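(* Let $k$ be a positive integer and let $P_k(x)$ be the polynomial of degree $k^2$ defined below. Write $$P_k(x)=c_0(k)x^{k^2}+c_1(k)x^{k^2-1}+\cdots+c_{k^2}(k).$$ Then for every $0\le r\le k^2$, $$c_r(k)=a_k\prod_{l=0}^{k-1}\frac{l!}{(k+l)!}\sum_{|\alpha|+|\beta|=r}2^{1-\delta(\alpha;\beta)}\,b_k(\alpha;\beta)\,N_k(\alpha;\beta),$$ where the sum runs over all pairs $(\alpha;\beta)$ of partitions with at most $k$ parts each, with $|\alpha|+|\beta|=r$ and $\alpha\ge\beta$ in lexicographic order (each pair is counted once). Here $\delta(\alpha;\beta)=1$ if $\alpha=\beta$ and $0$ otherwise.
   Context: Notation: $e(\theta)=\exp(2\pi i\theta)$; $\Delta(z_1,\dots,z_m)=\prod_{1\le i<j\le m}(z_j-z_i)$; $\zeta$ is the Riemann zeta function. For a positive integer $k$ define, for $z=(z_1,\dots,z_{2k})$ near $0$, the Euler product $$A_k(z)=\prod_p\prod_{i,j=1}^k\bigl(1-p^{-1-z_i+z_{k+j}}\bigr)\int_0^1\prod_{j=1}^k\Bigl(1-\tfrac{e(\theta)}{p^{1/2+z_j}}\Bigr)^{-1}\Bigl(1-\tfrac{e(-\theta)}{p^{1/2-z_{k+j}}}\Bigr)^{-1}d\theta,$$ let $G(z)=A_k(z)\prod_{i,j=1}^k\zeta(1+z_i-z_{j+k})$, and $$P_k(x)=\frac{(-1)^k}{k!^2}\frac{1}{(2\pi i)^{2k}}\oint\cdots\oint\frac{G(z)\Delta(z_1,\dots,z_{2k})^2}{\prod_{i=1}^{2k}z_i^{2k}}e^{\frac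 x2\sum_{i=1}^k(z_i-z_{i+k})}\,dz_1\cdots dz_{2k},$$ integrating over small circles about $z_i=0$. Let $a_k=\prod_p(1-p^{-1})^{k^2}\,{}_2F_1(k,k;1;1/p)$ (Gauss hypergeometric function); $a_k=A_k(0,\dots,0)$. $b_k(\alpha;\beta)$: for $k$-tuples $\alpha=(\alpha_1,\dots,\alpha_k)$, $\beta=(\beta_1,\dots,\beta_k)$ of nonnegative integers, $b_k(\alpha;\beta)$ is the coefficient of $z_1^{\alpha_1}\cdots z_k^{\alpha_k}z_{k+1}^{\beta_1}\cdots z_{2k}^{\beta_k}$ in the Taylor series at $0$ of $$\frac{1}{a_k}A_k(z_1,\dots,z_{2k})\prod_{1\le i,j\le k}(z_i-z_{j+k})\zeta(1+z_i-z_{j+k}).$$ A partition with at most $k$ parts is identified with the nonincreasing $k$-tuple obtained by padding with zeros; $|\alpha|=\sum_i\alpha_i$. $\tilde M_k$: for $k$-tuples $a=(a_1,\dots,a_k)$, $b=(b_1,\dots,b_k)$ of nonnegative integers, $\tilde M_k(a,b)=(-1)^{\sum_i b_i}\det(m_{ij})_{1\le i,j\le 2k}$, where for $1\le i\le k$, $1\le j\le 2k$: $m_{ij}=\Gamma(2k-i-j+2-a_i)^{-1}$ and $m_{k+i,j}=(-1)^{i+j-1}\Gamma(2k-i-j+2-b_i)^{-1}$, with the convention $1/\Gamma(m)=0$ for $m\in\{0,-1,-2,\dots\}$. $N_k$: for partitions $\alpha,\beta$ with at most $k$ parts and $r=|\alpha|+|\beta|$, $$N_k(\alpha;\beta)=\frac{1}{2^{k^2-r}}\Bigl(\prod_{l=0}^{k-1}\frac{l!}{(k+l)!}\Bigr)^{-1}\sum_{\sigma(\alpha),\tau(\beta)}\tilde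 M_k(\sigma(\alpha),\tau(\beta)),$$ where the sum runs over all distinct rearrangements $\sigma(\alpha)=(\alpha_{\sigma_1},\dots,\alpha_{\sigma_k})$ of the $k$-tuple $\alpha$ and $\tau(\beta)$ of $\beta$ (two rearrangements are the same if they give the same $k$-tuple). *)

theory Defs
  imports "HOL-Complex_Analysis.Complex_Analysis" "HOL-Combinatorics.Multiset_Permutations"
begin

text \<open>Riemann zeta function, via the Dirichlet eta function (valid for Re s > 0, s not 1 + 2 pi i m / ln 2).
  Only values near s = 1 are used.\<close>
definition zeta :: "complex \<Rightarrow> complex" where
  "zeta s = (\<Sum>n. (-1) ^ n / (of_nat (Suc n)) powr s) / (1 - 2 powr (1 - s))"

definition e :: "real \<Rightarrow> complex" where
  "e \<theta> = exp (2 * of_real pi * \<i> * of_real \<theta>)"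

definition A_local :: "nat \<Rightarrow> (nat \<Rightarrow> complex) \<Rightarrow> nat \<Rightarrow> complex" where
  "A_local k z p =
     (\<Prod>i\<in>{1..k}. \<Prod>j\<in>{1..k}. 1 - of_nat p powr (- 1 - z i + z (k + j))) *
     integral {0..1} (\<lambda>\<theta>. \<Prod>j\<in>{1..k}.
        inverse (1 - e \<theta> / of_nat p powr (1/2 + z j)) *
        inverse (1 - e (- \<theta>) / of_nat p powr (1/2 - z (k + j))))"

definition A :: "nat \<Rightarrow> (nat \<Rightarrow> complex) \<Rightarrow> complex" where
  "A k z = (\<Prod>p. if prime p then A_local k z p else 1)"

definition G :: "nat \<Rightarrow> (nat \<Rightarrow> complex) \<Rightarrow> complex" where
  "G k z = A k z * (\<Prod>i\<in>{1..k}. \<Prod>j\<in>{1..k}. zeta (1 + z i - z (j + k)))"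

definition Vandermonde :: "nat \<Rightarrow> (nat \<Rightarrow> complex) \<Rightarrow> complex" where
  "Vandermonde m z = (\<Prod>j\<in>{1..m}. \<Prod>i\<in>{1..<j}. z j - z i)"

fun iter_circ :: "real \<Rightarrow> nat \<Rightarrow> ((nat \<Rightarrow> complex) \<Rightarrow> complex) \<Rightarrow> (nat \<Rightarrow> complex) \<Rightarrow> complex" where
  "iter_circ r 0 f z = f z"
| "iter_circ r (Suc n) f z =
     contour_integral (circlepath 0 r) (\<lambda>w. iter_circ r n f (z(Suc n := w)))"

text \<open>"Small circles": the integral is independent of the radius for small radii; we take the limit r -> 0+.\<close>
definition small_circ_int :: "nat \<Rightarrow> ((nat \<Rightarrow> complex) \<Rightarrow> complex) \<Rightarrow> complex" where
  "small_circ_int n f = Lim (at_right 0) (\<lambda>r. iter_circ r n f (\<lambda>_. 0))"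

definition P :: "nat \<Rightarrow> complex \<Rightarrow> complex" where
  "P k x = (-1) ^ k / (of_nat (fact k) ^ 2) * (1 / (2 * of_real pi * \<i>) ^ (2 * k)) *
     small_circ_int (2 * k) (\<lambda>z. G k z * Vandermonde (2 * k) z ^ 2 / (\<Prod>i\<in>{1..2*k}. z i ^ (2 * k))
        * exp (x / 2 * (\<Sum>i\<in>{1..k}. z i - z (i + k))))"

definition hyp2F1 :: "real \<Rightarrow> real \<Rightarrow> real \<Rightarrow> real \<Rightarrow> real" where
  "hyp2F1 a b c x = (\<Sum>n. pochhammer a n * pochhammer b n / (pochhammer c n * fact n) * x ^ n)"

definition a_const :: "nat \<Rightarrow> real" where
  "a_const k = (\<Prod>p. if prime p then (1 - 1 / real p) ^ (k ^ 2) * hyp2F1 (real k) (real k) 1 (1 / real p) else 1)"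

text \<open>Taylor coefficient at 0 of a function of z 1..z n, index n_i for z i, via Cauchy's formula.\<close>
definition taylor_coeff :: "nat \<Rightarrow> ((nat \<Rightarrow> complex) \<Rightarrow> complex) \<Rightarrow> (nat \<Rightarrow> nat) \<Rightarrow> complex" where
  "taylor_coeff n f ex = (1 / (2 * of_real pi * \<i>) ^ n) *
     small_circ_int n (\<lambda>z. f z / (\<Prod>i\<in>{1..n}. z i ^ (ex i + 1)))"

text \<open>k-tuples are lists of length k; alpha ! (i-1) is alpha_i.\<close>
definition b :: "nat \<Rightarrow> nat list \<Rightarrow> nat list \<Rightarrow> complex" where
  "b k \<alpha> \<beta> = taylor_coeff (2 * k)
     (\<lambda>z. 1 / of_real (a_const k) * A k z *
        (\<Prod>i\<in>{1..k}. \<Prod>j\<in>{1..k}. (z i - z (j + k)) * zeta (1 + z i - z (j + k))))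
     (\<lambda>i. if 1 \<le> i \<and> i \<le> k then \<alpha> ! (i - 1) else if k < i \<and> i \<le> 2 * k then \<beta> ! (i - k - 1) else 0)"

definition det_n :: "nat \<Rightarrow> (nat \<Rightarrow> nat \<Rightarrow> real) \<Rightarrow> real" where
  "det_n n m = (\<Sum>p | p permutes {0..<n}. of_int (sign p) * (\<Prod>i<n. m i (p i)))"

text \<open>M-tilde; 1-based (i,j) of the paper correspond to 0-based (i-1, j-1).\<close>
definition Mt :: "nat \<Rightarrow> nat list \<Rightarrow> nat list \<Rightarrow> real" where
  "Mt k a bb = (-1) ^ sum_list bb * det_n (2 * k) (\<lambda>i j.
     if i < k then rGamma (of_int (2 * int k - int i - int j - int (a ! i)))
     else (-1) ^ ((i - k) + j + 1) * rGamma (of_int (2 * int k - int (i - k) - int j - int (bb ! (i - k)))))"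

definition N :: "nat \<Rightarrow> nat list \<Rightarrow> nat list \<Rightarrow> real" where
  "N k \<alpha> \<beta> = 1 / 2 ^ (k ^ 2 - (sum_list \<alpha> + sum_list \<beta>)) *
     inverse (\<Prod>l<k. fact l / fact (k + l)) *
     (\<Sum>\<sigma>\<in>permutations_of_multiset (mset \<alpha>). \<Sum>\<tau>\<in>permutations_of_multiset (mset \<beta>). Mt k \<sigma> \<tau>)"

definition is_partition_k :: "nat \<Rightarrow> nat list \<Rightarrow> bool" where
  "is_partition_k k \<alpha> \<longleftrightarrow> length \<alpha> = k \<and> sorted_wrt (\<lambda>x y. x \<ge> y) \<alpha>"

definition lex_ge :: "nat list \<Rightarrow> nat list \<Rightarrow> bool" where
  "lex_ge \<alpha> \<beta> \<longleftrightarrow> \<alpha> = \<beta> \<or> (\<beta>, \<alpha>) \<in> lexord {(x, y). x < y}"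

definition coeff_c :: "nat \<Rightarrow> nat \<Rightarrow> complex" where
  "coeff_c k r = of_real (a_const k * (\<Prod>l<k. fact l / fact (k + l))) *
     (\<Sum>(\<alpha>, \<beta>) \<in> {(\<alpha>, \<beta>). is_partition_k k \<alpha> \<and> is_partition_k k \<beta> \<and>
          sum_list \<alpha> + sum_list \<beta> = r \<and> lex_ge \<alpha> \<beta>}.
        of_real (2 ^ (if \<alpha> = \<beta> then 0 else 1) * N k \<alpha> \<beta>) * b k \<alpha> \<beta>)"

end

theory Submission
  imports Defs
begin

text \<open>
  Near the origin, \<open>w * zeta (1 + w)\<close> and the Euler product \<open>A k\<close> are uniform limits of polynomials on a
  closed polydisc.  Every iterated contour integral in question is a bounded linear functional on the
  uniform closure of the polynomials, so an identity between such functionals (independence of the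
  radius, behaviour under permutations of the variables, the Taylor expansion of a product) only has to
  be checked on monomials, where the integral factors into one-dimensional residues.

  The factor \<open>Vandermonde (2 * k) z\<close> equals the product of the Vandermonde products of the two halves
  and of all \<open>z (j + k) - z i\<close>, and the latter cancel the poles of the zeta factors.  What remains of the
  zeta factors and \<open>A k\<close> is symmetric in each half, so the two smaller Vandermonde products may be replaced
  by \<open>(fact k)\<^sup>2\<close> times one monomial; the Leibniz expansion of the remaining Vandermonde determinant then
  turns the residues into the determinants \<open>Mt\<close>.  Exchanging the two halves with a change of sign
  multiplies both \<open>b\<close> and \<open>N\<close> by \<open>(-1) ^ r\<close>, whence the restriction to lexicographically ordered pairs.
\<close>

section \<open>Uniform closures of polynomial algebras\<close>

text \<open>Uniform closures fit because every operation that builds the integrand preserves them: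
  products, composition with a holomorphic function of one variable, infinite products with a
  summable majorant, and integration over \<theta>. Separate properties in several variables need
  not be tracked beyond this membership.

  The obstacle is the Euler product: its local factors contain terms of the size of 1/p, which are
  not summable over the primes. They cancel between the finite product and the integral over
  \<theta>, and the remainder is cubic in quantities of size \<open>p powr (- 1/2)\<close>. The
  radius 1/12 worsens that exponent to -5/12, and three times 5/12 still exceeds 1.

  The powers of x come from a degree count: after the denominator, the monomial and a term of the
  Leibniz expansion have taken their exponents, those left to the exponential add up to
  \<open>k ^ 2\<close> minus the degree of the Taylor term. This fixes the power of x, bounds r by
  \<open>k ^ 2\<close>, and makes every sum finite.\<close>

inductive_set polyfun :: "('a \<Rightarrow> complex) set \<Rightarrow> ('a \<Rightarrow> complex) set" for S where
  polyfun_const: "(\<lambda>_. c) \<in> polyfun S"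
| polyfun_gen: "g \<in> S \<Longrightarrow> f \<in> polyfun S \<Longrightarrow> (\<lambda>x. g x * f x) \<in> polyfun S"
| polyfun_add: "f \<in> polyfun S \<Longrightarrow> g \<in> polyfun S \<Longrightarrow> (\<lambda>x. f x + g x) \<in> polyfun S"

text \<open>Only the values of \<open>f\<close> on \<open>K\<close> are constrained, so functions on
  the whole type with arbitrary values off \<open>K\<close> need no restriction.\<close>

definition unif_closure :: "('a \<Rightarrow> complex) set \<Rightarrow> 'a set \<Rightarrow> ('a \<Rightarrow> complex) set" where
  "unif_closure S K = {f. \<forall>\<epsilon>>0. \<exists>g\<in>polyfun S. \<forall>x\<in>K. norm (f x - g x) < \<epsilon>}"

lemma unif_closureD:
  "f \<in> unif_closure S K \<Longrightarrow> \<epsilon> > 0 \<Longrightarrow> \<exists>g\<in>polyfun S. \<forall>x\<in>K. norm (f x - g x) < \<epsilon>"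
  by (auto simp: unif_closure_def)

lemma polyfun_scale: "f \<in> polyfun S \<Longrightarrow> (\<lambda>x. c * f x) \<in> polyfun S"
proof (induction rule: polyfun.induct)
  case (polyfun_const d)
  show ?case by (rule polyfun.polyfun_const)
next
  case (polyfun_gen g f)
  have "(\<lambda>x. g x * (c * f x)) \<in> polyfun S"
    by (intro polyfun.polyfun_gen polyfun_gen)
  then show ?case by (simp add: mult.left_commute)
next
  case (polyfun_add f g)
  then show ?case by (simp add: distrib_left polyfun.polyfun_add)
qed

lemma polyfun_mult: "f \<in> polyfun S \<Longrightarrow> h \<in> polyfun S \<Longrightarrow> (\<lambda>x. f x * h x) \<in> polyfun S"
proof (induction rule: polyfun.induct)
  case (polyfun_const c)
  then show ?case by (rule polyfun_scale)
next
  case (polyfun_gen g f)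
  then have "(\<lambda>x. g x * (f x * h x)) \<in> polyfun S"
    by (intro polyfun.polyfun_gen[OF polyfun_gen(1)])
  then show ?case by (simp add: mult.assoc)
next
  case (polyfun_add f g)
  then show ?case by (simp add: distrib_right polyfun.polyfun_add)
qed

lemma polyfun_subset_unif_closure: "f \<in> polyfun S \<Longrightarrow> f \<in> unif_closure S K"
  unfolding unif_closure_def by (auto intro!: bexI[of _ f])

lemma unif_closure_const [simp]: "(\<lambda>_. c) \<in> unif_closure S K"
  by (intro polyfun_subset_unif_closure polyfun_const)

lemma unif_closure_gen: "g \<in> S \<Longrightarrow> g \<in> unif_closure S K"
  using polyfun_subset_unif_closure[OF polyfun_gen[OF _ polyfun_const[of 1]], of g S K] by simp

lemma unif_closure_add:
  assumes "f \<in> unif_closure S K" "g \<in> unif_closure S K"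
  shows "(\<lambda>x. f x + g x) \<in> unif_closure S K"
  unfolding unif_closure_def
proof safe
  fix \<epsilon> :: real assume "\<epsilon> > 0"
  then obtain p q where p: "p \<in> polyfun S" "\<forall>x\<in>K. norm (f x - p x) < \<epsilon> / 2"
    and q: "q \<in> polyfun S" "\<forall>x\<in>K. norm (g x - q x) < \<epsilon> / 2"
    using unif_closureD[OF assms(1), of "\<epsilon>/2"] unif_closureD[OF assms(2), of "\<epsilon>/2"] by auto
  have "norm (f x + g x - (p x + q x)) < \<epsilon>" if "x \<in> K" for x
  proof -
    have "norm (f x + g x - (p x + q x)) \<le> norm (f x - p x) + norm (g x - q x)"
      by norm
    then show ?thesis using p(2) q(2) that by (smt (verit) field_sum_of_halves)
  qed
  then show "\<exists>h\<in>polyfun S. \<forall>x\<in>K. norm (f x + g x - h x) < \<epsilon>"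
    using polyfun_add[OF p(1) q(1)] by (intro bexI) auto
qed

lemma unif_closure_uniform_limit:
  assumes "\<And>\<epsilon>. \<epsilon> > 0 \<Longrightarrow> \<exists>g\<in>unif_closure S K. \<forall>x\<in>K. norm (f x - g x) < \<epsilon>"
  shows "f \<in> unif_closure S K"
  unfolding unif_closure_def
proof safe
  fix \<epsilon> :: real assume "\<epsilon> > 0"
  then obtain g where g: "g \<in> unif_closure S K" "\<forall>x\<in>K. norm (f x - g x) < \<epsilon> / 2"
    using assms[of "\<epsilon>/2"] by auto
  obtain p where p: "p \<in> polyfun S" "\<forall>x\<in>K. norm (g x - p x) < \<epsilon> / 2"
    using unif_closureD[OF g(1), of "\<epsilon>/2"] \<open>\<epsilon> > 0\<close> by auto
  have "norm (f x - p x) < \<epsilon>" if "x \<in> K" for x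
  proof -
    have "norm (f x - p x) \<le> norm (f x - g x) + norm (g x - p x)"
      by norm
    then show ?thesis using g(2) p(2) that by (smt (verit) field_sum_of_halves)
  qed
  then show "\<exists>h\<in>polyfun S. \<forall>x\<in>K. norm (f x - h x) < \<epsilon>"
    using p(1) by auto
qed

text \<open>Boundedness of the generators on \<open>K\<close> passes to the whole closure, and this
  is what makes a product of uniform limits a uniform limit.\<close>

locale bounded_gens =
  fixes S :: "('a \<Rightarrow> complex) set" and K :: "'a set"
  assumes bounded_gen: "g \<in> S \<Longrightarrow> bounded (g ` K)"
begin

lemma bounded_polyfun: "f \<in> polyfun S \<Longrightarrow> bounded (f ` K)"
proof (induction rule: polyfun.induct)
  case (polyfun_const c)
  show ?case by (rule bounded_subset[of "{c}"]) auto
next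
  case (polyfun_gen g f)
  from bounded_gen[OF polyfun_gen(1)] obtain B where B: "\<And>x. x \<in> K \<Longrightarrow> norm (g x) \<le> B"
    by (auto simp: bounded_iff)
  from polyfun_gen(3) obtain C where C: "\<And>x. x \<in> K \<Longrightarrow> norm (f x) \<le> C"
    by (auto simp: bounded_iff)
  have "norm (g x * f x) \<le> B * C" if "x \<in> K" for x
    unfolding norm_mult using B[OF that] C[OF that]
    by (intro mult_mono) (auto intro: order_trans[OF norm_ge_zero])
  then show ?case by (auto simp: bounded_iff)
next
  case (polyfun_add f g)
  then show ?case by (intro bounded_plus_comp)
qed

lemma bounded_unif_closure: "f \<in> unif_closure S K \<Longrightarrow> \<exists>B>0. \<forall>x\<in>K. norm (f x) \<le> B"
proof -
  assume "f \<in> unif_closure S K"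
  from unif_closureD[OF this, of 1]
  obtain p where p: "p \<in> polyfun S" "\<forall>x\<in>K. norm (f x - p x) < 1"
    by auto
  from bounded_polyfun[OF p(1)] obtain C where C: "\<And>x. x \<in> K \<Longrightarrow> norm (p x) \<le> C"
    by (auto simp: bounded_iff)
  have "norm (f x) \<le> 1 + \<bar>C\<bar>" if "x \<in> K" for x
  proof -
    have "norm (f x) \<le> norm (f x - p x) + norm (p x)" by norm
    then show ?thesis using p(2) C that by (smt (verit))
  qed
  then show ?thesis by (intro exI[of _ "1 + \<bar>C\<bar>"]) auto
qed

lemma unif_closure_mult:
  assumes "f \<in> unif_closure S K" "g \<in> unif_closure S K"
  shows "(\<lambda>x. f x * g x) \<in> unif_closure S K"
  unfolding unif_closure_def
proof safe
  fix \<epsilon> :: real assume "\<epsilon> > 0"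
  obtain B where B: "B > 0" "\<And>x. x \<in> K \<Longrightarrow> norm (f x) \<le> B"
    using bounded_unif_closure[OF assms(1)] by blast
  \<comment> \<open>\<open>q\<close> is chosen before \<open>p\<close>: the error of
    \<open>p\<close> gets multiplied by \<open>q\<close>, so its tolerance has to use a bound for
    \<open>q\<close> itself.\<close>
  obtain q where q: "q \<in> polyfun S" "\<forall>x\<in>K. norm (g x - q x) < \<epsilon> / (2 * B)"
    using unif_closureD[OF assms(2), of "\<epsilon>/(2*B)"] \<open>\<epsilon> > 0\<close> B by auto
  obtain C where C: "C > 0" "\<And>x. x \<in> K \<Longrightarrow> norm (q x) \<le> C"
    using bounded_unif_closure[OF polyfun_subset_unif_closure[OF q(1)]] by blast
  obtain p where p: "p \<in> polyfun S" "\<forall>x\<in>K. norm (f x - p x) < \<epsilon> / (2 * C)"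
    using unif_closureD[OF assms(1), of "\<epsilon>/(2*C)"] \<open>\<epsilon> > 0\<close> C by auto
  have "norm (f x * g x - (p x * q x)) < \<epsilon>" if "x \<in> K" for x
  proof -
    have "f x * g x - p x * q x = f x * (g x - q x) + (f x - p x) * q x"
      by (simp add: algebra_simps)
    then have "norm (f x * g x - p x * q x) \<le> norm (f x) * norm (g x - q x) + norm (f x - p x) * norm (q x)"
      by (metis norm_mult norm_triangle_ineq)
    also have "\<dots> \<le> B * norm (g x - q x) + norm (f x - p x) * C"
      using B C that by (intro add_mono mult_right_mono mult_left_mono) auto
    also have "\<dots> < B * (\<epsilon> / (2 * B)) + \<epsilon> / (2 * C) * C"
      using B(1) C(1) p(2) q(2) that
      by (intro add_strict_mono mult_strict_right_mono mult_strict_left_mono) auto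
    also have "\<dots> = \<epsilon>" using B(1) C(1) by simp
    finally show ?thesis .
  qed
  then show "\<exists>h\<in>polyfun S. \<forall>x\<in>K. norm (f x * g x - h x) < \<epsilon>"
    using polyfun_mult[OF p(1) q(1)] by (intro bexI) auto
qed

lemma unif_closure_cmult: "f \<in> unif_closure S K \<Longrightarrow> (\<lambda>x. c * f x) \<in> unif_closure S K"
  by (rule unif_closure_mult) auto

lemma unif_closure_diff:
  "f \<in> unif_closure S K \<Longrightarrow> g \<in> unif_closure S K \<Longrightarrow> (\<lambda>x. f x - g x) \<in> unif_closure S K"
  using unif_closure_add[OF _ unif_closure_cmult[of g "-1"]] by simp

lemma unif_closure_sum:
  "(\<And>i. i \<in> I \<Longrightarrow> f i \<in> unif_closure S K) \<Longrightarrow> (\<lambda>x. \<Sum>i\<in>I. f i x) \<in> unif_closure S K"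
  by (induction I rule: infinite_finite_induct) (auto intro: unif_closure_add)

lemma unif_closure_prod:
  "(\<And>i. i \<in> I \<Longrightarrow> f i \<in> unif_closure S K) \<Longrightarrow> (\<lambda>x. \<Prod>i\<in>I. f i x) \<in> unif_closure S K"
  by (induction I rule: infinite_finite_induct) (auto intro: unif_closure_mult)

lemma unif_closure_power:
  "f \<in> unif_closure S K \<Longrightarrow> (\<lambda>x. f x ^ n) \<in> unif_closure S K"
  by (induction n) (auto intro: unif_closure_mult)

text \<open>The Taylor polynomials of \<open>h\<close> at 0 converge uniformly on the closed disc of
  radius \<open>c\<close>, which lies strictly inside the disc of holomorphy; substituting
  \<open>f\<close> into them stays in the closure.\<close>

lemma unif_closure_holomorphic_comp:
  assumes f: "f \<in> unif_closure S K" and le: "\<And>x. x \<in> K \<Longrightarrow> norm (f x) \<le> c"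
    and c: "c < R" and h: "h holomorphic_on ball 0 R"
  shows "(\<lambda>x. h (f x)) \<in> unif_closure S K"
proof (cases "K = {}")
  case True
  then show ?thesis by (auto intro: unif_closure_uniform_limit bexI[OF _ unif_closure_const])
next
  case False
  then have c0: "0 \<le> c" using le by (meson ex_in_conv norm_ge_zero order_trans)
  define a where "a = (\<lambda>n. (deriv ^^ n) h 0 / fact n)"
  have sums: "(\<lambda>n. a n * w ^ n) sums h w" if "norm w < R" for w
    using holomorphic_power_series[OF h, of w] that by (simp add: a_def)
  \<comment> \<open>A point strictly between \<open>c\<close> and \<open>R\<close>: convergence at
    \<open>s\<close> gives absolute convergence at \<open>c\<close>, hence the majorant for the
    M-test.\<close>
  define s where "s = (c + R) / 2"
  have s: "c < s" "s < R" "0 < s" using c c0 by (auto simp: s_def)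
  have "summable (\<lambda>n. norm (a n * of_real c ^ n))"
    by (rule powser_insidea[of _ "of_real s"]) (use sums[of "of_real s"] s c0 in \<open>auto simp: sums_iff\<close>)
  then have sc: "summable (\<lambda>n. norm (a n) * c ^ n)"
    using c0 by (simp add: norm_mult norm_power)
  have ul: "uniform_limit K (\<lambda>n x. \<Sum>i<n. a i * f x ^ i) (\<lambda>x. \<Sum>i. a i * f x ^ i) sequentially"
    by (rule Weierstrass_m_test[OF _ sc])
      (auto simp: norm_mult norm_power intro!: mult_left_mono power_mono le)
  show ?thesis
  proof (rule unif_closure_uniform_limit)
    fix \<epsilon> :: real assume "\<epsilon> > 0"
    from uniform_limitD[OF ul this] obtain n
      where n: "\<forall>x\<in>K. dist (\<Sum>i<n. a i * f x ^ i) (\<Sum>i. a i * f x ^ i) < \<epsilon>"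
      by (auto simp: eventually_sequentially)
    have "(\<lambda>x. \<Sum>i<n. a i * f x ^ i) \<in> unif_closure S K"
      by (intro unif_closure_sum unif_closure_cmult unif_closure_power f)
    moreover have "(\<Sum>i. a i * f x ^ i) = h (f x)" if "x \<in> K" for x
      using sums[of "f x"] le[OF that] c by (simp add: sums_iff)
    ultimately show "\<exists>g\<in>unif_closure S K. \<forall>x\<in>K. norm (h (f x) - g x) < \<epsilon>"
      using n by (intro bexI) (auto simp: dist_norm norm_minus_commute)
  qed
qed

lemma unif_closure_exp: 
  assumes f: "f \<in> unif_closure S K"
  shows "(\<lambda>x. exp (f x)) \<in> unif_closure S K"
proof -
  obtain B where B: "B > 0" "\<And>x. x \<in> K \<Longrightarrow> norm (f x) \<le> B"
    using bounded_unif_closure[OF f] by blast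
  show ?thesis
    by (rule unif_closure_holomorphic_comp[OF f B(2), of "B+1"]) (auto intro: holomorphic_intros)
qed

lemma unif_closure_inverse_one_minus: 
  assumes f: "f \<in> unif_closure S K" and le: "\<And>x. x \<in> K \<Longrightarrow> norm (f x) \<le> c" and "c < 1"
  shows "(\<lambda>x. inverse (1 - f x)) \<in> unif_closure S K"
  by (rule unif_closure_holomorphic_comp[OF f le \<open>c < 1\<close>, where h = "\<lambda>w. inverse (1 - w)"])
    (auto intro!: holomorphic_intros)

text \<open>Substitution commutes with sums, products and uniform limits, so only the substituted
  generators have to be examined.\<close>

lemma unif_closure_pullback:
  assumes "f \<in> unif_closure S' K'" "\<And>x. x \<in> K \<Longrightarrow> \<phi> x \<in> K'"
    and gens: "\<And>g. g \<in> S' \<Longrightarrow> (\<lambda>x. g (\<phi> x)) \<in> unif_closure S K"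
  shows "(\<lambda>x. f (\<phi> x)) \<in> unif_closure S K"
proof (rule unif_closure_uniform_limit)
  fix \<epsilon> :: real assume "\<epsilon> > 0"
  from unif_closureD[OF assms(1) this] obtain g where g: "g \<in> polyfun S'" "\<forall>x\<in>K'. norm (f x - g x) < \<epsilon>"
    by auto
  from g(1) have "(\<lambda>x. g (\<phi> x)) \<in> unif_closure S K"
    by (induction rule: polyfun.induct) (auto intro: unif_closure_mult unif_closure_add gens)
  then show "\<exists>g\<in>unif_closure S K. \<forall>x\<in>K. norm (f (\<phi> x) - g x) < \<epsilon>"
    using g(2) assms(2) by (intro bexI) auto
qed

text \<open>The partial products are bounded by \<open>exp (suminf M)\<close>, and a block of later
  factors differs from 1 by at most \<open>exp\<close> of a tail of \<open>M\<close>, minus 1. Hence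
  the partial products converge uniformly on \<open>K\<close>.\<close>

lemma unif_closure_prodinf:
  assumes f: "\<And>n. f n \<in> unif_closure S K"
    and le: "\<And>n x. x \<in> K \<Longrightarrow> norm (f n x - 1) \<le> M n" and M: "summable M"
  shows "(\<lambda>x. \<Prod>n. f n x) \<in> unif_closure S K"
proof (cases "K = {}")
  case True
  then show ?thesis by (auto intro: unif_closure_uniform_limit bexI[OF _ unif_closure_const])
next
  case False
  then have M0: "M n \<ge> 0" for n using le by (meson ex_in_conv norm_ge_zero order_trans)
  have lim: "(\<lambda>N. \<Prod>n\<le>N. f n x) \<longlonglongrightarrow> (\<Prod>n. f n x)" if "x \<in> K" for x
  proof -
    have "summable (\<lambda>n. norm (f n x - 1))"
      by (rule summable_comparison_test'[OF M, of 0]) (use le that in auto)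
    then have "convergent_prod (\<lambda>n. f n x)"
      by (intro abs_convergent_prod_imp_convergent_prod summable_imp_abs_convergent_prod)
    then show ?thesis by (rule convergent_prod_LIMSEQ)
  qed
  define B where "B = exp (suminf M)"
  have prod_le: "(\<Prod>n\<in>I. 1 + norm (f n x - 1)) \<le> exp (sum M I)" if "x \<in> K" "finite I" for I x
  proof -
    have "(\<Prod>n\<in>I. 1 + norm (f n x - 1)) \<le> (\<Prod>n\<in>I. exp (M n))"
      using le[OF that(1)] by (intro prod_mono) (auto intro: order_trans[OF _ exp_ge_add_one_self])
    also have "\<dots> = exp (sum M I)" using that(2) by (simp add: exp_sum)
    finally show ?thesis .
  qed
  show ?thesis
  proof (rule unif_closure_uniform_limit)
    fix \<epsilon> :: real assume "\<epsilon> > 0"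
    have "((\<lambda>s. exp s - 1) \<longlongrightarrow> exp 0 - (1::real)) (at 0)"
      by (intro tendsto_intros)
    then have "\<forall>\<^sub>F s in at 0. norm (exp s - 1 :: real) < \<epsilon> / (2 * B)"
      using \<open>\<epsilon> > 0\<close> by (auto simp: tendsto_iff B_def)
    then obtain d where d: "d > 0" "\<And>s. s \<noteq> 0 \<Longrightarrow> \<bar>s\<bar> < d \<Longrightarrow> exp s - 1 < \<epsilon> / (2 * B)"
      unfolding eventually_at by (force simp: dist_norm)
    obtain N where N: "\<And>n. n \<ge> N \<Longrightarrow> norm (\<Sum>i. M (i + n)) < d"
      using suminf_exist_split[OF \<open>d > 0\<close> M] by auto
    have tail: "sum M {N<..m} < d" for m
    proof -
      have "sum M {N<..m} = (\<Sum>i<m - N. M (i + Suc N))"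
        by (rule sum.reindex_bij_witness[of _ "\<lambda>i. i + Suc N" "\<lambda>i. i - Suc N"]) auto
      also have "\<dots> \<le> (\<Sum>i. M (i + Suc N))"
        by (intro sum_le_suminf summable_ignore_initial_segment M) (auto simp: M0)
      also have "\<dots> < d" using N[of "Suc N"] by auto
      finally show ?thesis .
    qed
    \<comment> \<open>The punctured neighbourhood that produced \<open>d\<close> says nothing about
      a vanishing tail sum, which is therefore treated apart.\<close>
    have exp_tail: "exp (sum M {N<..m}) - 1 \<le> \<epsilon> / (2 * B)" for m
    proof (cases "sum M {N<..m} = 0")
      case True
      then show ?thesis using \<open>\<epsilon> > 0\<close> by (simp add: B_def)
    next
      case False
      then show ?thesis using d(2)[of "sum M {N<..m}"] tail[of m] sum_nonneg[of "{N<..m}" M] M0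
        by fastforce
    qed
    have diff: "norm ((\<Prod>n\<le>m. f n x) - (\<Prod>n\<le>N. f n x)) \<le> \<epsilon> / 2" if "x \<in> K" "m \<ge> N" for x m
    proof -
      have "{..m} = {..N} \<union> {N<..m}" using that by auto
      then have eq: "(\<Prod>n\<le>m. f n x) = (\<Prod>n\<le>N. f n x) * (\<Prod>n\<in>{N<..m}. f n x)"
        by (simp add: prod.union_disjoint Int_def)
      have b1: "norm (\<Prod>n\<le>N. f n x) \<le> B"
      proof -
        have "norm (\<Prod>n\<le>N. f n x) \<le> (\<Prod>n\<le>N. 1 + norm (f n x - 1))"
          unfolding prod_norm[symmetric]
        proof (intro prod_mono conjI)
          fix n
          show "norm (f n x) \<le> 1 + norm (f n x - 1)"
            using norm_triangle_ineq[of 1 "f n x - 1"] by simp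
        qed auto
        also have "\<dots> \<le> exp (sum M {..N})" by (rule prod_le) (use that in auto)
        also have "\<dots> \<le> B" unfolding B_def by (auto intro!: sum_le_suminf M M0)
        finally show ?thesis .
      qed
      have b2: "norm ((\<Prod>n\<in>{N<..m}. f n x) - 1) \<le> \<epsilon> / (2 * B)"
        using norm_prod_minus1_le_prod_minus1[of "\<lambda>n. f n x - 1" "{N<..m}"]
          prod_le[OF that(1), of "{N<..m}"] exp_tail[of m] by simp
      have "norm ((\<Prod>n\<le>m. f n x) - (\<Prod>n\<le>N. f n x)) = norm (\<Prod>n\<le>N. f n x) * norm ((\<Prod>n\<in>{N<..m}. f n x) - 1)"
        unfolding eq by (simp add: algebra_simps flip: norm_mult)
      also have "\<dots> \<le> B * (\<epsilon> / (2 * B))"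
        by (intro mult_mono b1 b2) (auto simp: B_def)
      also have "\<dots> = \<epsilon> / 2" by (simp add: B_def)
      finally show ?thesis .
    qed
    have "norm ((\<Prod>n. f n x) - (\<Prod>n\<le>N. f n x)) \<le> \<epsilon> / 2" if "x \<in> K" for x
      by (rule tendsto_upperbound[OF tendsto_norm[OF tendsto_diff[OF lim[OF that] tendsto_const]]])
        (use diff[OF that] in \<open>auto simp: eventually_sequentially\<close>)
    then show "\<exists>g\<in>unif_closure S K. \<forall>x\<in>K. norm ((\<Prod>n. f n x) - g x) < \<epsilon>"
      using \<open>\<epsilon> > 0\<close> by (intro bexI[OF _ unif_closure_prod[of "{..N}" f]] f) force
  qed
qed

end

section \<open>Iterated contour integrals\<close>

text \<open>Coordinates outside \<open>I\<close> are free. After \<open>n\<close> integrations only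
  the coordinates above \<open>n\<close> remain as parameters, and \<open>I\<close> shrinks
  accordingly.\<close>

definition torus :: "real \<Rightarrow> nat set \<Rightarrow> (nat \<Rightarrow> complex) set" where
  "torus r I = {z. \<forall>i\<in>I. norm (z i) = r}"

lemma torus_upd: "z \<in> torus r {Suc n<..D} \<Longrightarrow> norm w = r \<Longrightarrow> z(Suc n := w) \<in> torus r {n<..D}"
  by (auto simp: torus_def)

lemma atLeast1_eq_greaterThan0: "{Suc 0..D} = {0<..D}"
  by auto

lemma continuous_on_coord: "continuous_on S (\<lambda>z::nat\<Rightarrow>complex. z i)"
  by (rule continuous_on_product_then_coordinatewise) (rule continuous_on_id)

lemma continuous_on_upd: "continuous_on S (\<lambda>w. (z::nat\<Rightarrow>complex)(n := w))"
proof (rule continuous_on_coordinatewise_then_product)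
  fix i
  show "continuous_on S (\<lambda>w. (z(n := w)) i)"
    by (cases "i = n") (auto intro: continuous_intros)
qed

text \<open>Continuity in the remaining coordinates is what makes the next contour integral exist.
  The contour integral is rewritten over the unit interval, where continuity of parameter integrals
  applies.\<close>

lemma iter_circ_continuous:
  assumes r: "r > 0" and f: "continuous_on (torus r {1..D}) f" and "n \<le> D"
  shows "continuous_on (torus r {n<..D}) (iter_circ r n f)"
  using \<open>n \<le> D\<close>
proof (induction n)
  case 0
  have "iter_circ r 0 f = f" by (rule ext) simp
  then show ?case using f by (simp add: atLeast1_eq_greaterThan0)
next
  case (Suc n)
  let ?U = "torus r {Suc n<..D}"
  have eq: "iter_circ r (Suc n) f = (\<lambda>z. integral (cbox 0 1) (\<lambda>t. iter_circ r n f (z(Suc n := circlepath 0 r t)) *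
      (2 * pi * \<i> * r * exp (2 * of_real pi * \<i> * t))))"
    unfolding iter_circ.simps contour_integral_integral
    by (intro ext) (auto intro!: integral_cong simp: vector_derivative_circlepath)
  have circ: "continuous_on (?U \<times> cbox 0 1) (\<lambda>x. circlepath 0 r (snd x))"
    unfolding circlepath_def part_circlepath_def linepath_def by (intro continuous_intros)
  have upd: "continuous_on (?U \<times> cbox 0 1) (\<lambda>(z, t). z(Suc n := circlepath 0 r t))"
    unfolding case_prod_beta
  proof (rule continuous_on_coordinatewise_then_product)
    fix i
    have "continuous_on (?U \<times> cbox (0::real) 1) (\<lambda>x. fst x i)"
      by (rule continuous_on_compose2[OF continuous_on_coord[of UNIV]]) (auto intro: continuous_intros)
    then show "continuous_on (?U \<times> cbox 0 1) (\<lambda>x. ((fst x)(Suc n := circlepath 0 r (snd x))) i)"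
      using circ by (cases "i = Suc n") auto
  qed
  have img: "(\<lambda>(z, t). z(Suc n := circlepath 0 r t)) ` (?U \<times> cbox 0 1) \<subseteq> torus r {n<..D}"
  proof -
    have "circlepath 0 r t \<in> sphere 0 r" if "t \<in> cbox 0 1" for t
      using that r path_image_circlepath[of 0 r] by (auto simp: path_image_def simp del: path_image_circlepath)
    then show ?thesis
      by (auto intro!: torus_upd)
  qed
  have "continuous_on (?U \<times> cbox 0 1) (\<lambda>x. iter_circ r n f (case x of (z, t) \<Rightarrow> z(Suc n := circlepath 0 r t)))"
    by (rule continuous_on_compose2[OF Suc.IH upd]) (use img Suc.prems in auto)
  then show ?case unfolding eq
    by (intro integral_continuous_on_param) (auto simp: case_prod_beta intro!: continuous_intros)
qed

lemma iter_circ_integrable: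
  assumes "r > 0" "continuous_on (torus r {1..D}) f" "Suc n \<le> D" "z \<in> torus r {Suc n<..D}"
  shows "(\<lambda>w. iter_circ r n f (z(Suc n := w))) contour_integrable_on circlepath 0 r"
proof (rule contour_integrable_continuous_circlepath)
  show "continuous_on (path_image (circlepath 0 r)) (\<lambda>w. iter_circ r n f (z(Suc n := w)))"
    by (rule continuous_on_compose2[OF iter_circ_continuous[OF assms(1,2), of n] continuous_on_upd])
      (use assms in \<open>auto intro!: torus_upd\<close>)
qed

lemma iter_circ_add:
  assumes "r > 0" and f: "continuous_on (torus r {1..D}) f" and g: "continuous_on (torus r {1..D}) g"
  shows "n \<le> D \<Longrightarrow> z \<in> torus r {n<..D} \<Longrightarrow>
    iter_circ r n (\<lambda>z. f z + g z) z = iter_circ r n f z + iter_circ r n g z"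
proof (induction n arbitrary: z)
  case (Suc n)
  have "contour_integral (circlepath 0 r) (\<lambda>w. iter_circ r n (\<lambda>z. f z + g z) (z(Suc n := w))) =
    contour_integral (circlepath 0 r) (\<lambda>w. iter_circ r n f (z(Suc n := w)) + iter_circ r n g (z(Suc n := w)))"
    by (rule contour_integral_cong) (use Suc assms in \<open>auto intro!: torus_upd\<close>)
  also have "\<dots> = iter_circ r (Suc n) f z + iter_circ r (Suc n) g z"
    using Suc.prems assms by (simp add: contour_integral_add iter_circ_integrable)
  finally show ?case by simp
qed simp

lemma iter_circ_cmult:
  assumes "r > 0" and f: "continuous_on (torus r {1..D}) f"
  shows "n \<le> D \<Longrightarrow> z \<in> torus r {n<..D} \<Longrightarrow> iter_circ r n (\<lambda>z. c * f z) z = c * iter_circ r n f z"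
proof (induction n arbitrary: z)
  case (Suc n)
  have "contour_integral (circlepath 0 r) (\<lambda>w. iter_circ r n (\<lambda>z. c * f z) (z(Suc n := w))) =
    contour_integral (circlepath 0 r) (\<lambda>w. c * iter_circ r n f (z(Suc n := w)))"
    by (rule contour_integral_cong) (use Suc assms in \<open>auto intro!: torus_upd\<close>)
  also have "\<dots> = c * iter_circ r (Suc n) f z"
    using Suc.prems assms by (simp add: contour_integral_lmul iter_circ_integrable)
  finally show ?case by simp
qed simp

lemma iter_circ_norm_le:
  assumes "r > 0" and f: "continuous_on (torus r {1..D}) f" and B: "\<And>z. z \<in> torus r {1..D} \<Longrightarrow> norm (f z) \<le> B" "B \<ge> 0"
  shows "n \<le> D \<Longrightarrow> z \<in> torus r {n<..D} \<Longrightarrow> norm (iter_circ r n f z) \<le> B * (2 * pi * r) ^ n"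
proof (induction n arbitrary: z)
  case (Suc n)
  have "norm (iter_circ r (Suc n) f z) \<le> (B * (2 * pi * r) ^ n) * (2 * pi * r)"
    unfolding iter_circ.simps
    by (rule has_contour_integral_bound_circlepath
        [OF has_contour_integral_integral[OF iter_circ_integrable[OF assms(1,2) Suc.prems]]])
      (use assms Suc in \<open>auto intro!: torus_upd\<close>)
  then show ?case by (simp add: mult_ac)
qed (use B in \<open>auto simp: atLeast1_eq_greaterThan0\<close>)

text \<open>Integrands may differ on the diagonals, so the junk value of \<^const>\<open>zeta\<close> at its pole is harmless.\<close>
lemma iter_circ_cong_inj:
  assumes "r > 0" and fg: "\<And>z. z \<in> torus r {1..D} \<Longrightarrow> inj_on z {1..D} \<Longrightarrow> f z = g z"
  shows "n \<le> D \<Longrightarrow> z \<in> torus r {n<..D} \<Longrightarrow> inj_on z {n<..D} \<Longrightarrow> iter_circ r n f z = iter_circ r n g z"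
proof (induction n arbitrary: z)
  case (Suc n)
  show ?case unfolding iter_circ.simps
  \<comment> \<open>The coordinates above \<open>Suc n\<close> are already fixed, so only finitely
    many \<open>w\<close> coincide with one of them, and a contour integral ignores finitely many
    points.\<close>
  proof (rule contour_integral_spike_finite_simple_path[of "z ` {Suc n<..D}"])
    fix w assume w: "w \<in> path_image (circlepath 0 r) - z ` {Suc n<..D}"
    have "{n<..D} = insert (Suc n) {Suc n<..D}" using Suc.prems by auto
    moreover have "inj_on (z(Suc n := w)) (insert (Suc n) {Suc n<..D})"
      using w Suc.prems(3) by (auto simp: inj_on_def)
    ultimately show "iter_circ r n f (z(Suc n := w)) = iter_circ r n g (z(Suc n := w))"
      using w Suc.prems(1,2) \<open>r > 0\<close> by (intro Suc.IH torus_upd) (auto simp del: fun_upd_apply)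
  qed (use \<open>r > 0\<close> in \<open>auto simp: simple_path_circlepath\<close>)
qed (use fg in \<open>auto simp: atLeast1_eq_greaterThan0\<close>)

lemma iter_circ_prod:
  assumes r: "r > 0" and g: "\<And>i. i \<in> {1..D} \<Longrightarrow> continuous_on (sphere 0 r) (g i)"
  shows "n \<le> D \<Longrightarrow> iter_circ r n (\<lambda>z. \<Prod>i\<in>{1..D}. g i (z i)) z =
    (\<Prod>i\<in>{1..n}. contour_integral (circlepath 0 r) (g i)) * (\<Prod>i\<in>{n<..D}. g i (z i))"
proof (induction n arbitrary: z)
  case (Suc n)
  let ?c = "\<Prod>i\<in>{1..n}. contour_integral (circlepath 0 r) (g i)"
  let ?d = "\<Prod>i\<in>{Suc n<..D}. g i (z i)"
  have *: "{n<..D} = insert (Suc n) {Suc n<..D}" using Suc.prems by auto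
  have "iter_circ r (Suc n) (\<lambda>z. \<Prod>i\<in>{1..D}. g i (z i)) z =
    contour_integral (circlepath 0 r) (\<lambda>w. (?c * ?d) * g (Suc n) w)"
    using Suc unfolding iter_circ.simps
    by (intro contour_integral_cong) (auto simp: * mult_ac intro!: prod.cong)
  also have "\<dots> = (?c * ?d) * contour_integral (circlepath 0 r) (g (Suc n))"
    by (intro contour_integral_lmul contour_integrable_continuous_circlepath) (use g Suc.prems r in auto)
  finally show ?case by (simp add: mult_ac)
qed (simp add: atLeast1_eq_greaterThan0)

section \<open>Residues of monomials times an exponential\<close>

definition exp_coeff :: "complex \<Rightarrow> int \<Rightarrow> complex" where
  "exp_coeff s j = (if j < 0 then 0 else s ^ nat j / fact (nat j))"

lemma exp_coeff_0: "exp_coeff 0 j = (if j = 0 then 1 else 0)"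
  by (auto simp: exp_coeff_def power_0_left)

lemma higher_deriv_exp_mult: "(deriv ^^ n) (\<lambda>w. exp (s * w)) = (\<lambda>w. s ^ n * exp (s * w) :: complex)"
proof (induction n)
  case (Suc n)
  have "deriv (\<lambda>w. s ^ n * exp (s * w)) w = s ^ Suc n * exp (s * w)" for w
    by (rule DERIV_imp_deriv) (auto intro!: derivative_eq_intros)
  then show ?case using Suc by simp
qed simp

text \<open>For \<open>a \<le> m\<close> Cauchy's formula yields a derivative of the exponential;
  otherwise the integrand extends holomorphically and the integral vanishes. The integer argument of
  \<open>exp_coeff\<close> covers both cases.\<close>

lemma contour_integral_exp_monomial:
  assumes r: "r > 0"
  shows "contour_integral (circlepath 0 r) (\<lambda>w. w ^ a * exp (s * w) / w ^ Suc m) =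
    2 * of_real pi * \<i> * exp_coeff s (int m - int a)"
proof (cases "a \<le> m")
  case True
  have "contour_integral (circlepath 0 r) (\<lambda>w. w ^ a * exp (s * w) / w ^ Suc m) =
    contour_integral (circlepath 0 r) (\<lambda>w. exp (s * w) / (w - 0) ^ Suc (m - a))"
  proof (rule contour_integral_cong)
    fix w assume "w \<in> path_image (circlepath 0 r)"
    then have "w \<noteq> 0" using r by auto
    moreover have "w ^ Suc m = w ^ a * w ^ Suc (m - a)"
      using True by (simp flip: power_add)
    ultimately show "w ^ a * exp (s * w) / w ^ Suc m = exp (s * w) / (w - 0) ^ Suc (m - a)"
      by simp
  qed simp
  also have "\<dots> = (2 * pi * \<i>) / fact (m - a) * (deriv ^^ (m - a)) (\<lambda>w. exp (s * w)) 0"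
    by (subst Cauchy_contour_integral_circlepath) (use r in \<open>auto intro!: holomorphic_intros continuous_intros\<close>)
  finally show ?thesis using True by (simp add: higher_deriv_exp_mult exp_coeff_def flip: of_nat_diff)
next
  case False
  have "contour_integral (circlepath 0 r) (\<lambda>w. w ^ a * exp (s * w) / w ^ Suc m) =
    contour_integral (circlepath 0 r) (\<lambda>w. w ^ (a - Suc m) * exp (s * w))"
  proof (rule contour_integral_cong)
    fix w assume "w \<in> path_image (circlepath 0 r)"
    then have "w \<noteq> 0" using r by auto
    moreover have "w ^ a = w ^ Suc m * w ^ (a - Suc m)"
      using False by (simp flip: power_add power_Suc)
    ultimately show "w ^ a * exp (s * w) / w ^ Suc m = w ^ (a - Suc m) * exp (s * w)"
      by simp
  qed simp
  also have "\<dots> = 0"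
    by (rule contour_integral_unique, rule Cauchy_theorem_convex_simple[of _ UNIV])
      (auto intro!: holomorphic_intros)
  finally show ?thesis using False by (simp add: exp_coeff_def)
qed

section \<open>Taylor coefficients as bounded functionals\<close>

definition coords :: "nat \<Rightarrow> ((nat \<Rightarrow> complex) \<Rightarrow> complex) set" where
  "coords n = (\<lambda>i z. z i) ` {1..n}"

definition polydisc :: "real \<Rightarrow> nat \<Rightarrow> (nat \<Rightarrow> complex) set" where
  "polydisc \<rho> n = {z. \<forall>i\<in>{1..n}. norm (z i) \<le> \<rho>}"

abbreviation polydisc_alg :: "real \<Rightarrow> nat \<Rightarrow> ((nat \<Rightarrow> complex) \<Rightarrow> complex) set" where
  "polydisc_alg \<rho> n \<equiv> unif_closure (coords n) (polydisc \<rho> n)"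

interpretation pd: bounded_gens "coords n" "polydisc \<rho> n" for n \<rho>
  by unfold_locales (auto simp: coords_def polydisc_def bounded_iff)

lemma polydisc_alg_coord: "i \<in> {1..n} \<Longrightarrow> (\<lambda>z. z i) \<in> polydisc_alg \<rho> n"
  by (rule unif_closure_gen) (auto simp: coords_def)

definition monomial :: "nat \<Rightarrow> (nat \<Rightarrow> nat) \<Rightarrow> (nat \<Rightarrow> complex) \<Rightarrow> complex" where
  "monomial n a z = (\<Prod>i\<in>{1..n}. z i ^ a i)"

lemma polydisc_alg_mono: "monomial n a \<in> polydisc_alg \<rho> n"
proof -
  have "(\<lambda>z. \<Prod>i\<in>{1..n}. z i ^ a i) \<in> polydisc_alg \<rho> n"
    by (intro pd.unif_closure_prod pd.unif_closure_power polydisc_alg_coord)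
  then show ?thesis by (simp add: monomial_def[abs_def])
qed

lemma monomial_0: "monomial n (\<lambda>_. 0) z = 1"
  by (simp add: monomial_def)

lemma monomial_add: "monomial n (\<lambda>i. a i + c i) z = monomial n a z * monomial n c z"
  by (simp add: monomial_def power_add prod.distrib)

lemma coord_times_mono:
  assumes "i \<in> {1..n}"
  shows "z i * monomial n a z = monomial n (a(i := Suc (a i))) z"
proof -
  have *: "(\<Prod>j\<in>{1..n} - {i}. z j ^ (a(i := Suc (a i))) j) = (\<Prod>j\<in>{1..n} - {i}. z j ^ a j)"
    by (rule prod.cong) auto
  show ?thesis unfolding monomial_def
    by (subst (1 2) prod.remove[OF _ assms]) (simp_all only: * finite_atLeastAtMost fun_upd_same power_Suc mult.assoc)
qed

lemma continuous_on_polydisc_alg: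
  assumes "f \<in> polydisc_alg \<rho> n"
  shows "continuous_on (polydisc \<rho> n) f"
proof -
  have "\<forall>m. \<exists>p\<in>polyfun (coords n). \<forall>z\<in>polydisc \<rho> n. norm (f z - p z) < inverse (real (Suc m))"
    using unif_closureD[OF assms] by auto
  then obtain p where p: "\<And>m. p m \<in> polyfun (coords n)"
    "\<And>m z. z \<in> polydisc \<rho> n \<Longrightarrow> norm (f z - p m z) < inverse (real (Suc m))"
    by metis
  have "continuous_on X g" if "g \<in> polyfun (coords n)" for X g
    using that by (induction rule: polyfun.induct)
      (auto simp: coords_def intro!: continuous_intros continuous_on_coord)
  then have cont: "\<forall>\<^sub>F m in sequentially. continuous_on (polydisc \<rho> n) (p m)"
    using p(1) by simp
  have ul: "uniform_limit (polydisc \<rho> n) p f sequentially"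
  proof (rule uniform_limitI)
    fix \<epsilon> :: real assume "\<epsilon> > 0"
    then obtain M where M: "inverse (real (Suc M)) < \<epsilon>" using reals_Archimedean by blast
    have "dist (p m z) (f z) < \<epsilon>" if "m \<ge> M" "z \<in> polydisc \<rho> n" for m z
    proof -
      have "inverse (real (Suc m)) \<le> inverse (real (Suc M))"
        using that by (intro le_imp_inverse_le) auto
      moreover have "norm (p m z - f z) < inverse (real (Suc m))"
        using p(2)[OF that(2), of m] by (simp add: norm_minus_commute)
      ultimately show ?thesis using M unfolding dist_norm by linarith
    qed
    then show "\<forall>\<^sub>F m in sequentially. \<forall>z\<in>polydisc \<rho> n. dist (p m z) (f z) < \<epsilon>"
      by (auto simp: eventually_sequentially)
  qed
  show ?thesis by (rule uniform_limit_theorem[OF cont ul]) simp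
qed

lemma torus_subset_polydisc: "r \<le> \<rho> \<Longrightarrow> torus r {1..n} \<subseteq> polydisc \<rho> n"
  by (auto simp: torus_def polydisc_def)

section \<open>Bounded functionals on the polydisc algebra\<close>

definition bounded_functional :: "real \<Rightarrow> nat \<Rightarrow> (((nat \<Rightarrow> complex) \<Rightarrow> complex) \<Rightarrow> complex) \<Rightarrow> bool" where
  "bounded_functional \<rho> n \<Psi> \<longleftrightarrow>
     (\<forall>f\<in>polydisc_alg \<rho> n. \<forall>c. \<Psi> (\<lambda>z. c * f z) = c * \<Psi> f) \<and>
     (\<forall>f\<in>polydisc_alg \<rho> n. \<forall>g\<in>polydisc_alg \<rho> n. \<Psi> (\<lambda>z. f z + g z) = \<Psi> f + \<Psi> g) \<and>
     (\<exists>B. \<forall>f\<in>polydisc_alg \<rho> n. \<forall>C\<ge>0. (\<forall>z\<in>polydisc \<rho> n. norm (f z) \<le> C) \<longrightarrow> norm (\<Psi> f) \<le> B * C)"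

lemma bounded_functionalD:
  assumes "bounded_functional \<rho> n \<Psi>"
  shows "f \<in> polydisc_alg \<rho> n \<Longrightarrow> \<Psi> (\<lambda>z. c * f z) = c * \<Psi> f"
    "f \<in> polydisc_alg \<rho> n \<Longrightarrow> g \<in> polydisc_alg \<rho> n \<Longrightarrow> \<Psi> (\<lambda>z. f z + g z) = \<Psi> f + \<Psi> g"
    "\<exists>B>0. \<forall>f\<in>polydisc_alg \<rho> n. \<forall>C\<ge>0. (\<forall>z\<in>polydisc \<rho> n. norm (f z) \<le> C) \<longrightarrow> norm (\<Psi> f) \<le> B * C"
proof -
  from assms obtain B where B: "\<And>f C. f\<in>polydisc_alg \<rho> n \<Longrightarrow> C \<ge> 0 \<Longrightarrow> (\<forall>z\<in>polydisc \<rho> n. norm (f z) \<le> C) \<Longrightarrow> norm (\<Psi> f) \<le> B * C"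
    unfolding bounded_functional_def by metis
  have "norm (\<Psi> f) \<le> (\<bar>B\<bar> + 1) * C"
    if "f\<in>polydisc_alg \<rho> n" "C \<ge> 0" "\<forall>z\<in>polydisc \<rho> n. norm (f z) \<le> C" for f C
    using B[OF that] mult_right_mono[of B "\<bar>B\<bar> + 1" C] that(2) by linarith
  then show "\<exists>B>0. \<forall>f\<in>polydisc_alg \<rho> n. \<forall>C\<ge>0. (\<forall>z\<in>polydisc \<rho> n. norm (f z) \<le> C) \<longrightarrow> norm (\<Psi> f) \<le> B * C"
    by (intro exI[of _ "\<bar>B\<bar> + 1"]) auto
qed (use assms in \<open>auto simp: bounded_functional_def\<close>)

text \<open>Monomials span the polynomials, the polynomials are dense for the sup norm on the
  polydisc, and both functionals are continuous for that norm.\<close>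

lemma bounded_functional_eqI:
  assumes \<Psi>: "bounded_functional \<rho> n \<Psi>" and \<Phi>: "bounded_functional \<rho> n \<Phi>"
    and monomial: "\<And>a. \<Psi> (monomial n a) = \<Phi> (monomial n a)" and f: "f \<in> polydisc_alg \<rho> n"
  shows "\<Psi> f = \<Phi> f"
proof -
  note D1 = bounded_functionalD[OF \<Psi>] and D2 = bounded_functionalD[OF \<Phi>]
  \<comment> \<open>A monomial prefactor is carried through the induction: each generator that
    \<open>polyfun\<close> multiplies on is absorbed by raising one exponent.\<close>
  have poly: "\<Psi> (\<lambda>z. monomial n a z * p z) = \<Phi> (\<lambda>z. monomial n a z * p z)" if "p \<in> polyfun (coords n)" for p a
    using that
  proof (induction arbitrary: a rule: polyfun.induct)
    case (polyfun_const c)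
    then show ?case
      using D1(1)[OF polydisc_alg_mono, of c a] D2(1)[OF polydisc_alg_mono, of c a] monomial
      by (simp add: mult.commute)
  next
    case (polyfun_gen g f)
    then obtain i where i: "i \<in> {1..n}" "g = (\<lambda>z. z i)" by (auto simp: coords_def)
    have "(\<lambda>z. monomial n a z * (g z * f z)) = (\<lambda>z. monomial n (a(i := Suc (a i))) z * f z)"
      using coord_times_mono[OF i(1)] i(2) by (auto simp: mult_ac)
    then show ?case by (simp only: polyfun_gen.IH)
  next
    case (polyfun_add f g)
    then have "(\<lambda>z. monomial n a z * f z) \<in> polydisc_alg \<rho> n" "(\<lambda>z. monomial n a z * g z) \<in> polydisc_alg \<rho> n"
      by (auto intro!: pd.unif_closure_mult[OF polydisc_alg_mono] intro: polyfun_subset_unif_closure)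
    then show ?case using D1(2) D2(2) polyfun_add.IH by (simp add: distrib_left)
  qed
  obtain B1 where B1: "B1 > 0" "\<forall>f\<in>polydisc_alg \<rho> n. \<forall>C\<ge>0. (\<forall>z\<in>polydisc \<rho> n. norm (f z) \<le> C) \<longrightarrow> norm (\<Psi> f) \<le> B1 * C"
    using D1(3) by blast
  obtain B2 where B2: "B2 > 0" "\<forall>f\<in>polydisc_alg \<rho> n. \<forall>C\<ge>0. (\<forall>z\<in>polydisc \<rho> n. norm (f z) \<le> C) \<longrightarrow> norm (\<Phi> f) \<le> B2 * C"
    using D2(3) by blast
  have "norm (\<Psi> f - \<Phi> f) \<le> 0 + \<epsilon>" if "\<epsilon> > 0" for \<epsilon>
  proof -
    define \<delta> where "\<delta> = \<epsilon> / (B1 + B2)"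
    have "\<delta> > 0" using that B1 B2 by (simp add: \<delta>_def)
    then obtain p where p: "p \<in> polyfun (coords n)" "\<forall>z\<in>polydisc \<rho> n. norm (f z - p z) < \<delta>"
      using unif_closureD[OF f] by blast
    define g where "g = (\<lambda>z. f z + (-1) * p z)"
    have pU: "p \<in> polydisc_alg \<rho> n" by (rule polyfun_subset_unif_closure[OF p(1)])
    have gU: "g \<in> polydisc_alg \<rho> n"
      unfolding g_def by (intro unif_closure_add f pd.unif_closure_cmult pU)
    have gb: "\<forall>z\<in>polydisc \<rho> n. norm (g z) \<le> \<delta>" using p(2) by (auto simp: g_def less_imp_le)
    have "\<Psi> p = \<Phi> p" using poly[OF p(1), of "\<lambda>_. 0"] by (simp add: monomial_0)
    moreover have "\<Psi> g = \<Psi> f + (-1) * \<Psi> p" unfolding g_def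
      by (subst D1(2)[OF f pd.unif_closure_cmult[OF pU]], subst D1(1)[OF pU]) simp
    moreover have "\<Phi> g = \<Phi> f + (-1) * \<Phi> p" unfolding g_def
      by (subst D2(2)[OF f pd.unif_closure_cmult[OF pU]], subst D2(1)[OF pU]) simp
    ultimately have "\<Psi> f - \<Phi> f = \<Psi> g - \<Phi> g" by simp
    also have "norm \<dots> \<le> B1 * \<delta> + B2 * \<delta>"
      using B1(2) B2(2) gU gb \<open>\<delta> > 0\<close> by (intro order_trans[OF norm_triangle_ineq4] add_mono) auto
    also have "\<dots> = (B1 + B2) * \<delta>" by (simp add: distrib_right)
    also have "\<dots> = \<epsilon>" using B1(1) B2(1) by (simp add: \<delta>_def)
    finally show ?thesis by simp
  qed
  then have "norm (\<Psi> f - \<Phi> f) \<le> 0" by (rule field_le_epsilon)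
  then show ?thesis by simp
qed

lemma bounded_functional_cmult:
  assumes "bounded_functional \<rho> n \<Psi>" shows "bounded_functional \<rho> n (\<lambda>f. c * \<Psi> f)"
proof -
  note D = bounded_functionalD[OF assms]
  obtain B where B: "\<forall>f\<in>polydisc_alg \<rho> n. \<forall>C\<ge>0. (\<forall>z\<in>polydisc \<rho> n. norm (f z) \<le> C) \<longrightarrow> norm (\<Psi> f) \<le> B * C"
    using D(3) by blast
  have "norm (c * \<Psi> f) \<le> (norm c * B) * C"
    if "f \<in> polydisc_alg \<rho> n" "C \<ge> 0" "\<forall>z\<in>polydisc \<rho> n. norm (f z) \<le> C" for f C
    using B that unfolding norm_mult mult.assoc by (intro mult_left_mono) auto
  then show ?thesis unfolding bounded_functional_def
    by (intro conjI exI[of _ "norm c * B"]) (use D(1,2) in \<open>auto simp: algebra_simps\<close>)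
qed

lemma bounded_functional_0: "bounded_functional \<rho> n (\<lambda>f. 0)"
  unfolding bounded_functional_def by (auto intro: exI[of _ 0])

lemma bounded_functional_add:
  assumes "bounded_functional \<rho> n \<Psi>" "bounded_functional \<rho> n \<Phi>"
  shows "bounded_functional \<rho> n (\<lambda>f. \<Psi> f + \<Phi> f)"
proof -
  note D1 = bounded_functionalD[OF assms(1)] and D2 = bounded_functionalD[OF assms(2)]
  obtain B1 where B1: "\<forall>f\<in>polydisc_alg \<rho> n. \<forall>C\<ge>0. (\<forall>z\<in>polydisc \<rho> n. norm (f z) \<le> C) \<longrightarrow> norm (\<Psi> f) \<le> B1 * C"
    using D1(3) by blast
  obtain B2 where B2: "\<forall>f\<in>polydisc_alg \<rho> n. \<forall>C\<ge>0. (\<forall>z\<in>polydisc \<rho> n. norm (f z) \<le> C) \<longrightarrow> norm (\<Phi> f) \<le> B2 * C"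
    using D2(3) by blast
  have "norm (\<Psi> f + \<Phi> f) \<le> (B1 + B2) * C"
    if "f \<in> polydisc_alg \<rho> n" "C \<ge> 0" "\<forall>z\<in>polydisc \<rho> n. norm (f z) \<le> C" for f C
    unfolding distrib_right using B1 B2 that by (intro norm_triangle_mono) auto
  then show ?thesis unfolding bounded_functional_def
    by (intro conjI exI[of _ "B1 + B2"]) (simp_all add: D1(1,2) D2(1,2) distrib_left)
qed

lemma bounded_functional_sum:
  "(\<And>i. i \<in> I \<Longrightarrow> bounded_functional \<rho> n (\<Psi> i)) \<Longrightarrow> bounded_functional \<rho> n (\<lambda>f. \<Sum>i\<in>I. \<Psi> i f)"
  by (induction I rule: infinite_finite_induct)
    (auto intro: bounded_functional_0 bounded_functional_add)

text \<open>Multiplication by a fixed \<open>g\<close> is bounded in the sup norm. The fixed factor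
  will be a monomial times an exponential.\<close>

lemma bounded_functional_mult:
  assumes "bounded_functional \<rho> n \<Psi>" and g: "g \<in> polydisc_alg \<rho> n"
  shows "bounded_functional \<rho> n (\<lambda>f. \<Psi> (\<lambda>z. f z * g z))"
proof -
  note D = bounded_functionalD[OF assms(1)]
  note closed = pd.unif_closure_mult[OF _ g]
  obtain B where B: "B > 0" "\<And>f C. f \<in> polydisc_alg \<rho> n \<Longrightarrow> C \<ge> 0 \<Longrightarrow> (\<forall>z\<in>polydisc \<rho> n. norm (f z) \<le> C) \<Longrightarrow> norm (\<Psi> f) \<le> B * C"
    using D(3) by blast
  obtain L where L: "L > 0" "\<forall>z\<in>polydisc \<rho> n. norm (g z) \<le> L"
    using pd.bounded_unif_closure[OF g] by blast
  have "norm (\<Psi> (\<lambda>z. f z * g z)) \<le> (B * L) * C"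
    if "f \<in> polydisc_alg \<rho> n" "C \<ge> 0" "\<forall>z\<in>polydisc \<rho> n. norm (f z) \<le> C" for f C
  proof -
    have "norm (\<Psi> (\<lambda>z. f z * g z)) \<le> B * (C * L)"
      by (rule B(2)) (use that L in \<open>auto intro!: closed mult_mono simp: norm_mult\<close>)
    then show ?thesis by (simp add: mult_ac)
  qed
  moreover have "\<Psi> (\<lambda>z. c * f z * g z) = c * \<Psi> (\<lambda>z. f z * g z)" if "f \<in> polydisc_alg \<rho> n" for c f
    using D(1)[OF closed[OF that], of c] by (simp add: mult.assoc)
  moreover have "\<Psi> (\<lambda>z. (f z + h z) * g z) = \<Psi> (\<lambda>z. f z * g z) + \<Psi> (\<lambda>z. h z * g z)"
    if "f \<in> polydisc_alg \<rho> n" "h \<in> polydisc_alg \<rho> n" for f h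
    using D(2)[OF closed[OF that(1)] closed[OF that(2)]] by (simp add: distrib_right)
  ultimately show ?thesis unfolding bounded_functional_def by blast
qed

text \<open>Composition with a self-map of the polydisc cannot increase the sup norm; the maps in
  question permute coordinates and multiply them by a unit.\<close>

lemma bounded_functional_pullback:
  assumes "bounded_functional \<rho> n \<Psi>" and \<phi>: "\<And>z. z \<in> polydisc \<rho> n \<Longrightarrow> \<phi> z \<in> polydisc \<rho> n"
    and gens: "\<And>i. i \<in> {1..n} \<Longrightarrow> (\<lambda>z. \<phi> z i) \<in> polydisc_alg \<rho> n"
  shows "bounded_functional \<rho> n (\<lambda>f. \<Psi> (\<lambda>z. f (\<phi> z)))"
proof -
  note D = bounded_functionalD[OF assms(1)]
  have closed: "(\<lambda>z. f (\<phi> z)) \<in> polydisc_alg \<rho> n" if "f \<in> polydisc_alg \<rho> n" for f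
    proof (rule pd.unif_closure_pullback[OF that \<phi>])
    fix g assume "g \<in> coords n"
    then obtain i where "i \<in> {1..n}" "g = (\<lambda>z. z i)" unfolding coords_def by blast
    then show "(\<lambda>z. g (\<phi> z)) \<in> polydisc_alg \<rho> n" using gens by simp
  qed
  obtain B where B: "B > 0" "\<And>f C. f \<in> polydisc_alg \<rho> n \<Longrightarrow> C \<ge> 0 \<Longrightarrow> (\<forall>z\<in>polydisc \<rho> n. norm (f z) \<le> C) \<Longrightarrow> norm (\<Psi> f) \<le> B * C"
    using D(3) by blast
  then show ?thesis unfolding bounded_functional_def
    using D(1,2) closed \<phi> by (intro conjI exI[of _ B]) auto
qed

section \<open>Taylor coefficients as torus integrals\<close>

definition tcoeff :: "real \<Rightarrow> nat \<Rightarrow> ((nat \<Rightarrow> complex) \<Rightarrow> complex) \<Rightarrow> (nat \<Rightarrow> nat) \<Rightarrow> complex" where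
  "tcoeff r n f a = iter_circ r n (\<lambda>z. f z / (\<Prod>i\<in>{1..n}. z i ^ (a i + 1))) (\<lambda>_. 0) / (2 * of_real pi * \<i>) ^ n"

lemma torus_empty [simp]: "torus r {} = UNIV"
  by (auto simp: torus_def)

text \<open>The denominator has constant modulus on the torus, so this is the Cauchy
  estimate.\<close>

lemma bounded_functional_tcoeff:
  assumes "0 < r" "r \<le> \<rho>"
  shows "bounded_functional \<rho> n (\<lambda>f. tcoeff r n f a)"
proof -
  define w where "w = (\<lambda>z::nat\<Rightarrow>complex. \<Prod>i\<in>{1..n}. z i ^ (a i + 1))"
  have w0: "w z \<noteq> 0" if "z \<in> torus r {1..n}" for z
    using that assms by (auto simp: w_def torus_def prod_zero_iff)
  have cw: "continuous_on X w" for X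
    unfolding w_def by (intro continuous_intros continuous_on_coord)
  have cont: "continuous_on (torus r {1..n}) (\<lambda>z. f z / w z)" if "f \<in> polydisc_alg \<rho> n" for f
    by (intro continuous_on_divide cw continuous_on_subset[OF continuous_on_polydisc_alg[OF that]]
        torus_subset_polydisc assms) (use w0 in auto)
  define R where "R = r ^ (\<Sum>i\<in>{1..n}. a i + 1)"
  have nw: "norm (w z) = R" if "z \<in> torus r {1..n}" for z
    using that unfolding w_def R_def power_sum prod_norm[symmetric] norm_power torus_def by auto
  have "R > 0" using assms by (simp add: R_def)
  have eq: "tcoeff r n f a = iter_circ r n (\<lambda>z. f z / w z) (\<lambda>_. 0) / (2 * of_real pi * \<i>) ^ n" for f
    by (simp add: tcoeff_def w_def)
  show ?thesis unfolding bounded_functional_def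
  proof (intro conjI ballI allI)
    fix f c assume "f \<in> polydisc_alg \<rho> n"
    from iter_circ_cmult[OF assms(1) cont[OF this], of n "\<lambda>_. 0" c]
    show "tcoeff r n (\<lambda>z. c * f z) a = c * tcoeff r n f a" by (simp add: eq)
  next
    fix f g assume "f \<in> polydisc_alg \<rho> n" "g \<in> polydisc_alg \<rho> n"
    from iter_circ_add[OF assms(1) cont[OF this(1)] cont[OF this(2)], of n "\<lambda>_. 0"]
    show "tcoeff r n (\<lambda>z. f z + g z) a = tcoeff r n f a + tcoeff r n g a"
      by (simp add: eq add_divide_distrib)
  next
    have "norm (tcoeff r n f a) \<le> ((2 * pi * r) ^ n / R / norm ((2 * of_real pi * \<i>) ^ n :: complex)) * C"
      if f: "f \<in> polydisc_alg \<rho> n" "C \<ge> 0" "\<forall>z\<in>polydisc \<rho> n. norm (f z) \<le> C" for f C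
    proof -
      have "norm (iter_circ r n (\<lambda>z. f z / w z) (\<lambda>_. 0)) \<le> (C / R) * (2 * pi * r) ^ n"
      proof (rule iter_circ_norm_le[OF assms(1) cont[OF f(1)]])
        fix z assume z: "z \<in> torus r {1..n}"
        then have "norm (f z) \<le> C" using torus_subset_polydisc[OF assms(2)] f(3) by blast
        then show "norm (f z / w z) \<le> C / R"
          using nw[OF z] \<open>R > 0\<close> by (simp add: norm_divide divide_right_mono)
      qed (use f(2) \<open>R > 0\<close> in auto)
      then have "norm (tcoeff r n f a) \<le> (C / R) * (2 * pi * r) ^ n / norm ((2 * of_real pi * \<i>) ^ n :: complex)"
        unfolding eq norm_divide by (rule divide_right_mono) auto
      then show ?thesis by (simp add: field_simps)
    qed
    then show "\<exists>B. \<forall>f\<in>polydisc_alg \<rho> n. \<forall>C\<ge>0. (\<forall>z\<in>polydisc \<rho> n. norm (f z) \<le> C) \<longrightarrow> norm (tcoeff r n f a) \<le> B * C"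
      by blast
  qed
qed

lemma tcoeff_mono_exp:
  assumes "r > 0"
  shows "tcoeff r n (\<lambda>z. monomial n \<alpha> z * (\<Prod>i\<in>{1..n}. exp (s i * z i))) a =
    (\<Prod>i\<in>{1..n}. exp_coeff (s i) (int (a i) - int (\<alpha> i)))"
proof -
  define g where "g = (\<lambda>i w. w ^ \<alpha> i * exp (s i * w) / w ^ Suc (a i))"
  have "iter_circ r n (\<lambda>z. \<Prod>i\<in>{1..n}. g i (z i)) (\<lambda>_. 0) =
     (\<Prod>i\<in>{1..n}. contour_integral (circlepath 0 r) (g i))"
    by (subst iter_circ_prod[OF assms, of n]) (use assms in \<open>auto simp: g_def intro!: continuous_intros\<close>)
  also have "\<dots> = (\<Prod>i\<in>{1..n}. 2 * of_real pi * \<i> * exp_coeff (s i) (int (a i) - int (\<alpha> i)))"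
    unfolding g_def by (intro prod.cong refl contour_integral_exp_monomial assms)
  also have "\<dots> = (2 * of_real pi * \<i>) ^ n * (\<Prod>i\<in>{1..n}. exp_coeff (s i) (int (a i) - int (\<alpha> i)))"
    by (simp add: prod.distrib)
  also have "(\<lambda>z. \<Prod>i\<in>{1..n}. g i (z i)) =
      (\<lambda>z. (monomial n \<alpha> z * (\<Prod>i\<in>{1..n}. exp (s i * z i))) / (\<Prod>i\<in>{1..n}. z i ^ (a i + 1)))"
    by (simp add: g_def monomial_def prod.distrib prod_dividef)
  finally show ?thesis by (simp add: tcoeff_def)
qed

lemma tcoeff_mono:
  assumes "r > 0"
  shows "tcoeff r n (monomial n \<alpha>) a = (if \<forall>i\<in>{1..n}. a i = \<alpha> i then 1 else 0)"
proof -
  have "tcoeff r n (monomial n \<alpha>) a = (\<Prod>i\<in>{1..n}. exp_coeff 0 (int (a i) - int (\<alpha> i)))"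
    using tcoeff_mono_exp[OF assms, of n \<alpha> "\<lambda>_. 0" a] by simp
  then show ?thesis by (auto simp: exp_coeff_0)
qed

lemma tcoeff_radius:
  assumes "f \<in> polydisc_alg \<rho> n" "0 < r" "r \<le> \<rho>" "0 < r'" "r' \<le> \<rho>"
  shows "tcoeff r n f a = tcoeff r' n f a"
  by (rule bounded_functional_eqI[OF bounded_functional_tcoeff bounded_functional_tcoeff _ assms(1)])
    (use assms in \<open>auto simp: tcoeff_mono\<close>)

text \<open>The limit over radii is taken of a function that is already constant for
  \<open>0 < r < \<rho>\<close>. The condition on \<open>g\<close> is restricted to distinct
  coordinates, since \<open>zeta\<close> has a default value at its pole.\<close>

lemma small_circ_int_eq:
  assumes f: "f \<in> polydisc_alg \<rho> n" and "\<rho> > 0"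
    and g: "\<And>z. z \<in> polydisc \<rho> n \<Longrightarrow> inj_on z {1..n} \<Longrightarrow> g z = f z / (\<Prod>i\<in>{1..n}. z i ^ (a i + 1))"
  shows "small_circ_int n g = (2 * of_real pi * \<i>) ^ n * tcoeff \<rho> n f a"
proof -
  have "iter_circ r n g (\<lambda>_. 0) = (2 * of_real pi * \<i>) ^ n * tcoeff \<rho> n f a" if "0 < r" "r < \<rho>" for r
  proof -
    have "iter_circ r n g (\<lambda>_. 0) = iter_circ r n (\<lambda>z. f z / (\<Prod>i\<in>{1..n}. z i ^ (a i + 1))) (\<lambda>_. 0)"
      by (rule iter_circ_cong_inj[of r n]) (use that g torus_subset_polydisc[of r \<rho> n] in auto)
    then have "iter_circ r n g (\<lambda>_. 0) = (2 * of_real pi * \<i>) ^ n * tcoeff r n f a"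
      by (simp add: tcoeff_def)
    then show ?thesis using tcoeff_radius[OF f, of r \<rho>] that by simp
  qed
  then have "\<forall>\<^sub>F r in at_right 0. iter_circ r n g (\<lambda>_. 0) = (2 * of_real pi * \<i>) ^ n * tcoeff \<rho> n f a"
    by (intro eventually_mono[OF eventually_at_right_real[OF \<open>\<rho> > 0\<close>]]) auto
  then show ?thesis unfolding small_circ_int_def
    by (intro tendsto_Lim) (auto simp: tendsto_eventually)
qed

lemma taylor_coeff_eq:
  assumes f: "f \<in> polydisc_alg \<rho> n" and "\<rho> > 0"
    and g: "\<And>z. z \<in> polydisc \<rho> n \<Longrightarrow> inj_on z {1..n} \<Longrightarrow> g z = f z"
  shows "taylor_coeff n g a = tcoeff \<rho> n f a"
  unfolding taylor_coeff_def using g by (subst small_circ_int_eq[OF f \<open>\<rho> > 0\<close>, where a = a]) auto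

text \<open>On a monomial the substitution permutes the exponents and produces a power of
  \<open>\<epsilon>\<close>. Both sides vanish unless the exponents match, and then the total
  degrees agree. \<open>\<epsilon> = 1\<close> will give the symmetry inside a half,
  \<open>\<epsilon> = -1\<close> the exchange of the halves.\<close>

lemma tcoeff_twist:
  assumes f: "f \<in> polydisc_alg \<rho> n" and r: "0 < r" "r \<le> \<rho>" and \<sigma>: "\<sigma> permutes {1..n}" and \<epsilon>: "norm \<epsilon> = 1"
  shows "tcoeff r n (\<lambda>z. f (\<lambda>i. \<epsilon> * z (\<sigma> i))) a = \<epsilon> ^ (\<Sum>i\<in>{1..n}. a i) * tcoeff r n f (\<lambda>i. a (\<sigma> i))"
proof (rule bounded_functional_eqI[OF _ _ _ f])
  show "bounded_functional \<rho> n (\<lambda>f. tcoeff r n (\<lambda>z. f (\<lambda>i. \<epsilon> * z (\<sigma> i))) a)"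
  proof (rule bounded_functional_pullback[OF bounded_functional_tcoeff[OF r]])
    fix z assume "z \<in> polydisc \<rho> n"
    then show "(\<lambda>i. \<epsilon> * z (\<sigma> i)) \<in> polydisc \<rho> n"
      unfolding polydisc_def mem_Collect_eq norm_mult \<epsilon> mult_1 using permutes_in_image[OF \<sigma>] by blast
  next
    fix i assume "i \<in> {1..n}"
    then have "\<sigma> i \<in> {1..n}" by (simp only: permutes_in_image[OF \<sigma>])
    then show "(\<lambda>z. \<epsilon> * z (\<sigma> i)) \<in> polydisc_alg \<rho> n"
      by (rule pd.unif_closure_cmult[OF polydisc_alg_coord])
  qed
  show "bounded_functional \<rho> n (\<lambda>f. \<epsilon> ^ (\<Sum>i\<in>{1..n}. a i) * tcoeff r n f (\<lambda>i. a (\<sigma> i)))"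
    by (intro bounded_functional_cmult bounded_functional_tcoeff r)
next
  fix \<alpha>
  have "monomial n \<alpha> (\<lambda>i. \<epsilon> * z (\<sigma> i)) = \<epsilon> ^ (\<Sum>i\<in>{1..n}. \<alpha> i) * monomial n (\<lambda>i. \<alpha> (inv \<sigma> i)) z" for z
  proof -
    have "monomial n \<alpha> (\<lambda>i. \<epsilon> * z (\<sigma> i)) = \<epsilon> ^ (\<Sum>i\<in>{1..n}. \<alpha> i) * (\<Prod>i\<in>{1..n}. z (\<sigma> i) ^ \<alpha> i)"
      by (simp add: monomial_def power_mult_distrib prod.distrib power_sum)
    also have "(\<Prod>i\<in>{1..n}. z (\<sigma> i) ^ \<alpha> i) = (\<Prod>i\<in>{1..n}. z (\<sigma> i) ^ \<alpha> (inv \<sigma> (\<sigma> i)))"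
      by (simp add: permutes_inverses[OF \<sigma>])
    also have "\<dots> = (\<Prod>i\<in>{1..n}. z i ^ \<alpha> (inv \<sigma> i))"
      using prod.permute[OF \<sigma>, of "\<lambda>i. z i ^ \<alpha> (inv \<sigma> i)"] by (simp add: o_def)
    finally show ?thesis by (simp add: monomial_def)
  qed
  then have L: "tcoeff r n (\<lambda>z. monomial n \<alpha> (\<lambda>i. \<epsilon> * z (\<sigma> i))) a =
     \<epsilon> ^ (\<Sum>i\<in>{1..n}. \<alpha> i) * tcoeff r n (monomial n (\<lambda>i. \<alpha> (inv \<sigma> i))) a"
    by (simp add: bounded_functionalD(1)[OF bounded_functional_tcoeff[OF r] polydisc_alg_mono])
  have iff: "(\<forall>i\<in>{1..n}. a i = \<alpha> (inv \<sigma> i)) \<longleftrightarrow> (\<forall>i\<in>{1..n}. a (\<sigma> i) = \<alpha> i)"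
    using permutes_in_image[OF \<sigma>] permutes_in_image[OF permutes_inv[OF \<sigma>]] permutes_inverses[OF \<sigma>]
    by metis
  have "(\<Sum>i\<in>{1..n}. a i) = (\<Sum>i\<in>{1..n}. \<alpha> i)" if "\<forall>i\<in>{1..n}. a (\<sigma> i) = \<alpha> i"
    using sum.permute[OF \<sigma>, of a] that by (simp add: o_def)
  then show "tcoeff r n (\<lambda>z. monomial n \<alpha> (\<lambda>i. \<epsilon> * z (\<sigma> i))) a =
     \<epsilon> ^ (\<Sum>i\<in>{1..n}. a i) * tcoeff r n (monomial n \<alpha>) (\<lambda>i. a (\<sigma> i))"
    unfolding L tcoeff_mono[OF r(1)] iff by auto
qed

text \<open>Convolution of the Taylor coefficients of \<open>f\<close> with those of the
  exponential, as a finite sum over \<open>T\<close>. By \<open>inj\<close> no exponent is counted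
  twice; by \<open>cover\<close> the exponents missed by \<open>T\<close> contribute nothing. On a
  monomial at most one term of the sum survives.\<close>

lemma tcoeff_mult_exp:
  fixes ex :: "'t \<Rightarrow> nat \<Rightarrow> nat"
  assumes f: "f \<in> polydisc_alg \<rho> n" and r: "0 < r" "r \<le> \<rho>" and "finite T"
    and inj: "\<And>t t'. t \<in> T \<Longrightarrow> t' \<in> T \<Longrightarrow> \<forall>i\<in>{1..n}. ex t i = ex t' i \<Longrightarrow> t = t'"
    and cover: "\<And>\<alpha>. \<forall>t\<in>T. \<exists>i\<in>{1..n}. ex t i \<noteq> \<alpha> i \<Longrightarrow>
        (\<Prod>i\<in>{1..n}. exp_coeff (s i) (int (a i) - int (q i) - int (\<alpha> i))) = 0"
  shows "tcoeff r n (\<lambda>z. f z * (monomial n q z * (\<Prod>i\<in>{1..n}. exp (s i * z i)))) a =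
    (\<Sum>t\<in>T. tcoeff r n f (ex t) * (\<Prod>i\<in>{1..n}. exp_coeff (s i) (int (a i) - int (q i) - int (ex t i))))"
proof (rule bounded_functional_eqI[OF _ _ _ f])
  have "(\<lambda>z. monomial n q z * (\<Prod>i\<in>{1..n}. exp (s i * z i))) \<in> polydisc_alg \<rho> n"
    by (intro pd.unif_closure_mult polydisc_alg_mono pd.unif_closure_prod pd.unif_closure_exp
        pd.unif_closure_cmult polydisc_alg_coord)
  then show "bounded_functional \<rho> n (\<lambda>f. tcoeff r n (\<lambda>z. f z * (monomial n q z * (\<Prod>i\<in>{1..n}. exp (s i * z i)))) a)"
    by (intro bounded_functional_mult[OF bounded_functional_tcoeff[OF r]])
  show "bounded_functional \<rho> n (\<lambda>f. \<Sum>t\<in>T. tcoeff r n f (ex t) *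
     (\<Prod>i\<in>{1..n}. exp_coeff (s i) (int (a i) - int (q i) - int (ex t i))))"
    by (subst mult.commute) (intro bounded_functional_sum bounded_functional_cmult bounded_functional_tcoeff r)
next
  fix \<alpha>
  let ?c = "\<lambda>\<alpha>. \<Prod>i\<in>{1..n}. exp_coeff (s i) (int (a i) - int (q i) - int (\<alpha> i))"
  have "(\<lambda>z. monomial n \<alpha> z * (monomial n q z * (\<Prod>i\<in>{1..n}. exp (s i * z i)))) =
     (\<lambda>z. monomial n (\<lambda>i. q i + \<alpha> i) z * (\<Prod>i\<in>{1..n}. exp (s i * z i)))"
    by (simp add: monomial_add mult_ac)
  then have L: "tcoeff r n (\<lambda>z. monomial n \<alpha> z * (monomial n q z * (\<Prod>i\<in>{1..n}. exp (s i * z i)))) a = ?c \<alpha>"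
    by (simp only: tcoeff_mono_exp[OF r(1)]) (simp add: algebra_simps)
  show "tcoeff r n (\<lambda>z. monomial n \<alpha> z * (monomial n q z * (\<Prod>i\<in>{1..n}. exp (s i * z i)))) a =
     (\<Sum>t\<in>T. tcoeff r n (monomial n \<alpha>) (ex t) * ?c (ex t))"
  proof (cases "\<exists>t\<in>T. \<forall>i\<in>{1..n}. ex t i = \<alpha> i")
    case True
    then obtain t where t: "t \<in> T" "\<forall>i\<in>{1..n}. ex t i = \<alpha> i" by blast
    have "(\<Sum>t\<in>T. tcoeff r n (monomial n \<alpha>) (ex t) * ?c (ex t)) = (\<Sum>u\<in>T. if u = t then ?c \<alpha> else 0)"
    proof (rule sum.cong)
      fix u assume u: "u \<in> T"
      show "tcoeff r n (monomial n \<alpha>) (ex u) * ?c (ex u) = (if u = t then ?c \<alpha> else 0)"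
      proof (cases "u = t")
        case True
        then show ?thesis using t by (simp add: tcoeff_mono[OF r(1)])
      next
        case False
        then have "\<not> (\<forall>i\<in>{1..n}. ex u i = \<alpha> i)" using inj[OF u t(1)] t(2) by auto
        then show ?thesis using False by (auto simp: tcoeff_mono[OF r(1)])
      qed
    qed simp
    then show ?thesis using t(1) \<open>finite T\<close> L by simp
  next
    case False
    then have "(\<Sum>t\<in>T. tcoeff r n (monomial n \<alpha>) (ex t) * ?c (ex t)) = 0"
      by (intro sum.neutral) (auto simp: tcoeff_mono[OF r(1)])
    then show ?thesis using cover[of \<alpha>] False L by auto
  qed
qed

section \<open>The zeta function near its pole\<close>

text \<open>Around \<open>s = 1\<close> the alternating series for \<open>zeta\<close> converges
  only conditionally when \<open>Re s \<le> 1\<close>, but its consecutive pairs converge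
  absolutely. The regrouping can be undone because the terms tend to 0.\<close>

lemma sums_from_pairs:
  fixes a :: "nat \<Rightarrow> 'a::real_normed_vector"
  assumes "(\<lambda>m. a (2 * m) + a (2 * m + 1)) sums s" "a \<longlonglongrightarrow> 0"
  shows "a sums s"
proof -
  have ev: "(\<Sum>i<2 * m. a i) = (\<Sum>i<m. a (2 * i) + a (2 * i + 1))" for m
    by (induction m) (auto simp: algebra_simps)
  have *: "(\<lambda>m. \<Sum>i<2 * m. a i) \<longlonglongrightarrow> s"
    using assms(1) by (simp add: ev sums_def)
  have "(\<lambda>m. a (2 * m)) \<longlonglongrightarrow> 0"
    by (rule filterlim_compose[OF assms(2)]) (rule filterlim_subseq, simp add: strict_mono_def)
  from tendsto_add[OF * this] have **: "(\<lambda>m. \<Sum>i<2 * m + 1. a i) \<longlonglongrightarrow> s" by simp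
  show ?thesis unfolding sums_def
  proof (rule LIMSEQ_I)
    fix r :: real assume "r > 0"
    obtain M1 where M1: "\<And>m. m \<ge> M1 \<Longrightarrow> norm ((\<Sum>i<2 * m. a i) - s) < r"
      using LIMSEQ_D[OF * \<open>r > 0\<close>] by blast
    obtain M2 where M2: "\<And>m. m \<ge> M2 \<Longrightarrow> norm ((\<Sum>i<2 * m + 1. a i) - s) < r"
      using LIMSEQ_D[OF ** \<open>r > 0\<close>] by blast
    have "norm ((\<Sum>i<n. a i) - s) < r" if "n \<ge> 2 * M1 + 2 * M2" for n
    proof (cases "even n")
      case True
      then obtain m where "n = 2 * m" by (rule evenE)
      then show ?thesis using M1[of m] that by simp
    next
      case False
      then obtain m where "n = 2 * m + 1" by (rule oddE)
      then show ?thesis using M2[of m] that by simp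
    qed
    then show "\<exists>no. \<forall>n\<ge>no. norm ((\<Sum>i<n. a i) - s) < r" by blast
  qed
qed

text \<open>Mean value inequality on the segment from \<open>x\<close> to \<open>x + 1\<close>;
  since \<open>Re s > 0\<close>, the modulus of the derivative is largest at the left end.\<close>

lemma norm_powr_diff_le:
  fixes s :: complex
  assumes "x > 0" "Re s > 0"
  shows "norm (of_real (x + 1) powr (- s) - of_real x powr (- s)) \<le> norm s * x powr (- Re s - 1)"
proof -
  let ?S = "closed_segment (complex_of_real x) (of_real (x + 1))"
  have S: "\<exists>t\<ge>x. u = of_real t" if "u \<in> ?S" for u
    using that unfolding closed_segment_of_real closed_segment_eq_real_ivl by auto
  have "norm (of_real (x + 1) powr (- s) - of_real x powr (- s)) \<le>
     (norm s * x powr (- Re s - 1)) * norm (complex_of_real (x + 1) - of_real x)"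
  proof (rule field_differentiable_bound[of ?S])
    fix u assume "u \<in> ?S"
    then obtain t where t: "t \<ge> x" "u = of_real t" using S by blast
    then have "u \<notin> \<real>\<^sub>\<le>\<^sub>0" using assms by (simp add: complex_nonpos_Reals_iff)
    then show "((\<lambda>u. u powr (- s)) has_field_derivative - s * u powr (- s - 1)) (at u within ?S)"
      by (rule has_field_derivative_at_within[OF has_field_derivative_powr])
    have "t powr (- Re s - 1) \<le> x powr (- Re s - 1)"
      using assms t by (intro powr_mono2') auto
    then show "norm (- s * u powr (- s - 1)) \<le> norm s * x powr (- Re s - 1)"
      using t assms by (simp add: norm_mult norm_powr_real_powr mult_left_mono)
  qed auto
  then show ?thesis by simp
qed

definition eta_term :: "nat \<Rightarrow> complex \<Rightarrow> complex" where
  "eta_term n w = (-1) ^ n / (of_nat (Suc n)) powr (1 + w)"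

text \<open>A difference of neighbouring terms gains one power over a single term:
  \<open>Re (1 + w) > 1/2\<close> becomes an exponent above 3/2, uniformly in
  \<open>w\<close>.\<close>

lemma eta_term_pair_le:
  assumes "norm w < 1/2"
  shows "norm (eta_term (2 * m) w + eta_term (2 * m + 1) w) \<le> 2 * (1 / real (Suc m) powr (3/2))"
proof -
  have "\<bar>Re w\<bar> < 1/2" using assms abs_Re_le_cmod[of w] by linarith
  then have Re: "- Re w < 1/2" "Re (1 + w) > 0" by auto
  have "norm (1 + w) \<le> norm (1::complex) + norm w" by (rule norm_triangle_ineq)
  then have nw: "norm (1 + w) \<le> 2" using assms by simp
  have "norm (eta_term (2 * m) w + eta_term (2 * m + 1) w) =
      norm (of_real (real (2 * m + 1) + 1) powr (- (1 + w)) - of_real (real (2 * m + 1)) powr (- (1 + w)))"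
    
  proof -
    have "(2 :: complex) + 2 * of_nat m = of_real (real (2 * m + 1) + 1)" "(1 :: complex) + 2 * of_nat m = of_real (real (2 * m + 1))"
      by auto
    then have "eta_term (2 * m) w + eta_term (2 * m + 1) w =
      of_real (real (2 * m + 1)) powr (- (1 + w)) - of_real (real (2 * m + 1) + 1) powr (- (1 + w))"
      unfolding powr_minus_divide by (simp add: eta_term_def)
    then show ?thesis by (simp only: norm_minus_commute)
  qed
  also have "\<dots> \<le> norm (1 + w) * real (2 * m + 1) powr (- Re (1 + w) - 1)"
    by (rule norm_powr_diff_le) (use Re in auto)
  also have "\<dots> \<le> 2 * real (2 * m + 1) powr (- 3/2)"
    by (rule mult_mono[OF nw powr_mono]) (use Re in \<open>auto simp: field_simps\<close>)
  also have "\<dots> \<le> 2 * real (Suc m) powr (- 3/2)"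
    by (intro mult_left_mono powr_mono2') auto
  finally show ?thesis by (simp add: powr_minus_divide)
qed

lemma summable_powr_3_2: "summable (\<lambda>m. 2 * (1 / real (Suc m) powr (3/2)))"
proof -
  have "summable (\<lambda>n. 1 / real n powr (3/2))"
    using summable_real_powr_iff[of "-3/2"] by (simp add: powr_minus_divide)
  then have "summable (\<lambda>m. 1 / real (Suc m) powr (3/2))"
    by (subst summable_Suc_iff[of "\<lambda>n. 1 / real n powr (3/2)"])
  then show ?thesis by (rule summable_mult)
qed

lemma eta_term_sums:
  assumes "norm w < 1/2"
  shows "(\<lambda>n. eta_term n w) sums (\<Sum>m. eta_term (2 * m) w + eta_term (2 * m + 1) w)"
proof (rule sums_from_pairs)
  show "(\<lambda>m. eta_term (2 * m) w + eta_term (2 * m + 1) w) sums (\<Sum>m. eta_term (2 * m) w + eta_term (2 * m + 1) w)"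
    by (rule summable_sums, rule summable_comparison_test'[OF summable_powr_3_2, of 0])
      (use eta_term_pair_le[OF assms] in auto)
  have "\<bar>Re w\<bar> < 1/2" using assms abs_Re_le_cmod[of w] by linarith
  then have Re: "Re (1 + w) > 0" by auto
  have "(\<lambda>n. real (Suc n) powr (- Re (1 + w))) \<longlonglongrightarrow> 0"
    by (rule tendsto_neg_powr[OF _ filterlim_compose[OF filterlim_real_sequentially filterlim_Suc]]) (use Re in auto)
  moreover have "norm (eta_term n w) = real (Suc n) powr (- Re (1 + w))" for n
  proof -
    have "norm (of_nat (Suc n) powr (1 + w)) = real (Suc n) powr Re (1 + w)"
      using norm_powr_real_powr[of "of_real (real (Suc n))" "1 + w"] by simp
    then show ?thesis by (simp only: eta_term_def norm_divide norm_power norm_minus_cancel norm_one power_one powr_minus_divide)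
  qed
  ultimately show "(\<lambda>n. eta_term n w) \<longlonglongrightarrow> 0"
    by (simp add: tendsto_norm_zero_iff[symmetric, of "\<lambda>n. eta_term n w"] del: of_nat_Suc)
qed

lemma holomorphic_eta: "(\<lambda>w. \<Sum>n. eta_term n w) holomorphic_on ball 0 (1/2)"
proof (rule holomorphic_uniform_sequence)
  let ?f = "\<lambda>n w. \<Sum>m<n. eta_term (2 * m) w + eta_term (2 * m + 1) w"
  have hol: "eta_term m holomorphic_on UNIV" for m
    unfolding eta_term_def[abs_def] by (intro holomorphic_intros) (auto simp: complex_nonpos_Reals_iff simp del: of_nat_Suc)
  show "?f n holomorphic_on ball 0 (1/2)" for n
    by (intro holomorphic_intros holomorphic_on_subset[OF hol]) auto
  have ul: "uniform_limit (ball 0 (1/2)) ?f (\<lambda>w. \<Sum>m. eta_term (2 * m) w + eta_term (2 * m + 1) w) sequentially"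
    by (rule Weierstrass_m_test[OF _ summable_powr_3_2]) (use eta_term_pair_le in auto)
  have ul: "uniform_limit (ball 0 (1/2)) ?f (\<lambda>w. \<Sum>n. eta_term n w) sequentially"
    by (rule uniform_limit_cong'[THEN iffD1, OF refl _ ul]) (use eta_term_sums in \<open>simp add: sums_iff\<close>)
  fix x :: complex assume "x \<in> ball 0 (1/2)"
  then obtain d where "d > 0" "cball x d \<subseteq> ball 0 (1/2)"
    using open_contains_cball[of "ball 0 (1/2) :: complex set"] by blast
  then show "\<exists>d>0. cball x d \<subseteq> ball 0 (1/2) \<and> uniform_limit (cball x d) ?f (\<lambda>w. \<Sum>n. eta_term n w) sequentially"
    using uniform_limit_on_subset[OF ul] by blast
qed auto

text \<open>The denominator \<open>1 - 2 powr (1 - s)\<close> has a simple zero at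
  \<open>s = 1\<close>. Divided by \<open>w = s - 1\<close> it becomes a function \<open>q\<close>
  with \<open>q 0 = ln 2\<close>, so the eta series over \<open>q\<close> is holomorphic near 0. The
  point \<open>w = 0\<close> is excluded because \<open>zeta 1\<close> is a division by
  zero.\<close>

lemma zeta_regularized:
  obtains R h where "R > 0" "h holomorphic_on ball 0 R" "\<And>w. w \<noteq> 0 \<Longrightarrow> norm w < R \<Longrightarrow> w * zeta (1 + w) = h w"
proof -
  \<comment> \<open>Chosen so that \<open>f w - f 0 = 1 - 2 powr (- w)\<close>; the removable
    singularity of its difference quotient is then filled by \<open>deriv f 0\<close>.\<close>
  define f where "f = (\<lambda>w::complex. - (2 powr (- w)))"
  define q where "q = (\<lambda>w. if w = 0 then deriv f 0 else (f w - f 0) / (w - 0))"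
  have hf: "f holomorphic_on UNIV" unfolding f_def by (intro holomorphic_intros) (auto simp: complex_nonpos_Reals_iff)
  have hq: "q holomorphic_on UNIV" unfolding q_def by (rule pole_lemma[OF hf]) auto
  have "deriv f 0 = of_real (ln 2)"
  proof (rule DERIV_imp_deriv)
    show "(f has_field_derivative of_real (ln 2)) (at 0)"
      unfolding f_def powr_def by (auto intro!: derivative_eq_intros simp: Ln_of_real[of 2, simplified])
  qed
  then have q0: "q 0 \<noteq> 0" by (simp add: q_def)
  have "isCont q 0" using holomorphic_on_imp_continuous_on[OF hq] by (simp add: continuous_on_eq_continuous_at)
  from continuous_at_avoid[OF this q0] obtain \<delta> where \<delta>: "\<delta> > 0" "\<And>w. dist 0 w < \<delta> \<Longrightarrow> q w \<noteq> 0" by blast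
  define R where "R = min \<delta> (1/2)"
  show ?thesis
  proof
    show "R > 0" using \<delta> by (simp add: R_def)
    show "(\<lambda>w. (\<Sum>n. eta_term n w) / q w) holomorphic_on ball 0 R"
      by (intro holomorphic_intros holomorphic_on_subset[OF holomorphic_eta] holomorphic_on_subset[OF hq])
        (use \<delta>(2) in \<open>auto simp: R_def\<close>)
    fix w :: complex assume w: "w \<noteq> 0"
    have "q w = (1 - 2 powr (- w)) / w" using w by (simp add: q_def f_def)
    moreover have "zeta (1 + w) = (\<Sum>n. eta_term n w) / (1 - 2 powr (- w))"
      by (simp add: zeta_def eta_term_def)
    ultimately show "w * zeta (1 + w) = (\<Sum>n. eta_term n w) / q w" by simp
  qed
qed

section \<open>The local factors of the Euler product\<close>

lemma continuous_on_e [continuous_intros]: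
  "continuous_on S f \<Longrightarrow> continuous_on S (\<lambda>x. e (f x))"
  unfolding e_def by (intro continuous_intros)

lemma norm_e [simp]: "norm (e \<theta>) = 1"
  using norm_exp_i_times[of "2 * pi * \<theta>"] by (simp add: e_def mult_ac)

lemma e_minus: "e (- \<theta>) = inverse (e \<theta>)"
  by (simp add: e_def exp_minus)

lemma e_neq_0 [simp]: "e \<theta> \<noteq> 0"
  by (simp add: e_def)

lemma integral_e_int:
  assumes "m \<noteq> 0"
  shows "((\<lambda>\<theta>. e (of_int m * \<theta>)) has_integral 0) {0..1}"
proof -
  define c where "c = 2 * of_real pi * \<i> * of_int m"
  have c0: "c \<noteq> 0" using assms by (simp add: c_def)
  have "((\<lambda>\<theta>. exp (c * of_real \<theta>) / c) has_vector_derivative exp (c * of_real \<theta>)) (at \<theta> within {0..1})" for \<theta>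
  proof (rule has_vector_derivative_real_field)
    show "((\<lambda>w. exp (c * w) / c) has_field_derivative exp (c * of_real \<theta>)) (at (of_real \<theta>))"
      using c0 by (auto intro!: derivative_eq_intros)
  qed
  then have "((\<lambda>\<theta>. exp (c * of_real \<theta>)) has_integral (exp (c * of_real 1) / c - exp (c * of_real 0) / c)) {0..1}"
    by (intro fundamental_theorem_of_calculus) auto
  moreover have "exp (c * of_real 1) = 1"
    using exp_integer_2pi[of "of_int m"] by (simp add: c_def mult_ac)
  ultimately show ?thesis by (simp add: c_def e_def mult_ac)
qed

text \<open>Functions of \<open>(\<theta>, z)\<close> are approximated by polynomials in \<open>z\<close> whose coefficients are
  arbitrary continuous functions of \<open>\<theta>\<close>.\<close>
definition cyl_gens :: "nat \<Rightarrow> (real \<times> (nat \<Rightarrow> complex) \<Rightarrow> complex) set" where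
  "cyl_gens n = (\<lambda>i x. snd x i) ` {1..n} \<union> {g. \<exists>c. continuous_on {0..1} c \<and> g = (\<lambda>x. c (fst x))}"

interpretation cyl: bounded_gens "cyl_gens n" "{0..1} \<times> polydisc \<rho> n" for n \<rho>
proof
  fix g assume "g \<in> cyl_gens n"
  then consider (coord) i where "i \<in> {1..n}" "g = (\<lambda>x. snd x i)"
    | (cont) c where "continuous_on {0..1} c" "g = (\<lambda>x. c (fst x))"
    unfolding cyl_gens_def by blast
  then show "bounded (g ` ({0..1} \<times> polydisc \<rho> n))"
  proof cases
    case coord
    then show ?thesis unfolding bounded_iff by (intro exI[of _ \<rho>]) (auto simp: polydisc_def)
  next
    case cont
    have "bounded (c ` {0..1})"
      by (intro compact_imp_bounded compact_continuous_image cont compact_Icc)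
    then show ?thesis by (rule bounded_subset) (auto simp: cont)
  qed
qed

text \<open>The continuous weight \<open>c\<close> is quantified so that a generator depending on
  \<theta> can be merged into it, while a coordinate of \<open>z\<close> is pulled out of the
  integral. Continuity in \<theta> is carried along to justify additivity of the integral.\<close>

lemma polyfun_cyl_integral:
  assumes "p \<in> polyfun (cyl_gens n)"
  shows "(\<forall>c. continuous_on {0..1} c \<longrightarrow> (\<lambda>z. integral {0..1} (\<lambda>\<theta>. c \<theta> * p (\<theta>, z))) \<in> polyfun (coords n)) \<and>
    (\<forall>z. continuous_on {0..1} (\<lambda>\<theta>. p (\<theta>, z)))"
  using assms
proof (induction rule: polyfun.induct)
  case (polyfun_const c)
  show ?case using polyfun.polyfun_const by auto
next
  case (polyfun_gen g f)
  then consider (coord) i where "i \<in> {1..n}" "g = (\<lambda>x. snd x i)"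
    | (cont) d where "continuous_on {0..1} d" "g = (\<lambda>x. d (fst x))"
    unfolding cyl_gens_def by blast
  then show ?case
  proof cases
    case coord
    have "(\<lambda>z. integral {0..1} (\<lambda>\<theta>. c \<theta> * (z i * f (\<theta>, z)))) \<in> polyfun (coords n)"
      if "continuous_on {0..1} c" for c
    proof -
      have "(\<lambda>z. z i * integral {0..1} (\<lambda>\<theta>. c \<theta> * f (\<theta>, z))) \<in> polyfun (coords n)"
        using polyfun_gen.IH that coord by (intro polyfun.polyfun_gen) (auto simp: coords_def)
      then show ?thesis by (simp add: mult.left_commute)
    qed
    then show ?thesis using polyfun_gen.IH coord by (auto intro!: continuous_intros)
  next
    case cont
    have "(\<lambda>z. integral {0..1} (\<lambda>\<theta>. c \<theta> * (d \<theta> * f (\<theta>, z)))) \<in> polyfun (coords n)"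
      if "continuous_on {0..1} c" for c
    proof -
      have "continuous_on {0..1} (\<lambda>\<theta>. c \<theta> * d \<theta>)" using that cont by (intro continuous_intros)
      then show ?thesis using polyfun_gen.IH by (simp add: mult.assoc[symmetric])
    qed
    then show ?thesis using polyfun_gen.IH cont by (auto intro!: continuous_intros)
  qed
next
  case (polyfun_add f g)
  have "integral {0..1} (\<lambda>\<theta>. c \<theta> * (f (\<theta>, z) + g (\<theta>, z))) =
      integral {0..1} (\<lambda>\<theta>. c \<theta> * f (\<theta>, z)) + integral {0..1} (\<lambda>\<theta>. c \<theta> * g (\<theta>, z))"
    if "continuous_on {0..1} c" for c z
    using that polyfun_add.IH unfolding distrib_left
    by (intro integral_add integrable_continuous_real continuous_intros) auto
  then show ?case using polyfun_add.IH by (auto intro!: continuous_intros polyfun.polyfun_add)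
qed

lemma unif_closure_integral:
  assumes f: "f \<in> unif_closure (cyl_gens n) ({0..1} \<times> polydisc \<rho> n)"
    and cont: "\<And>z. z \<in> polydisc \<rho> n \<Longrightarrow> continuous_on {0..1} (\<lambda>\<theta>. f (\<theta>, z))"
  shows "(\<lambda>z. integral {0..1} (\<lambda>\<theta>. f (\<theta>, z))) \<in> polydisc_alg \<rho> n"
proof (rule unif_closure_uniform_limit)
  fix \<epsilon> :: real assume "\<epsilon> > 0"
  then obtain p where p: "p \<in> polyfun (cyl_gens n)" "\<forall>x\<in>{0..1} \<times> polydisc \<rho> n. norm (f x - p x) < \<epsilon> / 2"
    using unif_closureD[OF f, of "\<epsilon>/2"] by auto
  have "(\<lambda>z. integral {0..1} (\<lambda>\<theta>. 1 * p (\<theta>, z))) \<in> polyfun (coords n)"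
    using polyfun_cyl_integral[OF p(1)] continuous_on_const by blast
  moreover have "norm (integral {0..1} (\<lambda>\<theta>. f (\<theta>, z)) - integral {0..1} (\<lambda>\<theta>. p (\<theta>, z))) < \<epsilon>"
    if z: "z \<in> polydisc \<rho> n" for z
  proof -
    have int: "(\<lambda>\<theta>. f (\<theta>, z)) integrable_on {0..1}" "(\<lambda>\<theta>. p (\<theta>, z)) integrable_on {0..1}"
      using cont[OF z] polyfun_cyl_integral[OF p(1)] by (auto intro: integrable_continuous_real)
    have "norm (integral {0..1} (\<lambda>\<theta>. f (\<theta>, z) - p (\<theta>, z))) \<le> \<epsilon> / 2 * (1 - 0)"
      by (rule integral_bound) (use p(2) z cont[OF z] polyfun_cyl_integral[OF p(1)] \<open>\<epsilon> > 0\<close>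
        in \<open>auto intro!: continuous_intros less_imp_le\<close>)
    then show ?thesis using int \<open>\<epsilon> > 0\<close> by (simp add: integral_diff)
  qed
  ultimately show "\<exists>g\<in>polydisc_alg \<rho> n. \<forall>z\<in>polydisc \<rho> n. norm (integral {0..1} (\<lambda>\<theta>. f (\<theta>, z)) - g z) < \<epsilon>"
    by (intro bexI[OF _ polyfun_subset_unif_closure]) auto
qed

section \<open>Local factors as functions of small variables\<close>

definition local_integrand :: "nat \<Rightarrow> (nat \<Rightarrow> complex) \<Rightarrow> (nat \<Rightarrow> complex) \<Rightarrow> real \<Rightarrow> complex" where
  "local_integrand k u v \<theta> = (\<Prod>j\<in>{1..k}. inverse (1 - e \<theta> * u j) * inverse (1 - e (- \<theta>) * v j))"

text \<open>\<open>u\<close> and \<open>v\<close> stand for \<open>p powr (- 1/2 - z j)\<close> and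
  \<open>p powr (- 1/2 + z (k + j))\<close>. Uniformity in the prime and in \<open>z\<close> thereby
  becomes uniformity in one bound \<open>q\<close> for small complex numbers.\<close>

definition local_factor :: "nat \<Rightarrow> (nat \<Rightarrow> complex) \<Rightarrow> (nat \<Rightarrow> complex) \<Rightarrow> complex" where
  "local_factor k u v = (\<Prod>i\<in>{1..k}. \<Prod>j\<in>{1..k}. 1 - u i * v j) * integral {0..1} (local_integrand k u v)"

lemma A_local_eq:
  assumes "p > 0"
  shows "A_local k z p = local_factor k (\<lambda>j. of_nat p powr (- 1/2 - z j)) (\<lambda>j. of_nat p powr (- 1/2 + z (k + j)))"
proof -
  have "of_nat p powr (- 1 - z i + z (k + j)) = of_nat p powr (- 1/2 - z i) * of_nat p powr (- 1/2 + z (k + j))" for i j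
  proof -
    have "- 1 - z i + z (k + j) = (- 1/2 - z i) + (- 1/2 + z (k + j))" by simp
    then show ?thesis by (simp only: powr_add)
  qed
  moreover have "x / of_nat p powr (1/2 + z j) = x * of_nat p powr (- 1/2 - z j)" for x j
    using powr_minus_divide[of "of_nat p :: complex" "1/2 + z j"] by simp
  moreover have "x / of_nat p powr (1/2 - z j) = x * of_nat p powr (- 1/2 + z j)" for x j
    using powr_minus_divide[of "of_nat p :: complex" "1/2 - z j"] by simp
  ultimately show ?thesis
    by (simp only: A_local_def local_factor_def local_integrand_def[abs_def])
qed

lemma one_minus_e_mult_neq_0: "norm w < 1 \<Longrightarrow> 1 - e \<theta> * w \<noteq> 0"
  by (metis eq_iff_diff_eq_0 mult.left_neutral norm_e norm_mult norm_one order_less_irrefl)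

lemma continuous_on_local_integrand:
  assumes "\<And>j. j \<in> {1..k} \<Longrightarrow> norm (u j) < 1" "\<And>j. j \<in> {1..k} \<Longrightarrow> norm (v j) < 1"
  shows "continuous_on S (local_integrand k u v)"
  unfolding local_integrand_def[abs_def]
  by (intro continuous_intros) (use assms one_minus_e_mult_neq_0 in auto)

text \<open>The geometric series in \<open>e \<theta> * u j\<close> and
  \<open>e (- \<theta>) * v j\<close> converge uniformly because the moduli stay below
  \<open>c < 1\<close>, and integration over \<theta> leads back to the polydisc algebra.\<close>

lemma polydisc_alg_local_factor:
  assumes u: "\<And>j. j \<in> {1..k} \<Longrightarrow> (\<lambda>z. u z j) \<in> polydisc_alg \<rho> n"
      "\<And>z j. z \<in> polydisc \<rho> n \<Longrightarrow> j \<in> {1..k} \<Longrightarrow> norm (u z j) \<le> c"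
    and v: "\<And>j. j \<in> {1..k} \<Longrightarrow> (\<lambda>z. v z j) \<in> polydisc_alg \<rho> n"
      "\<And>z j. z \<in> polydisc \<rho> n \<Longrightarrow> j \<in> {1..k} \<Longrightarrow> norm (v z j) \<le> c"
    and c: "c < 1"
  shows "(\<lambda>z. local_factor k (u z) (v z)) \<in> polydisc_alg \<rho> n"
proof -
  let ?K = "{0..1} \<times> polydisc \<rho> n"
  have lift: "(\<lambda>x. f (snd x)) \<in> unif_closure (cyl_gens n) ?K" if "f \<in> polydisc_alg \<rho> n" for f
  proof (rule cyl.unif_closure_pullback[OF that])
    fix g assume "g \<in> coords n"
    then obtain i where "i \<in> {1..n}" "g = (\<lambda>z. z i)" unfolding coords_def by blast
    then show "(\<lambda>x. g (snd x)) \<in> unif_closure (cyl_gens n) ?K"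
      by (intro unif_closure_gen) (auto simp: cyl_gens_def)
  qed auto
  have e1: "(\<lambda>x. e (fst x)) \<in> unif_closure (cyl_gens n) ?K"
    by (rule unif_closure_gen) (unfold cyl_gens_def, rule UnI2, auto intro!: exI[of _ e] continuous_intros)
  have e2: "(\<lambda>x. e (- fst x)) \<in> unif_closure (cyl_gens n) ?K"
    by (rule unif_closure_gen) (unfold cyl_gens_def, rule UnI2, auto intro!: exI[of _ "\<lambda>\<theta>. e (- \<theta>)"] continuous_intros)
  have "(\<lambda>x. local_integrand k (u (snd x)) (v (snd x)) (fst x)) \<in> unif_closure (cyl_gens n) ?K"
    unfolding local_integrand_def
  proof (rule cyl.unif_closure_prod, rule cyl.unif_closure_mult)
    fix j assume j: "j \<in> {1..k}"
    show "(\<lambda>x. inverse (1 - e (fst x) * u (snd x) j)) \<in> unif_closure (cyl_gens n) ?K"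
      by (rule cyl.unif_closure_inverse_one_minus[OF _ _ c])
        (use u(2) j in \<open>auto simp: norm_mult intro!: cyl.unif_closure_mult e1 lift[OF u(1)[OF j]]\<close>)
    show "(\<lambda>x. inverse (1 - e (- fst x) * v (snd x) j)) \<in> unif_closure (cyl_gens n) ?K"
      by (rule cyl.unif_closure_inverse_one_minus[OF _ _ c])
        (use v(2) j in \<open>auto simp: norm_mult intro!: cyl.unif_closure_mult e2 lift[OF v(1)[OF j]]\<close>)
  qed
  then have "(\<lambda>z. integral {0..1} (\<lambda>\<theta>. local_integrand k (u (snd (\<theta>, z))) (v (snd (\<theta>, z))) (fst (\<theta>, z)))) \<in> polydisc_alg \<rho> n"
  proof (rule unif_closure_integral)
    fix z assume z: "z \<in> polydisc \<rho> n"
    have "norm (u z j) < 1" "norm (v z j) < 1" if "j \<in> {1..k}" for j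
      using u(2)[OF z that] v(2)[OF z that] c by auto
    then show "continuous_on {0..1} (\<lambda>\<theta>. local_integrand k (u (snd (\<theta>, z))) (v (snd (\<theta>, z))) (fst (\<theta>, z)))"
      using continuous_on_local_integrand[of k "u z" "v z"] by simp
  qed
  then have I: "(\<lambda>z. integral {0..1} (local_integrand k (u z) (v z))) \<in> polydisc_alg \<rho> n"
    by simp
  show ?thesis unfolding local_factor_def
    by (intro pd.unif_closure_mult I pd.unif_closure_prod pd.unif_closure_diff unif_closure_const u(1) v(1)) auto
qed

section \<open>Expansion of the local factors with cubic error\<close>

lemma mult_diff_bound:
  fixes a a' c c' :: complex
  assumes "norm (a - a') \<le> B * t" "norm (c - c') \<le> C * t" "norm a' \<le> M" "norm c \<le> L" "B \<ge> 0" "t \<ge> 0" "M \<ge> 0"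
  shows "norm (a * c - a' * c') \<le> (B * L + M * C) * t"
proof -
  have "a * c - a' * c' = (a - a') * c + a' * (c - c')" by (simp add: algebra_simps)
  then have "norm (a * c - a' * c') \<le> norm (a - a') * norm c + norm a' * norm (c - c')"
    by (metis norm_mult norm_triangle_ineq)
  also have "\<dots> \<le> (B * t) * L + M * (C * t)"
    by (intro add_mono mult_mono assms) (use assms in auto)
  also have "\<dots> = (B * L + M * C) * t" by (simp add: algebra_simps)
  finally show ?thesis .
qed

lemma norm_sum_le_card:
  fixes u :: "'i \<Rightarrow> complex"
  assumes "\<And>j. j \<in> J \<Longrightarrow> norm (u j) \<le> q"
  shows "norm (\<Sum>j\<in>J. u j) \<le> real (card J) * q"
  using sum_norm_le[of J u "\<lambda>_. q"] assms by simp

lemma inverse_one_minus_expansion: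
  fixes w :: complex
  assumes "norm w \<le> q" "q \<le> q0" "q0 < 1"
  shows "norm (inverse (1 - w) - (1 + w + w ^ 2)) \<le> 1 / (1 - q0) * q ^ 3"
proof -
  have "norm w < 1" "0 \<le> q" using assms norm_ge_zero[of w] by linarith+
  then have w: "w \<noteq> 1" by auto
  have "norm (1 - w) \<ge> 1 - norm w" by (metis norm_one norm_triangle_ineq2)
  then have nw: "norm (1 - w) \<ge> 1 - q0" using assms by linarith
  have "inverse (1 - w) - (1 + w + w ^ 2) = w ^ 3 / (1 - w)"
    using w by (simp add: field_simps power2_eq_square power3_eq_cube)
  then have "norm (inverse (1 - w) - (1 + w + w ^ 2)) = norm w ^ 3 / norm (1 - w)"
    by (simp add: norm_divide norm_power)
  also have "\<dots> \<le> q ^ 3 / (1 - q0)"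
    using assms nw \<open>0 \<le> q\<close> by (intro frac_le power_mono) auto
  finally show ?thesis by simp
qed

text \<open>\<open>W\<close> may depend on \<open>u\<close> but not on \<open>x\<close>, so for
  \<open>x = e \<theta>\<close> the quadratic term has the pure frequency 2; only its size is
  recorded. The constant \<open>C\<close> is uniform in \<open>q\<close> and \<open>u\<close>, as is
  needed for a bound over all primes.\<close>

lemma prod_inverse_expansion:
  assumes "finite J" and q0: "0 \<le> q0" "q0 < 1"
  shows "\<exists>C\<ge>0. \<forall>q u. 0 \<le> q \<longrightarrow> q \<le> q0 \<longrightarrow> (\<forall>j\<in>J. norm (u j) \<le> q) \<longrightarrow>
     (\<exists>W. norm W \<le> C * q ^ 2 \<and> (\<forall>x. norm x = 1 \<longrightarrow>
        norm ((\<Prod>j\<in>J. inverse (1 - x * u j)) - (1 + (\<Sum>j\<in>J. u j) * x + W * x ^ 2 :: complex)) \<le> C * q ^ 3))"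
  using \<open>finite J\<close>
proof (induction J rule: finite_induct)
  case empty
  show ?case by (intro exI[of _ 0]) (auto intro!: exI[of _ 0])
next
  case (insert j J)
  then obtain C where C: "C \<ge> 0" and *: "\<And>q u. 0 \<le> q \<Longrightarrow> q \<le> q0 \<Longrightarrow> (\<forall>j\<in>J. norm (u j) \<le> q) \<Longrightarrow>
     (\<exists>W. norm W \<le> C * q ^ 2 \<and> (\<forall>x. norm x = 1 \<longrightarrow>
        norm ((\<Prod>j\<in>J. inverse (1 - x * u j)) - (1 + (\<Sum>j\<in>J. u j) * x + W * x ^ 2 :: complex)) \<le> C * q ^ 3))"
    by blast
  define m where "m = real (card J)"
  define L where "L = 1 + m + 2 * C"
  \<comment> \<open>The summands bound, in this order, the error of replacing both factors by their
    truncations (\<open>L\<close> bounds \<open>g\<close>, 3 bounds \<open>h0\<close>), the terms of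
    degree 3 and 4 in \<open>x\<close>, and \<open>norm W'\<close>.\<close>
  define C' where "C' = 1 / (1 - q0) * L + 3 * C + (C + m + C) + (C + m + 1)"
  have pos: "m \<ge> 0" "L \<ge> 0" "1 / (1 - q0) \<ge> 0" using C q0 by (auto simp: m_def L_def)
  have C'0: "C' \<ge> 0" using C pos by (simp add: C'_def)
  have C'1: "C + m + 1 \<le> C'" using C pos mult_nonneg_nonneg[OF pos(3,2)] by (simp add: C'_def)
  show ?case
  proof (intro exI[of _ C'] conjI C'0 allI impI)
    fix q and u :: "'a \<Rightarrow> complex" assume q: "0 \<le> q" "q \<le> q0" and u: "\<forall>i\<in>insert j J. norm (u i) \<le> q"
    have q1: "q \<le> 1" using q q0 by auto
    obtain W where W: "norm W \<le> C * q ^ 2" and R: "\<And>x. norm x = 1 \<Longrightarrow>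
        norm ((\<Prod>j\<in>J. inverse (1 - x * u j)) - (1 + (\<Sum>j\<in>J. u j) * x + W * x ^ 2)) \<le> C * q ^ 3"
      using *[of q u] q u by auto
    define U where "U = (\<Sum>j\<in>J. u j)"
    define W' where "W' = W + u j * U + u j ^ 2"
    have nU: "norm U \<le> m * q" unfolding U_def m_def by (rule norm_sum_le_card) (use u in auto)
    have nu: "norm (u j) \<le> q" using u by auto
    have qq: "q ^ 2 \<le> 1" "q ^ 3 \<le> 1" "q ^ 4 \<le> q ^ 3" using q q1 by (auto intro: power_le_one power_decreasing)
    have nuU: "norm (u j * U) \<le> m * q ^ 2"
      using mult_mono[OF nu nU] q by (simp add: norm_mult power2_eq_square mult_ac)
    have nu2: "norm (u j ^ 2) \<le> q ^ 2" using nu by (simp add: norm_power power_mono)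
    have "norm W' \<le> C * q ^ 2 + m * q ^ 2 + q ^ 2"
      unfolding W'_def using W nuU nu2 by (intro norm_triangle_mono)
    also have "\<dots> = (C + m + 1) * q ^ 2" by (simp add: algebra_simps)
    also have "\<dots> \<le> C' * q ^ 2" using C'1 by (intro mult_right_mono) auto
    finally have nW': "norm W' \<le> C' * q ^ 2" .
    have "norm ((\<Prod>i\<in>insert j J. inverse (1 - x * u i)) - (1 + (\<Sum>i\<in>insert j J. u i) * x + W' * x ^ 2)) \<le> C' * q ^ 3"
      if x: "norm x = 1" for x
    proof -
      define g where "g = (\<Prod>i\<in>J. inverse (1 - x * u i))"
      define g0 where "g0 = 1 + U * x + W * x ^ 2"
      define h where "h = inverse (1 - x * u j)"
      define h0 where "h0 = 1 + x * u j + (x * u j) ^ 2"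
      have gg: "norm (g - g0) \<le> C * q ^ 3" using R[OF x] by (simp add: g_def g0_def U_def)
      have hh: "norm (h - h0) \<le> 1 / (1 - q0) * q ^ 3" unfolding h_def h0_def
        by (rule inverse_one_minus_expansion) (use nu x q q0 in \<open>auto simp: norm_mult\<close>)
      have "norm g0 \<le> 1 + m * q + C * q ^ 2"
        unfolding g0_def using nU W x by (intro norm_triangle_mono) (auto simp: norm_mult norm_power)
      also have "\<dots> \<le> 1 + m * 1 + C * 1" using C pos q1 qq by (intro add_mono mult_left_mono) auto
      finally have ng0: "norm g0 \<le> 1 + m + C" by simp
      have "norm g \<le> norm (g - g0) + norm g0" by norm
      also have "\<dots> \<le> C * 1 + (1 + m + C)"
        using gg ng0 qq(2) mult_left_mono[OF qq(2) C] by linarith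
      finally have ng: "norm g \<le> L" by (simp add: L_def)
      have nh0: "norm h0 \<le> 3"
      proof -
        have "norm h0 \<le> 1 + q + q ^ 2"
          unfolding h0_def using nu nu2 x by (intro norm_triangle_mono) (auto simp: norm_mult norm_power)
        then show ?thesis using q1 qq(1) by linarith
      qed
      have d1: "norm (h * g - h0 * g0) \<le> (1 / (1 - q0) * L + 3 * C) * q ^ 3"
        by (rule mult_diff_bound[OF hh gg nh0 ng]) (use q pos in auto)
      have eq: "h0 * g0 - (1 + (u j + U) * x + W' * x ^ 2) = (u j * W + u j ^ 2 * U) * x ^ 3 + u j ^ 2 * W * x ^ 4"
        unfolding h0_def g0_def W'_def by (simp add: algebra_simps power2_eq_square power3_eq_cube power4_eq_xxxx)
      have t1: "norm (u j * W) \<le> C * q ^ 3"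
        using mult_mono[OF nu W] q by (simp add: norm_mult power2_eq_square power3_eq_cube mult_ac)
      have t2: "norm (u j ^ 2 * U) \<le> m * q ^ 3"
        using mult_mono[OF nu2 nU] q by (simp add: norm_mult power2_eq_square power3_eq_cube mult_ac)
      have t3: "norm (u j ^ 2 * W) \<le> C * q ^ 3"
      proof -
        have "norm (u j ^ 2 * W) \<le> C * q ^ 4"
          using mult_mono[OF nu2 W] q by (simp add: norm_mult power2_eq_square power4_eq_xxxx mult_ac)
        then show ?thesis using mult_left_mono[OF qq(3) C] by linarith
      qed
      have d2: "norm (h0 * g0 - (1 + (u j + U) * x + W' * x ^ 2)) \<le> (C + m + C) * q ^ 3"
      proof -
        have "norm ((u j * W + u j ^ 2 * U) * x ^ 3 + u j ^ 2 * W * x ^ 4) \<le> (C * q ^ 3 + m * q ^ 3) + C * q ^ 3"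
        proof (rule norm_triangle_mono)
          show "norm ((u j * W + u j ^ 2 * U) * x ^ 3) \<le> C * q ^ 3 + m * q ^ 3"
            using norm_triangle_mono[OF t1 t2] x by (simp add: norm_mult norm_power)
          show "norm (u j ^ 2 * W * x ^ 4) \<le> C * q ^ 3"
            using t3 x by (simp add: norm_mult norm_power)
        qed
        then show ?thesis unfolding eq by (simp add: algebra_simps)
      qed
      have "norm (h * g - (1 + (u j + U) * x + W' * x ^ 2)) \<le>
          (1 / (1 - q0) * L + 3 * C) * q ^ 3 + (C + m + C) * q ^ 3"
        by (rule norm_diff_triangle_le[OF d1 d2])
      also have "\<dots> = (1 / (1 - q0) * L + 3 * C + (C + m + C)) * q ^ 3" by (simp add: algebra_simps)
      also have "\<dots> \<le> C' * q ^ 3"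
        using C pos q by (intro mult_right_mono) (auto simp: C'_def)
      finally show ?thesis using insert.hyps by (simp add: h_def g_def U_def)
    qed
    then show "\<exists>W. norm W \<le> C' * q ^ 2 \<and> (\<forall>x. norm x = 1 \<longrightarrow>
        norm ((\<Prod>i\<in>insert j J. inverse (1 - x * u i)) - (1 + (\<Sum>i\<in>insert j J. u i) * x + W * x ^ 2)) \<le> C' * q ^ 3)"
      using nW' by blast
  qed
qed

text \<open>Only products of opposite frequencies have a nonzero mean over the period.\<close>

lemma integral_trig_product:
  "integral {0..1} (\<lambda>\<theta>. (1 + U * e \<theta> + W * e \<theta> ^ 2) * (1 + V * e (- \<theta>) + Y * e (- \<theta>) ^ 2)) = 1 + U * V + W * Y"
proof -
  have int: "((\<lambda>\<theta>. c * e (of_int m * \<theta>)) has_integral 0) {0..1}" if "m \<noteq> 0" for c m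
    using has_integral_mult_right[OF integral_e_int[OF that], of c] by simp
  define t where "t = 1 + U * V + W * Y"
  have "((\<lambda>\<theta>. t + (U + W * V) * e (of_int 1 * \<theta>) + (V + U * Y) * e (of_int (-1) * \<theta>)
      + W * e (of_int 2 * \<theta>) + Y * e (of_int (-2) * \<theta>)) has_integral (t + 0 + 0 + 0 + 0)) {0..1}"
    using has_integral_const_real[of t 0 1] by (intro has_integral_add int) auto
  moreover have "t + (U + W * V) * e (of_int 1 * \<theta>) + (V + U * Y) * e (of_int (-1) * \<theta>)
      + W * e (of_int 2 * \<theta>) + Y * e (of_int (-2) * \<theta>) =
      (1 + U * e \<theta> + W * e \<theta> ^ 2) * (1 + V * e (- \<theta>) + Y * e (- \<theta>) ^ 2)" for \<theta>
  proof -
    have e2: "e (2 * t) = e t ^ 2" for t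
      unfolding e_def by (simp add: power2_eq_square exp_add[symmetric] mult_ac)
    have "e (of_int 1 * \<theta>) = e \<theta>" "e (of_int (-1) * \<theta>) = inverse (e \<theta>)" "e (of_int 2 * \<theta>) = e \<theta> ^ 2"
      "e (of_int (-2) * \<theta>) = inverse (e \<theta>) ^ 2" 
      using e2[of \<theta>] e2[of "- \<theta>"] by (simp_all add: e_minus)
    then show ?thesis unfolding t_def by (simp only: e_minus) (simp add: field_simps power2_eq_square)
  qed
  ultimately have "((\<lambda>\<theta>. (1 + U * e \<theta> + W * e \<theta> ^ 2) * (1 + V * e (- \<theta>) + Y * e (- \<theta>) ^ 2))
      has_integral (1 + U * V + W * Y)) {0..1}"
    by (simp add: t_def)
  then show ?thesis by (rule integral_unique)
qed

lemma prod_one_minus_expansion: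
  assumes "finite J"
  shows "\<exists>C\<ge>0. \<forall>q a. 0 \<le> q \<longrightarrow> q \<le> 1 \<longrightarrow> (\<forall>j\<in>J. norm (a j) \<le> q ^ 2) \<longrightarrow>
     norm ((\<Prod>j\<in>J. 1 - a j) - (1 - (\<Sum>j\<in>J. a j) :: complex)) \<le> C * q ^ 3"
  using assms
proof (induction J rule: finite_induct)
  case empty
  show ?case by (intro exI[of _ 0]) auto
next
  case (insert j J)
  then obtain C where C: "C \<ge> 0" and *: "\<And>q a. 0 \<le> q \<Longrightarrow> q \<le> 1 \<Longrightarrow> (\<forall>j\<in>J. norm (a j) \<le> q ^ 2) \<Longrightarrow>
     norm ((\<Prod>j\<in>J. 1 - a j) - (1 - (\<Sum>j\<in>J. a j) :: complex)) \<le> C * q ^ 3"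
    by blast
  define m where "m = real (card J)"
  have "m \<ge> 0" by (simp add: m_def)
  show ?case
  proof (intro exI[of _ "m + 2 * C"] conjI allI impI)
    show "0 \<le> m + 2 * C" using C \<open>m \<ge> 0\<close> by simp
    fix q and a :: "'a \<Rightarrow> complex" assume q: "0 \<le> q" "q \<le> 1" and a: "\<forall>i\<in>insert j J. norm (a i) \<le> q ^ 2"
    define S where "S = (\<Sum>i\<in>J. a i)"
    define R where "R = (\<Prod>i\<in>J. 1 - a i) - (1 - S)"
    have R: "norm R \<le> C * q ^ 3" unfolding R_def S_def using * q a by auto
    have S: "norm S \<le> m * q ^ 2" unfolding S_def m_def by (rule norm_sum_le_card) (use a in auto)
    have aj: "norm (a j) \<le> q ^ 2" using a by auto
    have q4: "q ^ 4 \<le> q ^ 3" "q ^ 2 \<le> 1" using q by (auto intro: power_decreasing power_le_one)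
    have "norm (1 - a j) \<le> 1 + norm (a j)" using norm_triangle_ineq4[of 1 "a j"] by simp
    then have n1: "norm (1 - a j) \<le> 2" using aj q4 by linarith
    have "norm (a j * S) \<le> m * q ^ 4"
      using mult_mono[OF aj S] q by (simp add: norm_mult power2_eq_square power4_eq_xxxx mult_ac)
    also have "\<dots> \<le> m * q ^ 3" using q4 \<open>m \<ge> 0\<close> by (intro mult_left_mono)
    finally have t1: "norm (a j * S) \<le> m * q ^ 3" .
    have t2: "norm ((1 - a j) * R) \<le> 2 * (C * q ^ 3)"
      unfolding norm_mult by (intro mult_mono n1 R) auto
    have "(\<Prod>i\<in>insert j J. 1 - a i) - (1 - (\<Sum>i\<in>insert j J. a i)) = a j * S + (1 - a j) * R"
      using insert.hyps by (simp add: R_def S_def algebra_simps)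
    also have "norm \<dots> \<le> m * q ^ 3 + 2 * (C * q ^ 3)" by (rule norm_triangle_mono[OF t1 t2])
    also have "\<dots> = (m + 2 * C) * q ^ 3" by (simp add: algebra_simps)
    finally show "norm ((\<Prod>i\<in>insert j J. 1 - a i) - (1 - (\<Sum>i\<in>insert j J. a i))) \<le> (m + 2 * C) * q ^ 3" .
  qed
qed

text \<open>Taking the mean over \<theta> leaves \<open>U * V\<close>, of order
  \<open>q ^ 2\<close>, and \<open>W * Y\<close>, of order \<open>q ^ 4\<close>; the truncation
  errors of the two products are cubic.\<close>

lemma local_integral_bound:
  assumes q0: "0 \<le> q0" "q0 < 1"
  shows "\<exists>D\<ge>0. \<forall>q u v. 0 \<le> q \<longrightarrow> q \<le> q0 \<longrightarrow> (\<forall>j\<in>{1..k}. norm (u j) \<le> q) \<longrightarrow> (\<forall>j\<in>{1..k}. norm (v j) \<le> q) \<longrightarrow>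
     norm (integral {0..1} (local_integrand k u v) - (1 + (\<Sum>j\<in>{1..k}. u j) * (\<Sum>j\<in>{1..k}. v j))) \<le> D * q ^ 3"
proof -
  obtain C where C: "C \<ge> 0" and *: "\<And>q u. 0 \<le> q \<Longrightarrow> q \<le> q0 \<Longrightarrow> (\<forall>j\<in>{1..k}. norm (u j) \<le> q) \<Longrightarrow>
     (\<exists>W. norm W \<le> C * q ^ 2 \<and> (\<forall>x. norm x = 1 \<longrightarrow>
        norm ((\<Prod>j\<in>{1..k}. inverse (1 - x * u j)) - (1 + (\<Sum>j\<in>{1..k}. u j) * x + W * x ^ 2 :: complex)) \<le> C * q ^ 3))"
    using prod_inverse_expansion[of "{1..k}" q0] q0 by auto
  define M where "M = 1 + real k + C"
  define L where "L = 1 + real k + 2 * C"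
  define D where "D = (C * L + M * C) + C * C"
  have pos: "M \<ge> 0" "L \<ge> 0" "D \<ge> 0" using C by (auto simp: M_def L_def D_def)
  show ?thesis
  proof (intro exI[of _ D] conjI allI impI pos)
    fix q and u v :: "nat \<Rightarrow> complex" assume q: "0 \<le> q" "q \<le> q0" and u: "\<forall>j\<in>{1..k}. norm (u j) \<le> q" and v: "\<forall>j\<in>{1..k}. norm (v j) \<le> q"
    define U where "U = (\<Sum>j\<in>{1..k}. u j)"
    define V where "V = (\<Sum>j\<in>{1..k}. v j)"
    obtain W where W: "norm W \<le> C * q ^ 2" and RW: "\<And>x. norm x = 1 \<Longrightarrow>
        norm ((\<Prod>j\<in>{1..k}. inverse (1 - x * u j)) - (1 + U * x + W * x ^ 2 :: complex)) \<le> C * q ^ 3"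
      using *[OF q u] unfolding U_def by blast
    obtain Y where Y: "norm Y \<le> C * q ^ 2" and RY: "\<And>x. norm x = 1 \<Longrightarrow>
        norm ((\<Prod>j\<in>{1..k}. inverse (1 - x * v j)) - (1 + V * x + Y * x ^ 2 :: complex)) \<le> C * q ^ 3"
      using *[OF q v] unfolding V_def by blast
    have nU: "norm U \<le> real k * q" "norm V \<le> real k * q"
      using norm_sum_le_card[of "{1..k}" u q] norm_sum_le_card[of "{1..k}" v q] u v by (auto simp: U_def V_def)
    have q1: "q \<le> 1" using q q0 by auto
    have qq: "q ^ 2 \<le> 1" "q ^ 3 \<le> 1" "q ^ 4 \<le> q ^ 3" using q q1 by (auto intro: power_le_one power_decreasing)
    have base: "norm (1 + T * x + Z * x ^ 2) \<le> M" if "norm T \<le> real k * q" "norm Z \<le> C * q ^ 2" "norm x = 1" for T Z x :: complex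
    proof -
      have "norm (1 + T * x + Z * x ^ 2) \<le> 1 + real k * q + C * q ^ 2"
        using that by (intro norm_triangle_mono) (auto simp: norm_mult norm_power)
      also have "\<dots> \<le> 1 + real k * 1 + C * 1" using q1 qq C by (intro add_mono mult_left_mono) auto
      finally show ?thesis by (simp add: M_def)
    qed
    let ?f = "\<lambda>\<theta>. 1 + U * e \<theta> + W * e \<theta> ^ 2" and ?g = "\<lambda>\<theta>. 1 + V * e (- \<theta>) + Y * e (- \<theta>) ^ 2"
    have pt: "norm (local_integrand k u v \<theta> - ?f \<theta> * ?g \<theta>) \<le> (C * L + M * C) * q ^ 3" for \<theta>
      unfolding local_integrand_def prod.distrib
    proof (rule mult_diff_bound)
      show "norm ((\<Prod>j\<in>{1..k}. inverse (1 - e \<theta> * u j)) - ?f \<theta>) \<le> C * q ^ 3" by (rule RW) simp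
      show r: "norm ((\<Prod>j\<in>{1..k}. inverse (1 - e (- \<theta>) * v j)) - ?g \<theta>) \<le> C * q ^ 3" by (rule RY) simp
      show "norm (?f \<theta>) \<le> M" by (rule base) (use nU W in auto)
      have "norm (?g \<theta>) \<le> M" by (rule base) (use nU Y in auto)
      then have "norm (\<Prod>j\<in>{1..k}. inverse (1 - e (- \<theta>) * v j)) \<le> C * q ^ 3 + M"
        using norm_triangle_mono[OF r, of "?g \<theta>" M] by simp
      also have "\<dots> \<le> L" using mult_left_mono[OF qq(2) C] by (simp add: L_def M_def)
      finally show "norm (\<Prod>j\<in>{1..k}. inverse (1 - e (- \<theta>) * v j)) \<le> L" .
    qed (use C q pos in auto)
    have lt: "norm (u j) < 1" "norm (v j) < 1" if "j \<in> {1..k}" for j using u v q q0 that by force+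
    have cont: "continuous_on {0..1} (local_integrand k u v)" "continuous_on {0..1} (\<lambda>\<theta>. ?f \<theta> * ?g \<theta>)"
      by (auto intro!: continuous_intros continuous_on_local_integrand lt)
    have "norm (integral {0..1} (\<lambda>\<theta>. local_integrand k u v \<theta> - ?f \<theta> * ?g \<theta>)) \<le> (C * L + M * C) * q ^ 3 * (1 - 0)"
      by (rule integral_bound) (use pt cont in \<open>auto intro!: continuous_on_diff\<close>)
    then have d1: "norm (integral {0..1} (local_integrand k u v) - (1 + U * V + W * Y)) \<le> (C * L + M * C) * q ^ 3"
      using cont by (simp add: integral_diff integrable_continuous_real integral_trig_product)
    have "norm (W * Y) \<le> C * C * q ^ 4"
      using mult_mono[OF W Y] C by (simp add: norm_mult power2_eq_square power4_eq_xxxx mult_ac)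
    also have "\<dots> \<le> C * C * q ^ 3" using C qq by (intro mult_left_mono) auto
    finally have d2: "norm (1 + U * V + W * Y - (1 + U * V)) \<le> C * C * q ^ 3" by simp
    show "norm (integral {0..1} (local_integrand k u v) - (1 + (\<Sum>j\<in>{1..k}. u j) * (\<Sum>j\<in>{1..k}. v j))) \<le> D * q ^ 3"
      using norm_diff_triangle_le[OF d1 d2] by (simp add: D_def U_def V_def algebra_simps)
  qed
qed

text \<open>This is the cancellation that makes the Euler product converge. Up to cubic errors the
  finite product is \<open>1 - T\<close> and the integral is \<open>1 + T\<close>, and in
  \<open>(1 - T) * (1 + T) = 1 - T ^ 2\<close> the term \<open>T ^ 2\<close> has order
  \<open>q ^ 4\<close>.\<close>

lemma local_factor_bound:
  assumes q0: "0 \<le> q0" "q0 < 1"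
  shows "\<exists>C\<ge>0. \<forall>q u v. 0 \<le> q \<longrightarrow> q \<le> q0 \<longrightarrow> (\<forall>j\<in>{1..k}. norm (u j) \<le> q) \<longrightarrow> (\<forall>j\<in>{1..k}. norm (v j) \<le> q) \<longrightarrow>
     norm (local_factor k u v - 1) \<le> C * q ^ 3"
proof -
  obtain D where D: "D \<ge> 0" and dI: "\<And>q u v. 0 \<le> q \<Longrightarrow> q \<le> q0 \<Longrightarrow> (\<forall>j\<in>{1..k}. norm (u j) \<le> q) \<Longrightarrow> (\<forall>j\<in>{1..k}. norm (v j) \<le> q) \<Longrightarrow>
     norm (integral {0..1} (local_integrand k u v) - (1 + (\<Sum>j\<in>{1..k}. u j) * (\<Sum>j\<in>{1..k}. v j))) \<le> D * q ^ 3"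
    using local_integral_bound[OF q0, of k] by blast
  obtain B where B: "B \<ge> 0" and dB: "\<And>q a. 0 \<le> q \<Longrightarrow> q \<le> 1 \<Longrightarrow> (\<forall>j\<in>{1..k}\<times>{1..k}. norm (a j) \<le> q ^ 2) \<Longrightarrow>
     norm ((\<Prod>j\<in>{1..k}\<times>{1..k}. 1 - a j) - (1 - (\<Sum>j\<in>{1..k}\<times>{1..k}. a j) :: complex)) \<le> B * q ^ 3"
    using prod_one_minus_expansion[of "{1..k}\<times>{1..k}"] by auto
  define m where "m = real k * real k"
  define C where "C = (B * (1 + m + D) + (1 + m) * D) + m * m"
  have pos: "m \<ge> 0" "C \<ge> 0" using B D by (auto simp: m_def C_def)
  show ?thesis
  proof (intro exI[of _ C] conjI allI impI pos)
    fix q and u v :: "nat \<Rightarrow> complex" assume q: "0 \<le> q" "q \<le> q0" and u: "\<forall>j\<in>{1..k}. norm (u j) \<le> q" and v: "\<forall>j\<in>{1..k}. norm (v j) \<le> q"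
    define T where "T = (\<Sum>j\<in>{1..k}. u j) * (\<Sum>j\<in>{1..k}. v j)"
    define F where "F = (\<Prod>i\<in>{1..k}. \<Prod>j\<in>{1..k}. 1 - u i * v j)"
    define I where "I = integral {0..1} (local_integrand k u v)"
    have q1: "q \<le> 1" using q q0 by auto
    have qq: "q ^ 2 \<le> 1" "q ^ 3 \<le> 1" "q ^ 4 \<le> q ^ 3" using q q1 by (auto intro: power_le_one power_decreasing)
    have I: "norm (I - (1 + T)) \<le> D * q ^ 3" using dI[OF q u v] by (simp add: I_def T_def)
    have F: "norm (F - (1 - T)) \<le> B * q ^ 3"
    proof -
      have "norm (u i * v j) \<le> q ^ 2" if "i \<in> {1..k}" "j \<in> {1..k}" for i j
        using mult_mono[of "norm (u i)" q "norm (v j)" q] u v that q by (simp add: norm_mult power2_eq_square)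
      then have "norm ((\<Prod>j\<in>{1..k}\<times>{1..k}. 1 - u (fst j) * v (snd j)) - (1 - (\<Sum>j\<in>{1..k}\<times>{1..k}. u (fst j) * v (snd j)))) \<le> B * q ^ 3"
        by (intro dB q q1) auto
      then show ?thesis
        by (simp add: F_def T_def prod.cartesian_product sum_product sum.cartesian_product case_prod_beta)
    qed
    have "norm T \<le> (real k * q) * (real k * q)" unfolding T_def norm_mult
      using norm_sum_le_card[of "{1..k}" u q] norm_sum_le_card[of "{1..k}" v q] u v q by (intro mult_mono) auto
    then have T: "norm T \<le> m * q ^ 2" by (simp add: m_def power2_eq_square mult_ac)
    then have T1: "norm T \<le> m" using mult_left_mono[OF qq(1) pos(1)] by linarith
    have n1: "norm (1 - T) \<le> 1 + m" "norm (1 + T) \<le> 1 + m"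
      using norm_triangle_ineq4[of 1 T] norm_triangle_ineq[of 1 T] T1 by auto
    have "norm I \<le> D * q ^ 3 + (1 + m)"
      using norm_triangle_mono[OF I n1(2)] by simp
    then have nI: "norm I \<le> 1 + m + D" using mult_left_mono[OF qq(2) D] by linarith
    have d1: "norm (F * I - (1 - T) * (1 + T)) \<le> (B * (1 + m + D) + (1 + m) * D) * q ^ 3"
      by (rule mult_diff_bound[OF F I n1(1) nI]) (use B q pos in auto)
    have "norm (T * T) \<le> m * m * q ^ 4"
      using mult_mono[OF T T] pos by (simp add: norm_mult power2_eq_square power4_eq_xxxx mult_ac)
    also have "\<dots> \<le> m * m * q ^ 3" using pos qq by (intro mult_left_mono) auto
    finally have d2: "norm ((1 - T) * (1 + T) - 1) \<le> m * m * q ^ 3" by (simp add: algebra_simps)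
    show "norm (local_factor k u v - 1) \<le> C * q ^ 3"
      using norm_diff_triangle_le[OF d1 d2]
      by (simp add: local_factor_def F_def I_def C_def distrib_right)
  qed
qed

text \<open>On this polydisc the small variables are at most \<open>p powr (- 1/2 + 1/12)\<close>,
  so a local factor differs from 1 by a multiple of \<open>p powr (- 5/4)\<close>, which is summable
  even over all natural numbers.\<close>

lemma polydisc_alg_A:
  assumes \<rho>: "\<rho> \<le> 1/12"
  shows "A k \<in> polydisc_alg \<rho> (2 * k)"
proof -
  \<comment> \<open>The bound for \<open>p = 2\<close>, the worst prime; it is below 1, so the
    geometric series converge uniformly in the prime.\<close>
  define q0 :: real where "q0 = 2 powr (-5/12)"
  have q0: "0 \<le> q0" "q0 < 1" unfolding q0_def by (auto simp: powr_less_one)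
  obtain C where C: "C \<ge> 0" and loc: "\<And>q u v. 0 \<le> q \<Longrightarrow> q \<le> q0 \<Longrightarrow> (\<forall>j\<in>{1..k}. norm (u j) \<le> q) \<Longrightarrow> (\<forall>j\<in>{1..k}. norm (v j) \<le> q) \<Longrightarrow>
     norm (local_factor k u v - 1) \<le> C * q ^ 3"
    using local_factor_bound[OF q0, of k] by blast
  define u where "u = (\<lambda>p z (j::nat). complex_of_nat p powr (- 1/2 - z j))"
  define v where "v = (\<lambda>p z j. complex_of_nat p powr (- 1/2 + z (k + j)))"
  have bound: "norm (complex_of_nat p powr (- 1/2 + w)) \<le> real p powr (-5/12)" if "p > 0" "norm w \<le> \<rho>" for p w
  proof -
    have "norm (complex_of_nat p powr (- 1/2 + w)) = real p powr (- 1/2 + Re w)"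
      using that by (subst norm_powr_real_powr) auto
    also have "\<dots> \<le> real p powr (-5/12)"
      using that abs_Re_le_cmod[of w] \<rho> by (intro powr_mono) auto
    finally show ?thesis .
  qed
  have bu: "norm (u p z j) \<le> real p powr (-5/12)" if "p > 0" "z \<in> polydisc \<rho> (2 * k)" "j \<in> {1..k}" for p z j
    using bound[of p "- z j"] that by (auto simp: u_def polydisc_def)
  have bv: "norm (v p z j) \<le> real p powr (-5/12)" if "p > 0" "z \<in> polydisc \<rho> (2 * k)" "j \<in> {1..k}" for p z j
    using bound[of p "z (k + j)"] that by (auto simp: v_def polydisc_def)
  have pq: "real p powr (-5/12) \<le> q0" if "p \<ge> 2" for p
    unfolding q0_def using that by (intro powr_mono2') auto
  have mem: "(\<lambda>z. u p z j) \<in> polydisc_alg \<rho> (2 * k)" "(\<lambda>z. v p z j) \<in> polydisc_alg \<rho> (2 * k)"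
    if "p > 0" "j \<in> {1..k}" for p j
  proof -
    have "(\<lambda>z. exp ((- 1/2 - z j) * Ln (of_nat p))) \<in> polydisc_alg \<rho> (2 * k)"
      using that by (intro pd.unif_closure_exp pd.unif_closure_mult pd.unif_closure_diff unif_closure_const polydisc_alg_coord) auto
    then show "(\<lambda>z. u p z j) \<in> polydisc_alg \<rho> (2 * k)" using that by (simp add: u_def powr_def)
    have "(\<lambda>z. exp ((- 1/2 + z (k + j)) * Ln (of_nat p))) \<in> polydisc_alg \<rho> (2 * k)"
      using that by (intro pd.unif_closure_exp pd.unif_closure_mult unif_closure_add unif_closure_const polydisc_alg_coord) auto
    then show "(\<lambda>z. v p z j) \<in> polydisc_alg \<rho> (2 * k)" using that by (simp add: v_def powr_def)
  qed
  have A_loc: "A_local k z p = local_factor k (u p z) (v p z)" if "p > 0" for p z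
    unfolding A_local_eq[OF that] u_def v_def ..
  have "(\<lambda>z. \<Prod>p. if prime p then A_local k z p else 1) \<in> polydisc_alg \<rho> (2 * k)"
  proof (rule pd.unif_closure_prodinf)
    fix p :: nat
    show "(\<lambda>z. if prime p then A_local k z p else 1) \<in> polydisc_alg \<rho> (2 * k)"
    proof (cases "prime p")
      case True
      then have p: "p \<ge> 2" "p > 0" using prime_ge_2_nat[of p] by auto
      have "(\<lambda>z. local_factor k (u p z) (v p z)) \<in> polydisc_alg \<rho> (2 * k)"
      proof (rule polydisc_alg_local_factor[where c = q0])
        fix z j assume "z \<in> polydisc \<rho> (2 * k)" "j \<in> {1..k}"
        then show "norm (u p z j) \<le> q0" "norm (v p z j) \<le> q0"
          using bu[OF p(2)] bv[OF p(2)] pq[OF p(1)] by (meson order_trans)+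
      qed (use mem p q0 in auto)
      then show ?thesis using True p by (simp add: A_loc)
    qed auto
  next
    fix p :: nat and z assume z: "z \<in> polydisc \<rho> (2 * k)"
    show "norm ((if prime p then A_local k z p else 1) - 1) \<le> C * real p powr (-5/4)"
    proof (cases "prime p")
      case True
      then have p: "p \<ge> 2" "p > 0" using prime_ge_2_nat[of p] by auto
      have "norm (local_factor k (u p z) (v p z) - 1) \<le> C * (real p powr (-5/12)) ^ 3"
        by (rule loc) (use bu[OF _ z] bv[OF _ z] p pq in auto)
      also have "(real p powr (-5/12)) ^ 3 = real p powr (-5/4)" using p by (simp add: powr_power)
      finally show ?thesis using True p by (simp add: A_loc)
    qed (use C in auto)
  next
    show "summable (\<lambda>p. C * real p powr (-5/4))"
      by (intro summable_mult) (simp add: summable_real_powr_iff)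
  qed
  then show ?thesis by (simp add: A_def[abs_def])
qed

section \<open>Nonvanishing of the arithmetic constant\<close>

lemma power_one_minus_expansion:
  fixes y :: real
  assumes "0 \<le> y" "y \<le> 1"
  shows "\<bar>(1 - y) ^ m - (1 - real m * y)\<bar> \<le> real m ^ 2 * y ^ 2"
proof (induction m)
  case (Suc m)
  define R where "R = (1 - y) ^ m - (1 - real m * y)"
  have "(1 - y) ^ Suc m - (1 - real (Suc m) * y) = real m * y ^ 2 + (1 - y) * R"
    by (simp add: R_def algebra_simps power2_eq_square)
  also have "\<bar>\<dots>\<bar> \<le> real m * y ^ 2 + 1 * (real m ^ 2 * y ^ 2)"
  proof (intro order_trans[OF abs_triangle_ineq] add_mono)
    show "\<bar>(1 - y) * R\<bar> \<le> 1 * (real m ^ 2 * y ^ 2)"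
      unfolding abs_mult by (rule mult_mono) (use Suc assms in \<open>auto simp: R_def\<close>)
  qed (simp add: abs_mult)
  also have "\<dots> \<le> real (Suc m) ^ 2 * y ^ 2"
    unfolding distrib_right[symmetric] mult_1 by (intro mult_right_mono) (auto simp: power2_eq_square algebra_simps)
  finally show ?case .
qed simp

text \<open>The coefficients \<open>c n\<close> are nonnegative with \<open>c 0 = 1\<close> and
  \<open>c 1 = k ^ 2\<close>. The terms from degree 2 on are \<open>y ^ 2\<close> times a series
  dominated by its value at 1/2, the largest argument \<open>1 / p\<close>.\<close>

lemma hyp2F1_expansion:
  assumes "k \<ge> 1"
  shows "\<exists>D\<ge>0. \<forall>y. 0 \<le> y \<longrightarrow> y \<le> 1/2 \<longrightarrow> hyp2F1 (real k) (real k) 1 y \<ge> 1 \<and>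
    \<bar>hyp2F1 (real k) (real k) 1 y - (1 + real (k ^ 2) * y)\<bar> \<le> D * y ^ 2"
proof -
  define c where "c = (\<lambda>n. pochhammer (real k) n * pochhammer (real k) n / (pochhammer 1 n * fact n))"
  have c0: "c n \<ge> 0" for n by (simp add: c_def pochhammer_nonneg)
  have cSuc: "c (Suc n) = ((real k + real n) / (real n + 1)) ^ 2 * c n" for n
    by (simp add: c_def pochhammer_Suc pochhammer_fact[symmetric] power2_eq_square divide_simps add.commute)
  \<comment> \<open>For \<open>n \<ge> 5 * k\<close> the ratio of consecutive coefficients is at
    most \<open>(6/5) ^ 2\<close>; multiplied by 1/2 this gives 18/25.\<close>
  have sum2: "summable (\<lambda>n. c n * (1/2) ^ n)"
  proof (rule summable_ratio_test[of "18/25" "5 * k"])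
    fix n assume n: "n \<ge> 5 * k"
    have "(real k + real n) / (real n + 1) \<le> 6/5" using n by (simp add: divide_simps)
    then have "((real k + real n) / (real n + 1)) ^ 2 \<le> (6/5) ^ 2" by (intro power_mono) auto
    then have "((real k + real n) / (real n + 1)) ^ 2 \<le> 36/25" by (simp add: power2_eq_square)
    then have "((real k + real n) / (real n + 1)) ^ 2 * (c n * (1/2) ^ n) \<le> 36/25 * (c n * (1/2) ^ n)"
      by (rule mult_right_mono) (simp add: c0)
    moreover have "norm (c (Suc n) * (1/2) ^ Suc n) = ((real k + real n) / (real n + 1)) ^ 2 * (c n * (1/2) ^ n) / 2"
      using c0 by (simp add: cSuc abs_mult)
    moreover have "norm (c n * (1/2) ^ n) = c n * (1/2) ^ n" using c0 by (simp add: abs_mult)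
    ultimately show "norm (c (Suc n) * (1/2) ^ Suc n) \<le> 18/25 * norm (c n * (1/2) ^ n)"
      by linarith
  qed simp
  define D where "D = (\<Sum>n. c (n + 2) * (1/2) ^ n)"
  have "summable (\<lambda>n. c (n + 2) * (1/2) ^ (n + 2))" using summable_ignore_initial_segment[OF sum2] .
  then have sumD: "summable (\<lambda>n. c (n + 2) * (1/2) ^ n)"
    using summable_mult[of "\<lambda>n. c (n + 2) * (1/2) ^ (n + 2)" 4] by (simp add: mult_ac)
  have "D \<ge> 0" unfolding D_def by (rule suminf_nonneg[OF sumD]) (simp add: c0)
  show ?thesis
  proof (intro exI[of _ D] conjI allI impI \<open>D \<ge> 0\<close>)
    fix y :: real assume y: "0 \<le> y" "y \<le> 1/2"
    have s: "summable (\<lambda>n. c n * y ^ n)"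
      by (rule summable_comparison_test'[OF sum2, of 0]) (use y c0 in \<open>auto intro!: mult_left_mono power_mono\<close>)
    have s2: "summable (\<lambda>n. c (n + 2) * y ^ n)"
      by (rule summable_comparison_test'[OF sumD, of 0]) (use y c0 in \<open>auto intro!: mult_left_mono power_mono\<close>)
    have hyp: "hyp2F1 (real k) (real k) 1 y = (\<Sum>n. c n * y ^ n)" by (simp add: hyp2F1_def c_def)
    also have "\<dots> = (\<Sum>n. c (n + 2) * y ^ (n + 2)) + (\<Sum>n<2. c n * y ^ n)"
      by (rule suminf_split_initial_segment[OF s])
    also have "(\<Sum>n<2. c n * y ^ n) = 1 + real (k ^ 2) * y"
      by (simp add: numeral_2_eq_2 c_def power2_eq_square)
    also have "(\<Sum>n. c (n + 2) * y ^ (n + 2)) = (\<Sum>n. c (n + 2) * y ^ n) * y ^ 2"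
      using suminf_mult2[OF s2, of "y ^ 2"] by (simp add: mult_ac power2_eq_square)
    finally have h: "hyp2F1 (real k) (real k) 1 y = (\<Sum>n. c (n + 2) * y ^ n) * y ^ 2 + (1 + real (k ^ 2) * y)" .
    have "(\<Sum>n. c (n + 2) * y ^ n) \<le> D" unfolding D_def
      by (rule suminf_le[OF _ s2 sumD]) (use y c0 in \<open>auto intro!: mult_left_mono power_mono\<close>)
    moreover have nn: "(\<Sum>n. c (n + 2) * y ^ n) \<ge> 0" by (rule suminf_nonneg[OF s2]) (use y c0 in auto)
    ultimately show "\<bar>hyp2F1 (real k) (real k) 1 y - (1 + real (k ^ 2) * y)\<bar> \<le> D * y ^ 2"
      unfolding h using y by (auto simp: abs_mult intro!: mult_right_mono)
    show "hyp2F1 (real k) (real k) 1 y \<ge> 1" unfolding h using nn y by simp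
  qed
qed

text \<open>\<open>b\<close> divides by \<open>a_const k\<close> and \<open>coeff_c\<close>
  multiplies by it; cancelling requires it to be nonzero. The terms linear in \<open>1 / p\<close>
  cancel, so the product converges absolutely, and no factor vanishes because the hypergeometric
  value is at least 1.\<close>

lemma a_const_nonzero:
  assumes "k \<ge> 1"
  shows "a_const k \<noteq> 0"
proof -
  define h where "h = hyp2F1 (real k) (real k) 1"
  define f where "f = (\<lambda>p. if prime p then (1 - 1 / real p) ^ (k ^ 2) * h (1 / real p) else 1)"
  obtain D where D: "D \<ge> 0" and h1: "\<And>y. 0 \<le> y \<Longrightarrow> y \<le> 1/2 \<Longrightarrow> h y \<ge> 1"
    and hD: "\<And>y. 0 \<le> y \<Longrightarrow> y \<le> 1/2 \<Longrightarrow> \<bar>h y - (1 + real (k ^ 2) * y)\<bar> \<le> D * y ^ 2"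
    using hyp2F1_expansion[OF assms] unfolding h_def by blast
  define m where "m = real (k ^ 2)"
  define C where "C = D + m ^ 2 * (1 + m) + m ^ 2"
  have "m \<ge> 0" "C \<ge> 0" using D by (auto simp: m_def C_def)
  have est: "\<bar>(1 - y) ^ (k ^ 2) * h y - 1\<bar> \<le> C * y ^ 2" if y: "0 \<le> y" "y \<le> 1/2" for y
  proof -
    define a where "a = (1 - y) ^ (k ^ 2)"
    have a: "0 \<le> a" "a \<le> 1" using y by (auto simp: a_def intro: power_le_one)
    have eq: "a * h y - 1 = a * (h y - (1 + m * y)) + ((a - (1 - m * y)) * (1 + m * y) + - (m ^ 2 * y ^ 2))"
      by (simp add: algebra_simps power2_eq_square)
    have t1: "\<bar>a * (h y - (1 + m * y))\<bar> \<le> 1 * (D * y ^ 2)"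
      unfolding abs_mult using a hD[OF y] by (intro mult_mono) (auto simp: m_def)
    have t2: "\<bar>(a - (1 - m * y)) * (1 + m * y)\<bar> \<le> (m ^ 2 * y ^ 2) * (1 + m)"
      unfolding abs_mult
    proof (rule mult_mono)
      show "\<bar>a - (1 - m * y)\<bar> \<le> m ^ 2 * y ^ 2"
        using power_one_minus_expansion[of y "k ^ 2"] y by (simp add: a_def m_def)
      show "\<bar>1 + m * y\<bar> \<le> 1 + m" using y \<open>m \<ge> 0\<close> mult_left_mono[of y 1 m] by (simp add: abs_of_nonneg)
    qed auto
    have t3: "\<bar>- (m ^ 2 * y ^ 2)\<bar> \<le> m ^ 2 * y ^ 2" by (simp add: abs_mult)
    have "\<bar>a * h y - 1\<bar> \<le> 1 * (D * y ^ 2) + ((m ^ 2 * y ^ 2) * (1 + m) + m ^ 2 * y ^ 2)"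
      unfolding eq using t1 t2 t3 by linarith
    also have "\<dots> = C * y ^ 2" by (simp add: C_def algebra_simps)
    finally show ?thesis by (simp add: a_def)
  qed
  have pr: "0 \<le> 1 / real p" "1 / real p \<le> 1/2" if "prime p" for p
    using prime_ge_2_nat[OF that] by (auto simp: divide_simps)
  have "summable (\<lambda>p. norm (f p - 1))"
  proof (rule summable_comparison_test'[of "\<lambda>p. C * (1 / real p ^ 2)" 0])
    show "summable (\<lambda>p. C * (1 / real p ^ 2))"
      using inverse_power_summable[of 2, where ?'a = real] by (intro summable_mult) (simp add: field_simps)
    fix p :: nat
    show "norm (norm (f p - 1)) \<le> C * (1 / real p ^ 2)"
      using est[OF pr, of p] \<open>C \<ge> 0\<close> by (auto simp: f_def power_divide)
  qed
  then have conv: "convergent_prod f"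
    by (intro abs_convergent_prod_imp_convergent_prod summable_imp_abs_convergent_prod)
  have "f p \<noteq> 0" for p
  proof (cases "prime p")
    case True
    then show ?thesis using h1[OF pr[OF True]] prime_ge_2_nat[OF True] by (auto simp: f_def)
  qed (simp add: f_def)
  then have "prodinf f \<noteq> 0" by (rule prodinf_nonzero[OF conv])
  then show ?thesis unfolding a_const_def f_def h_def .
qed

section \<open>Alternants and Vandermonde determinants\<close>

text \<open>The Leibniz formula for the determinant with entries \<open>z i ^ w j\<close>, indexed
  by an arbitrary set \<open>I\<close> so that each half of the variables can be treated in
  place.\<close>

definition alternant :: "nat set \<Rightarrow> (nat \<Rightarrow> nat) \<Rightarrow> (nat \<Rightarrow> complex) \<Rightarrow> complex" where
  "alternant I w z = (\<Sum>p | p permutes I. of_int (sign p) * (\<Prod>i\<in>I. z i ^ w (p i)))"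

lemma alternant_permute:
  assumes "finite I" and q: "q permutes I"
  shows "alternant I w (\<lambda>i. z (q i)) = of_int (sign q) * alternant I w z"
proof -
  have "alternant I w (\<lambda>i. z (q i)) =
    (\<Sum>p | p permutes I. of_int (sign (p \<circ> q)) * (\<Prod>i\<in>I. z (q i) ^ w ((p \<circ> q) i)))"
    unfolding alternant_def by (rule sum_permutations_compose_right[OF q])
  also have "\<dots> = (\<Sum>p | p permutes I. of_int (sign q) * (of_int (sign p) * (\<Prod>i\<in>I. z i ^ w (p i))))"
  proof (rule sum.cong)
    fix p assume "p \<in> {p. p permutes I}"
    then have "sign (p \<circ> q) = sign p * sign q"
      using q \<open>finite I\<close> by (intro sign_compose) (auto simp: permutation_permutes)
    moreover have "(\<Prod>i\<in>I. z (q i) ^ w (p (q i))) = (\<Prod>i\<in>I. z i ^ w (p i))"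
      using prod.permute[OF q, of "\<lambda>i. z i ^ w (p i)"] by (simp add: o_def)
    ultimately show "of_int (sign (p \<circ> q)) * (\<Prod>i\<in>I. z (q i) ^ w ((p \<circ> q) i)) =
        of_int (sign q) * (of_int (sign p) * (\<Prod>i\<in>I. z i ^ w (p i)))"
      by simp
  qed simp
  also have "\<dots> = of_int (sign q) * alternant I w z"
    by (simp add: alternant_def sum_distrib_left)
  finally show ?thesis .
qed

lemma alternant_eq_0:
  assumes "finite I" "i \<in> I" "j \<in> I" "i \<noteq> j" "z i = z j"
  shows "alternant I w z = 0"
proof -
  have "Transposition.transpose i j permutes I" using assms by (intro permutes_swap_id)
  from alternant_permute[OF assms(1) this, of w z]
  have "alternant I w (\<lambda>l. z (Transposition.transpose i j l)) = - alternant I w z"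
    using assms by (simp add: sign_swap_id)
  moreover have "(\<lambda>l. z (Transposition.transpose i j l)) = z"
    using assms by (auto simp: fun_eq_iff Transposition.transpose_def)
  ultimately show ?thesis by simp
qed

text \<open>Induction on the number of variables: in the last variable the alternant is a polynomial
  of degree at most \<open>m\<close> that vanishes at the other \<open>z i\<close> and has the
  smaller alternant as coefficient of degree \<open>m\<close>. The offset \<open>c\<close> serves
  both halves.\<close>

lemma vandermonde_alternant:
  "(\<Prod>j\<in>{Suc c..c + m}. \<Prod>i\<in>{Suc c..<j}. z j - z i) = alternant {Suc c..c + m} (\<lambda>i. i - Suc c) z"
proof (induction m)
  case 0
  show ?case by (simp add: alternant_def)
next
  case (Suc m)
  define w where "w = (\<lambda>i. i - Suc c)"
  define l where "l = Suc (c + m)"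
  define I where "I = {Suc c..c + m}"
  have I': "{Suc c..c + Suc m} = insert l I" "{Suc c..<l} = I" by (auto simp: I_def l_def)
  have I: "finite I" "l \<notin> I" "card I = m" by (auto simp: I_def l_def)
  have IH: "(\<Prod>j\<in>I. \<Prod>i\<in>{Suc c..<j}. z j - z i) = alternant I w z"
    using Suc by (simp add: I_def w_def)
  \<comment> \<open>Distinct values give \<open>m\<close> roots, which together with the coefficient
    of degree \<open>m\<close> determine the polynomial; for a repeated value both sides
    vanish.\<close>
  have "alternant (insert l I) w z = alternant I w z * (\<Prod>i\<in>I. z l - z i)"
  proof (cases "inj_on z I")
    case True
    define Q where "Q = (\<Sum>p | p permutes insert l I. monom (of_int (sign p) * (\<Prod>i\<in>I. z i ^ w (p i))) (w (p l)))"
    define L where "L = (\<Prod>i\<in>I. [:- z i, 1:])"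
    have "poly Q x = (\<Sum>p | p permutes insert l I. of_int (sign p) * (\<Prod>i\<in>insert l I. (z(l := x)) i ^ w (p i)))" for x
    proof -
      have *: "(\<Prod>i\<in>I. (z(l := x)) i ^ w (p i)) = (\<Prod>i\<in>I. z i ^ w (p i))" for p
        by (rule prod.cong) (use I in auto)
      show ?thesis unfolding prod.insert[OF I(1,2)] *
        by (simp add: Q_def poly_sum poly_monom mult_ac)
    qed
    then have polyQ: "poly Q x = alternant (insert l I) w (z(l := x))" for x
      unfolding alternant_def .
    have wl: "w (p l) \<le> m" if "p permutes insert l I" for p
      using permutes_in_image[OF that, of l] by (auto simp: w_def I_def l_def)
    have degQ: "degree Q \<le> m" unfolding Q_def
    proof (rule degree_sum_le)
      fix p assume "p \<in> {p. p permutes insert l I}"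
      then show "degree (monom (of_int (sign p) * (\<Prod>i\<in>I. z i ^ w (p i))) (w (p l))) \<le> m"
        using degree_monom_le wl order_trans by blast
    qed (simp add: finite_permutations I(1))
    \<comment> \<open>The exponent \<open>m\<close> belongs to the index \<open>l\<close> alone, so
      the top power of the last variable comes exactly from the permutations fixing
      \<open>l\<close>.\<close>
    have fix_l: "{p. p permutes insert l I \<and> w (p l) = m} = {p. p permutes I}"
    proof (intro equalityI subsetI CollectI)
      fix p assume "p \<in> {p. p permutes insert l I \<and> w (p l) = m}"
      then have p: "p permutes insert l I" "w (p l) = m" by auto
      have "p l \<in> insert l I" using permutes_in_image[OF p(1), of l] by simp
      moreover have "w i < m" if "i \<in> I" for i using that by (auto simp: w_def I_def)
      ultimately have "p l = l" using p(2) by auto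
      then show "p permutes I" by (intro permutes_superset[OF p(1)]) auto
    next
      fix p assume "p \<in> {p. p permutes I}"
      then have p: "p permutes I" by simp
      have "p permutes insert l I" by (rule permutes_subset[OF p]) auto
      moreover have "w (p l) = m" using permutes_not_in[OF p I(2)] by (simp add: w_def l_def)
      ultimately show "p permutes insert l I \<and> w (p l) = m" ..
    qed
    have "coeff Q m = (\<Sum>p | p permutes insert l I. if w (p l) = m then of_int (sign p) * (\<Prod>i\<in>I. z i ^ w (p i)) else 0)"
      by (simp add: Q_def coeff_sum coeff_monom)
    also have "\<dots> = (\<Sum>p | p permutes insert l I \<and> w (p l) = m. of_int (sign p) * (\<Prod>i\<in>I. z i ^ w (p i)))"
      using I(1) by (subst sum.inter_filter[symmetric]) (auto intro: finite_permutations)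
    also have "\<dots> = alternant I w z" unfolding fix_l alternant_def ..
    finally have coeffQ: "coeff Q m = alternant I w z" .
    have degL: "degree L = m"
      unfolding L_def using I(3) by (subst degree_prod_eq_sum_degree) auto
    have "lead_coeff L = 1" unfolding L_def by (simp add: lead_coeff_prod)
    then have coeffL: "coeff (smult (alternant I w z) L) m = alternant I w z" using degL by simp
    have degL': "degree (smult (alternant I w z) L) \<le> m" using degL degree_smult_le[of "alternant I w z" L] by simp
    have "Q = smult (alternant I w z) L"
    proof (rule poly_eqI_degree_lead_coeff[of Q m _ "z ` I"])
      fix x assume "x \<in> z ` I"
      then obtain i where i: "i \<in> I" "x = z i" by blast
      then have "alternant (insert l I) w (z(l := x)) = 0"
        using I by (intro alternant_eq_0[of _ i l]) auto
      moreover have "poly L x = 0" using i I(1) by (auto simp: L_def poly_prod prod_zero_iff)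
      ultimately show "poly Q x = poly (smult (alternant I w z) L) x" by (simp add: polyQ)
    qed (use coeffQ coeffL degQ degL' card_image[OF True] I(3) in auto)
    then have "poly Q (z l) = alternant I w z * (\<Prod>i\<in>I. z l - z i)" by (simp add: L_def poly_prod)
    then show ?thesis by (simp add: polyQ)
  next
    case False
    then obtain i j where ij: "i \<in> I" "j \<in> I" "i \<noteq> j" "z i = z j" by (auto simp: inj_on_def)
    then show ?thesis
      using alternant_eq_0[of I i j z w] alternant_eq_0[of "insert l I" i j z w] I(1) by auto
  qed
  then show ?case
    unfolding I' prod.insert[OF I(1,2)] IH w_def[symmetric] by (simp add: I'(2) mult.commute)
qed

lemma Vandermonde_alternant: "Vandermonde m z = alternant {1..m} (\<lambda>i. i - 1) z"
  using vandermonde_alternant[where c = 0 and m = m and z = z] by (simp add: Vandermonde_def)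

lemma Vandermonde_split:
  "Vandermonde (2 * k) z =
     alternant {1..k} (\<lambda>i. i - 1) z * alternant {Suc k..2 * k} (\<lambda>i. i - Suc k) z *
     (\<Prod>i\<in>{1..k}. \<Prod>j\<in>{1..k}. z (j + k) - z i)"
proof -
  have split: "{1..2 * k} = {1..k} \<union> {Suc k..2 * k}" by auto
  have "Vandermonde (2 * k) z = (\<Prod>j\<in>{1..k}. \<Prod>i\<in>{1..<j}. z j - z i) * (\<Prod>j\<in>{Suc k..2 * k}. \<Prod>i\<in>{1..<j}. z j - z i)"
    unfolding Vandermonde_def split by (rule prod.union_disjoint) auto
  also have "(\<Prod>j\<in>{Suc k..2 * k}. \<Prod>i\<in>{1..<j}. z j - z i) =
     (\<Prod>j\<in>{Suc k..2 * k}. (\<Prod>i\<in>{1..k}. z j - z i) * (\<Prod>i\<in>{Suc k..<j}. z j - z i))"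
  proof (rule prod.cong)
    fix j assume "j \<in> {Suc k..2 * k}"
    then have "{1..<j} = {1..k} \<union> {Suc k..<j}" by auto
    then show "(\<Prod>i\<in>{1..<j}. z j - z i) = (\<Prod>i\<in>{1..k}. z j - z i) * (\<Prod>i\<in>{Suc k..<j}. z j - z i)"
      by (simp only:) (rule prod.union_disjoint, auto)
  qed simp
  also have "\<dots> = (\<Prod>j\<in>{Suc k..2 * k}. \<Prod>i\<in>{1..k}. z j - z i) * (\<Prod>j\<in>{Suc k..2 * k}. \<Prod>i\<in>{Suc k..<j}. z j - z i)"
    by (rule prod.distrib)
  also have "(\<Prod>j\<in>{Suc k..2 * k}. \<Prod>i\<in>{1..k}. z j - z i) = (\<Prod>j\<in>{1..k}. \<Prod>i\<in>{1..k}. z (j + k) - z i)"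
    by (rule prod.reindex_bij_witness[of _ "\<lambda>j. j + k" "\<lambda>j. j - k"]) auto
  also have "\<dots> = (\<Prod>i\<in>{1..k}. \<Prod>j\<in>{1..k}. z (j + k) - z i)" by (rule prod.swap)
  also have "(\<Prod>j\<in>{1..k}. \<Prod>i\<in>{1..<j}. z j - z i) = alternant {1..k} (\<lambda>i. i - 1) z"
    using vandermonde_alternant[where c = 0 and m = k and z = z] by simp
  also have "(\<Prod>j\<in>{Suc k..2 * k}. \<Prod>i\<in>{Suc k..<j}. z j - z i) = alternant {Suc k..2 * k} (\<lambda>i. i - Suc k) z"
    using vandermonde_alternant[where c = k and m = k and z = z] by (simp add: mult_2)
  finally show ?thesis by (simp add: mult_ac)
qed

lemma polydisc_alg_monomial:
  "I \<subseteq> {1..n} \<Longrightarrow> (\<lambda>z. \<Prod>i\<in>I. z i ^ w i) \<in> polydisc_alg \<rho> n"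
  by (intro pd.unif_closure_prod pd.unif_closure_power polydisc_alg_coord) auto

lemma polydisc_alg_alternant:
  "I \<subseteq> {1..n} \<Longrightarrow> alternant I w \<in> polydisc_alg \<rho> n"
  unfolding alternant_def[abs_def]
  by (intro pd.unif_closure_sum pd.unif_closure_cmult polydisc_alg_monomial)

text \<open>Against an antisymmetric function and symmetric exponents, all terms of an alternant
  contribute equally.\<close>
lemma tcoeff_antisymmetric:
  assumes f: "f \<in> polydisc_alg \<rho> n" and r: "0 < r" "r \<le> \<rho>" and I: "I \<subseteq> {1..n}"
    and anti: "\<And>q z. q permutes I \<Longrightarrow> f (\<lambda>i. z (q i)) = of_int (sign q) * f z"
  shows "tcoeff r n (\<lambda>z. f z * alternant I w z) (\<lambda>_. M) =
    fact (card I) * tcoeff r n (\<lambda>z. f z * (\<Prod>i\<in>I. z i ^ w i)) (\<lambda>_. M)"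
proof -
  define g where "g = (\<lambda>z. f z * (\<Prod>i\<in>I. z i ^ w i))"
  have finI: "finite I" using I by (rule finite_subset) simp
  have g: "g \<in> polydisc_alg \<rho> n" unfolding g_def by (intro pd.unif_closure_mult f polydisc_alg_monomial I)
  \<comment> \<open>Relabelling the variables in the single product \<open>g\<close> yields the term
    of \<open>p\<close> in the alternant; the sign is supplied by the antisymmetry of
    \<open>f\<close>.\<close>
  have g_perm: "g (\<lambda>i. z (inv p i)) = f z * (of_int (sign p) * (\<Prod>i\<in>I. z i ^ w (p i)))" if p: "p permutes I" for p z
  proof -
    have "(\<Prod>i\<in>I. z (inv p i) ^ w i) = (\<Prod>i\<in>I. z (inv p i) ^ w (p (inv p i)))"
      by (simp add: permutes_inverses[OF p])
    also have "\<dots> = (\<Prod>i\<in>I. z i ^ w (p i))"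
      using prod.permute[OF permutes_inv[OF p], of "\<lambda>i. z i ^ w (p i)"] by (simp add: o_def)
    finally have eq: "(\<Prod>i\<in>I. z (inv p i) ^ w i) = (\<Prod>i\<in>I. z i ^ w (p i))" .
    have "permutation p" using p finI by (auto simp: permutation_permutes)
    then show ?thesis using anti[OF permutes_inv[OF p], of z]
      by (simp add: g_def eq sign_inverse)
  qed
  have perm_n: "inv p permutes {1..n}" if "p permutes I" for p
    by (rule permutes_subset[OF permutes_inv[OF that] I])
  have gp: "(\<lambda>z. g (\<lambda>i. z (inv p i))) \<in> polydisc_alg \<rho> n" if "p permutes I" for p
    unfolding g_perm[OF that] by (intro pd.unif_closure_mult f unif_closure_const polydisc_alg_monomial I)
  have twist: "tcoeff r n (\<lambda>z. g (\<lambda>i. z (inv p i))) (\<lambda>_. M) = tcoeff r n g (\<lambda>_. M)" if "p permutes I" for p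
    using tcoeff_twist[OF g r perm_n[OF that], of 1 "\<lambda>_. M"] by simp
  note D = bounded_functionalD[OF bounded_functional_tcoeff[OF r, where n = n and a = "\<lambda>_. M"]]
  have sum: "tcoeff r n (\<lambda>z. \<Sum>p\<in>X. g (\<lambda>i. z (inv p i))) (\<lambda>_. M) = of_nat (card X) * tcoeff r n g (\<lambda>_. M)"
    if "finite X" "\<And>p. p \<in> X \<Longrightarrow> p permutes I" for X
    using that
  proof (induction X rule: finite_induct)
    case empty
    show ?case using D(1)[OF unif_closure_const, of 0 0] by simp
  next
    case (insert p X)
    have "(\<lambda>z. \<Sum>p\<in>X. g (\<lambda>i. z (inv p i))) \<in> polydisc_alg \<rho> n"
      using insert.prems by (intro pd.unif_closure_sum gp) auto
    from D(2)[OF gp this, of p] show ?case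
      using insert by (simp add: twist distrib_right)
  qed
  have eq: "(\<lambda>z. f z * alternant I w z) = (\<lambda>z. \<Sum>p | p permutes I. g (\<lambda>i. z (inv p i)))"
    by (simp add: alternant_def sum_distrib_left g_perm)
  have "tcoeff r n (\<lambda>z. f z * alternant I w z) (\<lambda>_. M) = of_nat (card {p. p permutes I}) * tcoeff r n g (\<lambda>_. M)"
    unfolding eq by (rule sum) (simp_all add: finite_permutations[OF finI])
  then show ?thesis unfolding card_permutations[OF refl finI] g_def of_nat_fact .
qed

section \<open>Rearrangements and the symmetry of the determinants\<close>

lemma det_n_cong:
  assumes "\<And>i j. i < n \<Longrightarrow> j < n \<Longrightarrow> m i j = m' i j"
  shows "det_n n m = det_n n m'"
proof -
  have "(\<Prod>i<n. m i (p i)) = (\<Prod>i<n. m' i (p i))" if "p permutes {0..<n}" for p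
    using permutes_in_image[OF that] by (intro prod.cong) (auto intro!: assms)
  then show ?thesis unfolding det_n_def by (intro sum.cong) auto
qed

lemma det_n_scale_permute:
  assumes s: "s permutes {0..<n}"
  shows "det_n n (\<lambda>i j. c i * d j * m (s i) j) = (\<Prod>i<n. c i) * (\<Prod>j<n. d j) * of_int (sign s) * det_n n m"
proof -
  have "det_n n (\<lambda>i j. c i * d j * m (s i) j) =
     (\<Sum>p | p permutes {0..<n}. of_int (sign (p \<circ> s)) * (\<Prod>i<n. c i * d ((p \<circ> s) i) * m (s i) ((p \<circ> s) i)))"
    unfolding det_n_def by (rule sum_permutations_compose_right[OF s])
  also have "\<dots> = (\<Sum>p | p permutes {0..<n}. (\<Prod>i<n. c i) * (\<Prod>j<n. d j) * of_int (sign s) *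
      (of_int (sign p) * (\<Prod>i<n. m i (p i))))"
  proof (rule sum.cong)
    fix p assume "p \<in> {p. p permutes {0..<n}}"
    then have p: "p permutes {0..<n}" by simp
    have "sign (p \<circ> s) = sign p * sign s"
      using s p by (intro sign_compose) (auto simp: permutation_permutes)
    moreover have "(\<Prod>i<n. d ((p \<circ> s) i)) = (\<Prod>j<n. d j)"
      using prod.permute[OF permutes_compose[OF s p], of d] by (simp add: o_def lessThan_atLeast0)
    moreover have "(\<Prod>i<n. m (s i) ((p \<circ> s) i)) = (\<Prod>i<n. m i (p i))"
      using prod.permute[OF s, of "\<lambda>i. m i (p i)"] by (simp add: o_def lessThan_atLeast0)
    ultimately show "of_int (sign (p \<circ> s)) * (\<Prod>i<n. c i * d ((p \<circ> s) i) * m (s i) ((p \<circ> s) i)) =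
       (\<Prod>i<n. c i) * (\<Prod>j<n. d j) * of_int (sign s) * (of_int (sign p) * (\<Prod>i<n. m i (p i)))"
      by (simp add: prod.distrib)
  qed simp
  also have "\<dots> = (\<Prod>i<n. c i) * (\<Prod>j<n. d j) * of_int (sign s) * det_n n m"
    by (simp add: det_n_def sum_distrib_left)
  finally show ?thesis .
qed

definition block_swap :: "nat \<Rightarrow> nat \<Rightarrow> nat" where
  "block_swap k i = (if i < k then i + k else if i < 2 * k then i - k else i)"

lemma block_swap_permutes: "block_swap k permutes {0..<2 * k}"
  by (rule inj_imp_permutes) (auto simp: block_swap_def inj_on_def split: if_splits)

lemma sign_block_swap: "sign (block_swap k) = (-1) ^ k"
proof -
  \<comment> \<open>The exchange as a product of \<open>k\<close> disjoint transpositions;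
    \<open>s m\<close> collects the first \<open>m\<close> of them.\<close>
  define s where "s = (\<lambda>m i. if i < m then i + k else if k \<le> i \<and> i < k + m then i - k else i)"
  have "permutation (s m) \<and> sign (s m) = (-1) ^ m" if "m \<le> k" for m
    using that
  proof (induction m)
    case 0
    have "s 0 = id" by (auto simp: s_def fun_eq_iff)
    then show ?case by simp
  next
    case (Suc m)
    have eq: "s (Suc m) = Transposition.transpose m (m + k) \<circ> s m"
      using Suc.prems by (auto simp: s_def fun_eq_iff Transposition.transpose_def)
    have "m \<noteq> m + k" using Suc.prems by simp
    then have sT: "sign (Transposition.transpose m (m + k)) = -1" by (simp add: sign_swap_id)
    have s: "permutation (s m)" "sign (s m) = (-1) ^ m" using Suc by auto
    show ?case unfolding eq
    proof
      show "permutation (Transposition.transpose m (m + k) \<circ> s m)"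
        by (rule permutation_compose[OF permutation_swap_id s(1)])
      show "sign (Transposition.transpose m (m + k) \<circ> s m) = (-1) ^ Suc m"
        unfolding sign_compose[OF permutation_swap_id s(1)] sT s(2) by simp
    qed
  qed
  moreover have "s k = block_swap k" by (auto simp: s_def block_swap_def fun_eq_iff)
  ultimately show ?thesis by (metis order_refl)
qed

text \<open>Exchanging the row blocks and changing signs of rows and columns turns one matrix into
  the other. Each row sign occurs in both blocks and cancels; the column signs multiply to
  \<open>(-1) ^ k\<close>, which is also the sign of the exchange. Only the prefactors of
  \<open>Mt\<close> are left.\<close>

lemma Mt_swap: "Mt k c a = (-1) ^ (sum_list a + sum_list c) * Mt k a c"
proof -
  define m where "m = (\<lambda>i j. if i < k then rGamma (of_int (2 * int k - int i - int j - int (a ! i)))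
     else (-1) ^ ((i - k) + j + 1) * rGamma (of_int (2 * int k - int (i - k) - int j - int (c ! (i - k)))) :: real)"
  define r where "r = (\<lambda>i. (-1) ^ ((if i < k then i else i - k) + 1) :: real)"
  have "det_n (2 * k) (\<lambda>i j.
     if i < k then rGamma (of_int (2 * int k - int i - int j - int (c ! i)))
     else (-1) ^ ((i - k) + j + 1) * rGamma (of_int (2 * int k - int (i - k) - int j - int (a ! (i - k)))) :: real)
     = det_n (2 * k) (\<lambda>i j. r i * (-1) ^ j * m (block_swap k i) j)"
  proof (rule det_n_cong)
    fix i j assume "i < 2 * k" "j < 2 * k"
    have "((-1::real) ^ l) * (-1) ^ l = 1" for l by (simp flip: power_mult_distrib)
    then have sq: "((-1::real) ^ l) * ((-1) ^ l * u) = u" for l u by (metis mult.assoc mult_1)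
    show "(if i < k then rGamma (of_int (2 * int k - int i - int j - int (c ! i)))
     else (-1) ^ ((i - k) + j + 1) * rGamma (of_int (2 * int k - int (i - k) - int j - int (a ! (i - k))))) =
      r i * (-1) ^ j * m (block_swap k i) j"
    proof (cases "i < k")
      case True
      have "r i * (-1) ^ j = (-1) ^ (i + j + 1)" using True by (simp add: r_def power_add)
      then show ?thesis using True sq by (simp only: m_def) (simp add: block_swap_def)
    next
      case False
      have "r i * (-1) ^ j = (-1) ^ ((i - k) + j + 1)" using False unfolding r_def power_add by simp
      moreover have "i - k < k" using False \<open>i < 2 * k\<close> by simp
      ultimately show ?thesis using False \<open>i < 2 * k\<close> by (simp only: m_def) (simp add: block_swap_def)
    qed
  qed
  also have "\<dots> = (\<Prod>i<2 * k. r i) * (\<Prod>j<2 * k. (-1) ^ j) * of_int (sign (block_swap k)) * det_n (2 * k) m"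
    by (rule det_n_scale_permute[OF block_swap_permutes])
  also have "(\<Prod>i<2 * k. r i) = 1"
  proof -
    have split: "{..<2 * k} = {..<k} \<union> {k..<2 * k}" by auto
    have "(\<Prod>i<2 * k. r i) = (\<Prod>i<k. r i) * (\<Prod>i\<in>{k..<2 * k}. r i)"
      unfolding split by (rule prod.union_disjoint) auto
    also have "(\<Prod>i\<in>{k..<2 * k}. r i) = (\<Prod>i<k. r i)"
      by (rule prod.reindex_bij_witness[of _ "\<lambda>i. i + k" "\<lambda>i. i - k"]) (auto simp: r_def)
    also have "(\<Prod>i<k. r i) * (\<Prod>i<k. r i) = (\<Prod>i<k. r i * r i)" by (simp add: prod.distrib)
    also have "\<dots> = 1" by (rule prod.neutral) (simp add: r_def flip: power_mult_distrib)
    finally show ?thesis .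
  qed
  also have "(\<Prod>j<2 * k. (-1) ^ j) = (-1 :: real) ^ k"
  proof (induction k)
    case (Suc k)
    have "(\<Prod>j<2 * Suc k. (-1) ^ j) = (\<Prod>j<2 * k. (-1) ^ j) * (-1 :: real) ^ (2 * k) * (-1) ^ (2 * k + 1)" by simp
    then show ?case using Suc by simp
  qed simp
  also have "1 * (-1) ^ k * real_of_int (sign (block_swap k)) = 1"
    by (simp add: sign_block_swap flip: power_mult_distrib)
  finally have "Mt k c a = (-1) ^ sum_list a * det_n (2 * k) m"
    by (simp add: Mt_def)
  moreover have "Mt k a c = (-1) ^ sum_list c * det_n (2 * k) m"
    unfolding Mt_def m_def ..
  ultimately show ?thesis by (simp add: power_add flip: mult.assoc power_mult_distrib)
qed

abbreviation rearrangements :: "nat list \<Rightarrow> nat list set" where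
  "rearrangements xs \<equiv> permutations_of_multiset (mset xs)"

lemma sum_list_mset_eq: "mset xs = mset ys \<Longrightarrow> sum_list xs = sum_list (ys :: nat list)"
  by (metis sum_mset_sum_list)

lemma N_swap: "N k \<beta> \<alpha> = (-1) ^ (sum_list \<alpha> + sum_list \<beta>) * N k \<alpha> \<beta>"
proof -
  have "(\<Sum>\<sigma>\<in>rearrangements \<beta>. \<Sum>\<tau>\<in>rearrangements \<alpha>. Mt k \<sigma> \<tau>) =
    (\<Sum>\<tau>\<in>rearrangements \<alpha>. \<Sum>\<sigma>\<in>rearrangements \<beta>. Mt k \<sigma> \<tau>)"
    by (rule sum.swap)
  also have "\<dots> = (\<Sum>\<tau>\<in>rearrangements \<alpha>. \<Sum>\<sigma>\<in>rearrangements \<beta>.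
     (-1) ^ (sum_list \<alpha> + sum_list \<beta>) * Mt k \<tau> \<sigma>)"
  proof (intro sum.cong refl)
    fix \<tau> \<sigma> assume "\<tau> \<in> rearrangements \<alpha>" "\<sigma> \<in> rearrangements \<beta>"
    then have "sum_list \<tau> = sum_list \<alpha>" "sum_list \<sigma> = sum_list \<beta>"
      by (auto simp: permutations_of_multiset_def intro: sum_list_mset_eq)
    then show "Mt k \<sigma> \<tau> = (-1) ^ (sum_list \<alpha> + sum_list \<beta>) * Mt k \<tau> \<sigma>"
      using Mt_swap[of k \<sigma> \<tau>] by simp
  qed
  also have "\<dots> = (-1) ^ (sum_list \<alpha> + sum_list \<beta>) *
     (\<Sum>\<tau>\<in>rearrangements \<alpha>. \<Sum>\<sigma>\<in>rearrangements \<beta>. Mt k \<tau> \<sigma>)"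
    by (simp add: sum_distrib_left)
  finally show ?thesis by (simp add: N_def add.commute)
qed

section \<open>From tuples to lexicographically ordered partitions\<close>

definition tuple_pairs :: "nat \<Rightarrow> nat \<Rightarrow> (nat list \<times> nat list) set" where
  "tuple_pairs k r = {(a, c). length a = k \<and> length c = k \<and> sum_list a + sum_list c = r}"

definition partition_pairs :: "nat \<Rightarrow> nat \<Rightarrow> (nat list \<times> nat list) set" where
  "partition_pairs k r = {(\<alpha>, \<beta>). is_partition_k k \<alpha> \<and> is_partition_k k \<beta> \<and> sum_list \<alpha> + sum_list \<beta> = r}"

lemma finite_tuple_pairs: "finite (tuple_pairs k r)"
proof (rule finite_subset)
  let ?L = "{xs. set xs \<subseteq> {..r} \<and> length xs = k}"
  show "tuple_pairs k r \<subseteq> ?L \<times> ?L"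
    unfolding tuple_pairs_def by (auto dest: member_le_sum_list)
  show "finite (?L \<times> ?L)" by (intro finite_cartesian_product finite_lists_length_eq) auto
qed

lemma partition_pairs_subset: "partition_pairs k r \<subseteq> tuple_pairs k r"
  by (auto simp: partition_pairs_def tuple_pairs_def is_partition_k_def)

lemma sort_desc_eq_iff:
  assumes "is_partition_k k \<alpha>"
  shows "rev (sort xs) = \<alpha> \<longleftrightarrow> mset xs = mset \<alpha>"
proof
  assume "rev (sort xs) = \<alpha>"
  then have "mset (rev (sort xs)) = mset \<alpha>" by simp
  then show "mset xs = mset \<alpha>" by simp
next
  assume "mset xs = mset \<alpha>"
  moreover have "sorted (rev \<alpha>)" using assms by (simp add: is_partition_k_def sorted_wrt_rev)
  ultimately have "sort xs = rev \<alpha>" by (intro properties_for_sort) simp_all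
  then show "rev (sort xs) = \<alpha>" by simp
qed

text \<open>Tuples are grouped by their decreasing sorting; the fibre over a partition consists of
  its distinct rearrangements.\<close>

lemma sum_tuple_pairs:
  fixes f :: "nat list \<Rightarrow> nat list \<Rightarrow> 'a::comm_monoid_add"
  shows "(\<Sum>(a, c)\<in>tuple_pairs k r. f a c) =
    (\<Sum>(\<alpha>, \<beta>)\<in>partition_pairs k r. \<Sum>\<sigma>\<in>rearrangements \<alpha>. \<Sum>\<tau>\<in>rearrangements \<beta>. f \<sigma> \<tau>)"
proof -
  define g where "g = (\<lambda>(a, c). (rev (sort a), rev (sort c :: nat list)) :: nat list \<times> nat list)"
  have "(\<Sum>(a, c)\<in>tuple_pairs k r. f a c) =
    (\<Sum>y\<in>partition_pairs k r. \<Sum>x\<in>{x \<in> tuple_pairs k r. g x = y}. case x of (a, c) \<Rightarrow> f a c)"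
  proof (rule sum.group[symmetric])
    show "finite (partition_pairs k r)" by (rule finite_subset[OF partition_pairs_subset finite_tuple_pairs])
    show "g ` tuple_pairs k r \<subseteq> partition_pairs k r"
      by (auto simp: g_def tuple_pairs_def partition_pairs_def is_partition_k_def sorted_wrt_rev
          intro!: arg_cong2[of _ _ _ _ "(+)"] sum_list_mset_eq)
  qed (rule finite_tuple_pairs)
  also have "\<dots> = (\<Sum>(\<alpha>, \<beta>)\<in>partition_pairs k r. \<Sum>\<sigma>\<in>rearrangements \<alpha>. \<Sum>\<tau>\<in>rearrangements \<beta>. f \<sigma> \<tau>)"
  proof (rule sum.cong)
    fix y assume y: "y \<in> partition_pairs k r"
    obtain \<alpha> \<beta> where [simp]: "y = (\<alpha>, \<beta>)" by (cases y)
    have part: "is_partition_k k \<alpha>" "is_partition_k k \<beta>" "sum_list \<alpha> + sum_list \<beta> = r"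
      using y by (auto simp: partition_pairs_def)
    have "{x \<in> tuple_pairs k r. g x = y} = rearrangements \<alpha> \<times> rearrangements \<beta>"
    proof (intro equalityI subsetI)
      fix x assume "x \<in> {x \<in> tuple_pairs k r. g x = y}"
      then show "x \<in> rearrangements \<alpha> \<times> rearrangements \<beta>"
        using part by (auto simp: g_def sort_desc_eq_iff permutations_of_multiset_def split: prod.splits)
    next
      fix x assume "x \<in> rearrangements \<alpha> \<times> rearrangements \<beta>"
      then obtain a c where x: "x = (a, c)" "mset a = mset \<alpha>" "mset c = mset \<beta>"
        by (auto simp: permutations_of_multiset_def)
      moreover have "length a = k" "length c = k" "sum_list a + sum_list c = r"
        using part mset_eq_length[OF x(2)] mset_eq_length[OF x(3)] sum_list_mset_eq[OF x(2)] sum_list_mset_eq[OF x(3)]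
        by (auto simp: is_partition_k_def)
      ultimately show "x \<in> {x \<in> tuple_pairs k r. g x = y}"
        using part by (simp add: g_def sort_desc_eq_iff tuple_pairs_def)
    qed
    then show "(\<Sum>x\<in>{x \<in> tuple_pairs k r. g x = y}. case x of (a, c) \<Rightarrow> f a c) =
      (case y of (\<alpha>, \<beta>) \<Rightarrow> \<Sum>\<sigma>\<in>rearrangements \<alpha>. \<Sum>\<tau>\<in>rearrangements \<beta>. f \<sigma> \<tau>)"
      by (simp add: sum.cartesian_product)
  qed simp
  finally show ?thesis .
qed

lemma lex_ge_total: "lex_ge \<alpha> \<beta> \<or> lex_ge \<beta> \<alpha>"
proof -
  have "\<forall>x y. (x, y) \<in> {(x::nat, y). x < y} \<or> x = y \<or> (y, x) \<in> {(x, y). x < y}" by auto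
  from lexord_linear[OF this, of \<alpha> \<beta>] show ?thesis by (auto simp: lex_ge_def)
qed

lemma lex_ge_antisym: "lex_ge \<alpha> \<beta> \<Longrightarrow> lex_ge \<beta> \<alpha> \<Longrightarrow> \<alpha> = \<beta>"
  using lexord_asymmetric[of "{(x::nat, y). x < y}" \<alpha> \<beta>] by (auto simp: lex_ge_def asym_iff)

text \<open>The order is total and antisymmetric, so \<open>prod.swap\<close> matches the pairs that
  violate \<open>lex_ge\<close> with the strictly ordered ones. These count twice, the diagonal
  pairs once.\<close>

lemma sum_partition_pairs_lex:
  fixes T :: "nat list \<Rightarrow> nat list \<Rightarrow> complex"
  assumes sym: "\<And>\<alpha> \<beta>. (\<alpha>, \<beta>) \<in> partition_pairs k r \<Longrightarrow> T \<beta> \<alpha> = T \<alpha> \<beta>"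
  shows "(\<Sum>(\<alpha>, \<beta>)\<in>partition_pairs k r. T \<alpha> \<beta>) =
    (\<Sum>(\<alpha>, \<beta>)\<in>{(\<alpha>, \<beta>). is_partition_k k \<alpha> \<and> is_partition_k k \<beta> \<and> sum_list \<alpha> + sum_list \<beta> = r \<and> lex_ge \<alpha> \<beta>}.
       2 ^ (if \<alpha> = \<beta> then 0 else 1) * T \<alpha> \<beta>)"
proof -
  define X where "X = {(\<alpha>, \<beta>). (\<alpha>, \<beta>) \<in> partition_pairs k r \<and> lex_ge \<alpha> \<beta>}"
  define D where "D = {(\<alpha>, \<beta>). (\<alpha>, \<beta>) \<in> partition_pairs k r \<and> lex_ge \<alpha> \<beta> \<and> \<alpha> \<noteq> \<beta>}"
  define Y where "Y = {(\<alpha>, \<beta>). (\<alpha>, \<beta>) \<in> partition_pairs k r \<and> \<not> lex_ge \<alpha> \<beta>}"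
  have fin: "finite (partition_pairs k r)" by (rule finite_subset[OF partition_pairs_subset finite_tuple_pairs])
  have "X \<subseteq> partition_pairs k r" "Y \<subseteq> partition_pairs k r" by (auto simp: X_def Y_def)
  then have finX: "finite X" "finite Y" using fin finite_subset by blast+
  have XY: "partition_pairs k r = X \<union> Y" "X \<inter> Y = {}" by (auto simp: X_def Y_def)
  have "(\<Sum>(\<alpha>, \<beta>)\<in>Y. T \<alpha> \<beta>) = (\<Sum>(\<alpha>, \<beta>)\<in>D. T \<alpha> \<beta>)"
  proof (rule sum.reindex_bij_witness[of _ prod.swap prod.swap])
    fix y assume "y \<in> Y"
    then show "prod.swap y \<in> D" 
      using lex_ge_total by (auto simp: Y_def D_def partition_pairs_def lex_ge_def)
  next
    fix y assume "y \<in> D"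
    then show "prod.swap y \<in> Y" 
      using lex_ge_antisym by (auto simp: Y_def D_def partition_pairs_def)
  qed (auto simp: Y_def intro!: sym)
  also have "\<dots> = (\<Sum>(\<alpha>, \<beta>)\<in>X. if \<alpha> \<noteq> \<beta> then T \<alpha> \<beta> else 0)"
  proof -
    have "D = {y \<in> X. fst y \<noteq> snd y}" by (auto simp: D_def X_def)
    then show ?thesis using finX by (simp add: case_prod_beta sum.inter_filter)
  qed
  finally have Y: "(\<Sum>(\<alpha>, \<beta>)\<in>Y. T \<alpha> \<beta>) = (\<Sum>(\<alpha>, \<beta>)\<in>X. if \<alpha> \<noteq> \<beta> then T \<alpha> \<beta> else 0)" .
  have "(\<Sum>(\<alpha>, \<beta>)\<in>partition_pairs k r. T \<alpha> \<beta>) = (\<Sum>(\<alpha>, \<beta>)\<in>X. T \<alpha> \<beta>) + (\<Sum>(\<alpha>, \<beta>)\<in>Y. T \<alpha> \<beta>)"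
    unfolding XY(1) by (rule sum.union_disjoint) (use finX XY in auto)
  also have "\<dots> = (\<Sum>(\<alpha>, \<beta>)\<in>X. 2 ^ (if \<alpha> = \<beta> then 0 else 1) * T \<alpha> \<beta>)"
    unfolding Y sum.distrib[symmetric] by (rule sum.cong) auto
  also have "X = {(\<alpha>, \<beta>). is_partition_k k \<alpha> \<and> is_partition_k k \<beta> \<and> sum_list \<alpha> + sum_list \<beta> = r \<and> lex_ge \<alpha> \<beta>}"
    by (auto simp: X_def partition_pairs_def)
  finally show ?thesis .
qed

section \<open>Degrees left to the exponential and the determinants \<open>Mt\<close>\<close>

lemma exp_coeff_rGamma: "exp_coeff s j = s ^ nat j * of_real (rGamma (of_int (j + 1)))"
proof (cases "j < 0")
  case True
  \<comment> \<open>The zeros of \<open>rGamma\<close> at the nonpositive integers reproduce the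
    convention of \<open>exp_coeff\<close> for negative indices, where \<open>nat j\<close> is 0 and
    the power is 1.\<close>
  then have "of_int (j + 1) \<in> (\<int>\<^sub>\<le>\<^sub>0 :: real set)" by (intro nonpos_Ints_of_int) simp
  then have "rGamma (of_int (j + 1)) = (0 :: real)" by (simp only: rGamma_eq_zero_iff)
  then show ?thesis using True by (simp add: exp_coeff_def)
next
  case False
  then obtain m where j: "j = int m" by (metis nonneg_int_cases not_less)
  have "rGamma (of_int (j + 1)) = (1 / fact m :: real)"
    using Gamma_fact[of m, where ?'a = real] by (simp add: j rGamma_inverse_Gamma inverse_eq_divide add.commute)
  then show ?thesis using False by (simp add: exp_coeff_def j)
qed

definition tuple_index :: "nat \<Rightarrow> nat list \<times> nat list \<Rightarrow> nat \<Rightarrow> nat" where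
  "tuple_index k t = (\<lambda>i. if 1 \<le> i \<and> i \<le> k then fst t ! (i - 1) else if k < i \<and> i \<le> 2 * k then snd t ! (i - k - 1) else 0)"

lemma sum_double_split:
  fixes f :: "nat \<Rightarrow> 'a::comm_monoid_add"
  shows "(\<Sum>i\<in>{1..2 * k}. f i) = (\<Sum>i<k. f (Suc i)) + (\<Sum>i<k. f (Suc (i + k)))"
proof -
  have split: "{1..2 * k} = {1..k} \<union> {Suc k..2 * k}" by auto
  have "(\<Sum>i\<in>{1..2 * k}. f i) = (\<Sum>i\<in>{1..k}. f i) + (\<Sum>i\<in>{Suc k..2 * k}. f i)"
    unfolding split by (rule sum.union_disjoint) auto
  also have "(\<Sum>i\<in>{1..k}. f i) = (\<Sum>i<k. f (Suc i))"
    by (rule sum.reindex_bij_witness[of _ Suc "\<lambda>i. i - 1"]) auto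
  also have "(\<Sum>i\<in>{Suc k..2 * k}. f i) = (\<Sum>i<k. f (Suc (i + k)))"
    by (rule sum.reindex_bij_witness[of _ "\<lambda>i. Suc (i + k)" "\<lambda>i. i - Suc k"]) auto
  finally show ?thesis .
qed

lemma sum_tuple_index:
  assumes "length (fst t) = k" "length (snd t) = k"
  shows "(\<Sum>i\<in>{1..2 * k}. tuple_index k t i) = sum_list (fst t) + sum_list (snd t)"
  unfolding sum_double_split using assms
  by (simp add: tuple_index_def sum_list_sum_nth lessThan_atLeast0)

text \<open>Exponents of the monomial that replaces the two smaller Vandermonde products: one
  staircase \<open>0, ..., k - 1\<close> for each half.\<close>

definition row_degree :: "nat \<Rightarrow> nat \<Rightarrow> nat" where
  "row_degree k i = (if i \<le> k then i - 1 else i - Suc k)"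

text \<open>The degree that the exponential must supply in variable \<open>i\<close>: the pole of
  order \<open>2 * k\<close> asks for \<open>2 * k - 1\<close>, of which the staircase, the Leibniz
  exponent \<open>p i - 1\<close> and the Taylor exponent \<open>a i\<close> take their shares. It
  is an integer because these can exceed the total.\<close>

definition exponent_gap :: "nat \<Rightarrow> (nat \<Rightarrow> nat) \<Rightarrow> (nat \<Rightarrow> nat) \<Rightarrow> nat \<Rightarrow> int" where
  "exponent_gap k p a i = int (2 * k - 1) - int (row_degree k i + (p i - 1)) - int (a i)"

text \<open>The count is \<open>2k(2k - 1) - k(k - 1) - k(2k - 1) = k^2\<close>, whatever the
  permutation.\<close>

lemma sum_exponent_gap:
  assumes "k \<ge> 1" and p: "p permutes {1..2 * k}"
  shows "(\<Sum>i\<in>{1..2 * k}. exponent_gap k p a i) = int (k ^ 2) - int (\<Sum>i\<in>{1..2 * k}. a i)"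
proof -
  have tri: "2 * (\<Sum>i<m. int i) = int m * (int m - 1)" for m
    by (induction m) (auto simp: algebra_simps)
  have "(\<Sum>i\<in>{1..2 * k}. int (p i - 1)) = (\<Sum>i\<in>{1..2 * k}. int (i - 1))"
    using sum.permute[OF p, of "\<lambda>i. int (i - 1)"] by (simp add: o_def)
  also have "\<dots> = (\<Sum>i<2 * k. int i)"
    by (rule sum.reindex_bij_witness[of _ Suc "\<lambda>i. i - 1"]) auto
  finally have 1: "2 * (\<Sum>i\<in>{1..2 * k}. int (p i - 1)) = 2 * int k * (2 * int k - 1)"
    using tri[of "2 * k"] by simp
  have 2: "2 * (\<Sum>i\<in>{1..2 * k}. int (row_degree k i)) = 2 * (int k * (int k - 1))"
    unfolding sum_double_split using tri[of k] by (simp add: row_degree_def)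
  have "(\<Sum>i\<in>{1..2 * k}. exponent_gap k p a i) = 2 * int k * int (2 * k - 1) -
     ((\<Sum>i\<in>{1..2 * k}. int (row_degree k i)) + (\<Sum>i\<in>{1..2 * k}. int (p i - 1))) - (\<Sum>i\<in>{1..2 * k}. int (a i))"
    unfolding exponent_gap_def using assms(1) by (simp add: sum_subtractf sum.distrib of_nat_diff)
  moreover have "int (2 * k - 1) = 2 * int k - 1" using assms(1) by auto
  ultimately show ?thesis using 1 2 by (simp add: algebra_simps power2_eq_square)
qed

lemma prod_double_split:
  fixes f :: "nat \<Rightarrow> 'a::comm_monoid_mult"
  shows "(\<Prod>i<2 * k. f i) = (\<Prod>i<k. f i) * (\<Prod>i<k. f (i + k))"
proof -
  have split: "{..<2 * k} = {..<k} \<union> {k..<2 * k}" by auto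
  have "(\<Prod>i<2 * k. f i) = (\<Prod>i<k. f i) * (\<Prod>i\<in>{k..<2 * k}. f i)"
    unfolding split by (rule prod.union_disjoint) auto
  also have "(\<Prod>i\<in>{k..<2 * k}. f i) = (\<Prod>i<k. f (i + k))"
    by (rule prod.reindex_bij_witness[of _ "\<lambda>i. i + k" "\<lambda>i. i - k"]) auto
  finally show ?thesis .
qed

text \<open>Passage from the variables, numbered from 1, to the rows and columns of
  \<open>det_n\<close>, numbered from 0.\<close>

lemma sum_permutations_shift:
  fixes f :: "int \<Rightarrow> (nat \<Rightarrow> nat) \<Rightarrow> 'b::comm_monoid_add"
  assumes f_cong: "\<And>s u v. (\<And>i. i < n \<Longrightarrow> u i = v i) \<Longrightarrow> f s u = f s v"
  shows "(\<Sum>p | p permutes {1..n}. f (sign p) (\<lambda>i. p (Suc i) - 1)) =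
   (\<Sum>p | p permutes {0..<n}. f (sign p) p)"
proof (rule sum.reindex_bij_witness[of _ "map_permutation {0..<n} Suc" "map_permutation {1..n} (\<lambda>i. i - 1)"])
  have bij: "bij_betw Suc {0..<n} {1..n}" "bij_betw (\<lambda>i. i - 1) {1..n} {0..<n}"
    by (auto intro!: bij_betwI[of _ _ _ "\<lambda>i. i - 1"] bij_betwI[of _ _ _ Suc])
  note inj = bij[THEN bij_betw_imp_inj_on]
  {
    fix p assume "p \<in> {p. p permutes {1..n}}"
    then have p: "p permutes {1..n}" by simp
    show "map_permutation {0..<n} Suc (map_permutation {1..n} (\<lambda>i. i - 1) p) = p"
      by (rule map_permutation_compose_inv[OF bij(2) p]) auto
    show "map_permutation {1..n} (\<lambda>i. i - 1) p \<in> {p. p permutes {0..<n}}"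
      using map_permutation_permutes[OF bij(2) p] by simp
    have "map_permutation {1..n} (\<lambda>i. i - 1) p i = p (Suc i) - 1" if "i < n" for i
      using map_permutation_apply[OF inj(2), of "Suc i" p] that by simp
    then show "f (sign (map_permutation {1..n} (\<lambda>i. i - 1) p)) (map_permutation {1..n} (\<lambda>i. i - 1) p) =
       f (sign p) (\<lambda>i. p (Suc i) - 1)"
      unfolding sign_map_permutation[OF inj(2) p finite_atLeastAtMost] by (intro f_cong) simp
  }
  {
    fix p assume "p \<in> {p. p permutes {0..<n}}"
    then have p: "p permutes {0..<n}" by simp
    show "map_permutation {1..n} (\<lambda>i. i - 1) (map_permutation {0..<n} Suc p) = p"
      by (rule map_permutation_compose_inv[OF bij(1) p]) auto
    show "map_permutation {0..<n} Suc p \<in> {p. p permutes {1..n}}"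
      using map_permutation_permutes[OF bij(1) p] by simp
  }
qed

text \<open>Each residue splits into a power of \<open>x / 2\<close>, a matrix entry and, in the
  lower half, a sign \<open>(-1) ^ a i\<close>. The powers combine by the degree count, the signs
  make up \<open>(-1) ^ sum_list \<beta>\<close>, and the Leibniz sum of the entries is the
  determinant.\<close>

lemma Mt_exp_coeff:
  fixes x :: complex
  assumes k: "k \<ge> 1" and len: "length \<alpha> = k" "length \<beta> = k" and le: "sum_list \<alpha> + sum_list \<beta> \<le> k ^ 2"
  shows "(\<Sum>p | p permutes {1..2 * k}. of_int (sign p) *
      (\<Prod>i\<in>{1..2 * k}. exp_coeff (if i \<le> k then x / 2 else - (x / 2)) (exponent_gap k p (tuple_index k (\<alpha>, \<beta>)) i))) =
    (x / 2) ^ (k ^ 2 - (sum_list \<alpha> + sum_list \<beta>)) * of_real (Mt k \<alpha> \<beta>)"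
proof -
  define y where "y = x / 2"
  define a where "a = tuple_index k (\<alpha>, \<beta>)"
  define m where "m = (\<lambda>i j.
     if i < k then rGamma (of_int (2 * int k - int i - int j - int (\<alpha> ! i)))
     else (-1) ^ ((i - k) + j + 1) * rGamma (of_int (2 * int k - int (i - k) - int j - int (\<beta> ! (i - k)))) :: real)"
  have sum_a: "(\<Sum>i\<in>{1..2 * k}. a i) = sum_list \<alpha> + sum_list \<beta>"
    using sum_tuple_index[of "(\<alpha>, \<beta>)" k] len by (simp add: a_def)
  have entry: "exp_coeff (if i \<le> k then y else - y) (exponent_gap k p a i) =
      y ^ nat (exponent_gap k p a i) * (of_real (m (i - 1) (p i - 1)) * (if i \<le> k then 1 else (-1) ^ a i))"
    if p: "p permutes {1..2 * k}" and i: "i \<in> {1..2 * k}" for p i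
  proof -
    define j where "j = p i - 1"
    define d where "d = exponent_gap k p a i"
    have k1: "int (2 * k - 1) = 2 * int k - 1" using k by auto
    show ?thesis
    proof (cases "i \<le> k")
      case True
      have "d + 1 = 2 * int k - int (i - 1) - int j - int (\<alpha> ! (i - 1))"
        using True i unfolding d_def exponent_gap_def k1 by (simp add: row_degree_def a_def tuple_index_def j_def)
      moreover have "i - 1 < k" using True i by auto
      ultimately have "m (i - 1) j = rGamma (of_int (d + 1))" by (simp only: m_def if_True)
      then show ?thesis using True by (simp add: exp_coeff_rGamma d_def j_def)
    next
      case False
      define l where "l = i - Suc k"
      have l: "i - 1 - k = l" "\<not> i - 1 < k" using False by (auto simp: l_def)
      have ai: "a i = \<beta> ! l" using False i by (simp add: a_def tuple_index_def l_def)
      have d: "d + 1 = 2 * int k - int l - int j - int (\<beta> ! l)"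
        using False i unfolding d_def exponent_gap_def k1 by (simp add: row_degree_def ai j_def l_def)
      have mm: "m (i - 1) j = (-1) ^ (l + j + 1) * rGamma (of_int (d + 1))" 
        unfolding m_def l d using l by simp
      have "(-y) ^ nat d * of_real (rGamma (of_int (d + 1))) = y ^ nat d * (of_real (m (i - 1) j) * (-1) ^ a i)"
      proof (cases "d < 0")
        case True
        then have "of_int (d + 1) \<in> (\<int>\<^sub>\<le>\<^sub>0 :: real set)" by (intro nonpos_Ints_of_int) simp
        then have "rGamma (of_int (d + 1)) = (0 :: real)" by (simp only: rGamma_eq_zero_iff)
        then show ?thesis by (simp only: mm mult_zero_right mult_zero_left of_real_0)
      next
        case False
        obtain c where c: "d = int c" using False by (metis nonneg_int_cases not_less)
        \<comment> \<open>This is \<open>c + (l + j + 1 + a i) = 2 * k\<close> with the same number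
          added on both sides, which compares the parities without subtraction.\<close>
        have "c + 2 * (l + j + 1 + a i) = 2 * k + (l + j + 1 + a i)" using d unfolding ai c by arith
        then have "nat d + 2 * (l + j + 1 + a i) = 2 * k + (l + j + 1 + a i)" by (simp add: c)
        then have "(-1 :: complex) ^ (nat d + 2 * (l + j + 1 + a i)) = (-1) ^ (2 * k + (l + j + 1 + a i))" by (simp only:)
        then have "(-1 :: complex) ^ nat d = (-1) ^ (l + j + 1) * (-1) ^ a i" by (simp add: power_add power_mult)
        then show ?thesis unfolding mm by (simp add: power_minus[of y])
      qed
      then show ?thesis using False by (simp add: exp_coeff_rGamma d_def j_def)
    qed
  qed
  have sgn_a: "(\<Prod>i\<in>{1..2 * k}. if i \<le> k then 1 else (-1) ^ a i) = (-1 :: complex) ^ sum_list \<beta>"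
  proof -
    have "(\<Prod>i\<in>{1..2 * k}. if i \<le> k then 1 else (-1 :: complex) ^ a i) = (\<Prod>i<2 * k. if Suc i \<le> k then 1 else (-1) ^ a (Suc i))"
      by (rule prod.reindex_bij_witness[of _ Suc "\<lambda>i. i - 1"]) auto
    also have "\<dots> = (\<Prod>i<k. (-1) ^ a (Suc (i + k)))" unfolding prod_double_split by simp
    also have "\<dots> = (-1) ^ (\<Sum>i<k. \<beta> ! i)" by (simp add: power_sum a_def tuple_index_def)
    finally show ?thesis using len by (simp add: sum_list_sum_nth lessThan_atLeast0)
  qed
  \<comment> \<open>\<open>nat\<close> cuts negative gaps off at 0, so the exponents of
    \<open>y\<close> add up correctly only if all gaps are nonnegative. If one is negative, both
    products contain a zero factor.\<close>
  have prod_eq: "(\<Prod>i\<in>{1..2 * k}. exp_coeff (if i \<le> k then y else - y) (exponent_gap k p a i)) =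
      y ^ (k ^ 2 - (sum_list \<alpha> + sum_list \<beta>)) * ((-1) ^ sum_list \<beta> * (\<Prod>i<2 * k. of_real (m i (p (Suc i) - 1))))"
    if p: "p permutes {1..2 * k}" for p
  proof (cases "\<exists>i\<in>{1..2 * k}. exponent_gap k p a i < 0")
    case True
    then obtain i where i: "i \<in> {1..2 * k}" "exponent_gap k p a i < 0" by blast
    have z1: "(\<Prod>i\<in>{1..2 * k}. exp_coeff (if i \<le> k then y else - y) (exponent_gap k p a i)) = 0"
      using i by (intro prod_zero) (auto simp: exp_coeff_def)
    have "m (i - 1) (p i - 1) = 0"
    proof -
      have k1: "int (2 * k - 1) = 2 * int k - 1" using k by auto
      show ?thesis
      proof (cases "i \<le> k")
        case True
        then have "2 * int k - int (i - 1) - int (p i - 1) - int (\<alpha> ! (i - 1)) \<le> 0"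
          using i unfolding exponent_gap_def k1 by (simp add: row_degree_def a_def tuple_index_def)
        then show ?thesis using True i unfolding m_def
          by (simp add: rGamma_eq_zero_iff nonpos_Ints_of_int del: of_int_diff of_int_mult)
      next
        case False
        then have "2 * int k - int (i - 1 - k) - int (p i - 1) - int (\<beta> ! (i - 1 - k)) \<le> 0"
          using i unfolding exponent_gap_def k1 by (simp add: row_degree_def a_def tuple_index_def)
        then show ?thesis using False i unfolding m_def
          by (simp add: rGamma_eq_zero_iff nonpos_Ints_of_int del: of_int_diff of_int_mult)
      qed
    qed
    then have "(\<Prod>i<2 * k. complex_of_real (m i (p (Suc i) - 1))) = 0"
      using i by (intro prod_zero) (auto intro!: bexI[of _ "i - 1"])
    then show ?thesis unfolding z1 by (simp only: mult_zero_right)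
  next
    case False
    have "int (\<Sum>i\<in>{1..2 * k}. nat (exponent_gap k p a i)) = (\<Sum>i\<in>{1..2 * k}. exponent_gap k p a i)"
      unfolding of_nat_sum using False by (intro sum.cong refl) (simp add: not_less)
    also have "\<dots> = int (k ^ 2) - int (sum_list \<alpha> + sum_list \<beta>)"
      unfolding sum_exponent_gap[OF k p] sum_a ..
    finally have "(\<Sum>i\<in>{1..2 * k}. nat (exponent_gap k p a i)) = k ^ 2 - (sum_list \<alpha> + sum_list \<beta>)"
      using le by linarith
    then have pw: "(\<Prod>i\<in>{1..2 * k}. y ^ nat (exponent_gap k p a i)) = y ^ (k ^ 2 - (sum_list \<alpha> + sum_list \<beta>))"
      by (simp flip: power_sum)
    have sh: "(\<Prod>i\<in>{1..2 * k}. complex_of_real (m (i - 1) (p i - 1))) = (\<Prod>i<2 * k. of_real (m i (p (Suc i) - 1)))"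
      by (rule prod.reindex_bij_witness[of _ Suc "\<lambda>i. i - 1"]) auto
    have "(\<Prod>i\<in>{1..2 * k}. exp_coeff (if i \<le> k then y else - y) (exponent_gap k p a i)) =
      (\<Prod>i\<in>{1..2 * k}. y ^ nat (exponent_gap k p a i) * (of_real (m (i - 1) (p i - 1)) * (if i \<le> k then 1 else (-1) ^ a i)))"
      by (rule prod.cong) (use entry[OF p] in auto)
    also have "\<dots> = y ^ (k ^ 2 - (sum_list \<alpha> + sum_list \<beta>)) * ((\<Prod>i<2 * k. of_real (m i (p (Suc i) - 1))) * (-1) ^ sum_list \<beta>)"
      unfolding prod.distrib pw sh sgn_a ..
    finally show ?thesis by (simp add: mult_ac)
  qed
  have "(\<Sum>p | p permutes {1..2 * k}. of_int (sign p) *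
      (\<Prod>i\<in>{1..2 * k}. exp_coeff (if i \<le> k then y else - y) (exponent_gap k p a i))) =
    (\<Sum>p | p permutes {1..2 * k}. y ^ (k ^ 2 - (sum_list \<alpha> + sum_list \<beta>)) * (-1) ^ sum_list \<beta> *
       (of_int (sign p) * (\<Prod>i<2 * k. of_real (m i (p (Suc i) - 1)))))"
  proof (rule sum.cong[OF refl])
    fix p assume "p \<in> {p. p permutes {1..2 * k}}"
    then have p: "p permutes {1..2 * k}" by (simp only: mem_Collect_eq)
    show "of_int (sign p) * (\<Prod>i\<in>{1..2 * k}. exp_coeff (if i \<le> k then y else - y) (exponent_gap k p a i)) =
      y ^ (k ^ 2 - (sum_list \<alpha> + sum_list \<beta>)) * (-1) ^ sum_list \<beta> *
       (of_int (sign p) * (\<Prod>i<2 * k. of_real (m i (p (Suc i) - 1))))"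
      unfolding prod_eq[OF p] by (simp only: mult_ac)
  qed
  also have "\<dots> = y ^ (k ^ 2 - (sum_list \<alpha> + sum_list \<beta>)) * (-1) ^ sum_list \<beta> *
     (\<Sum>p | p permutes {1..2 * k}. of_int (sign p) * (\<Prod>i<2 * k. of_real (m i (p (Suc i) - 1))))"
    by (simp add: sum_distrib_left)
  also have "(\<Sum>p | p permutes {1..2 * k}. of_int (sign p) * (\<Prod>i<2 * k. complex_of_real (m i (p (Suc i) - 1)))) =
     (\<Sum>p | p permutes {0..<2 * k}. of_int (sign p) * (\<Prod>i<2 * k. of_real (m i (p i))))"
    by (rule sum_permutations_shift[of "2 * k" "\<lambda>s u. of_int s * (\<Prod>i<2 * k. complex_of_real (m i (u i)))"])
      (auto intro!: prod.cong)
  also have "\<dots> = of_real (det_n (2 * k) m)"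
    by (simp add: det_n_def)
  finally have eq: "(\<Sum>p | p permutes {1..2 * k}. of_int (sign p) *
      (\<Prod>i\<in>{1..2 * k}. exp_coeff (if i \<le> k then y else - y) (exponent_gap k p a i))) =
    y ^ (k ^ 2 - (sum_list \<alpha> + sum_list \<beta>)) * (-1) ^ sum_list \<beta> * of_real (det_n (2 * k) m)" .
  have Mt: "Mt k \<alpha> \<beta> = (-1) ^ sum_list \<beta> * det_n (2 * k) m"
    unfolding Mt_def m_def ..
  show ?thesis using eq unfolding Mt y_def a_def by (simp only: of_real_mult of_real_power of_real_minus of_real_1 mult.assoc)
qed

section \<open>Symmetries of the Euler product\<close>

lemma prod_block_permute:
  fixes \<phi> :: "complex \<Rightarrow> 'b::comm_monoid_mult"
  assumes "q permutes {1..k} \<or> q permutes {Suc k..2 * k}"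
  shows "(\<Prod>j\<in>{1..k}. \<phi> (z (q j))) = (\<Prod>j\<in>{1..k}. \<phi> (z j))"
    and "(\<Prod>j\<in>{1..k}. \<phi> (z (q (k + j)))) = (\<Prod>j\<in>{1..k}. \<phi> (z (k + j)))"
proof -
  have shift: "(\<Prod>j\<in>{1..k}. g (k + j)) = (\<Prod>j\<in>{Suc k..2 * k}. g j)" for g :: "nat \<Rightarrow> 'b"
    by (rule prod.reindex_bij_witness[of _ "\<lambda>j. j - k" "\<lambda>j. k + j"]) auto
  show "(\<Prod>j\<in>{1..k}. \<phi> (z (q j))) = (\<Prod>j\<in>{1..k}. \<phi> (z j))"
    using assms
  proof
    assume "q permutes {1..k}"
    from prod.permute[OF this, of "\<lambda>j. \<phi> (z j)"] show ?thesis by (simp add: o_def)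
  next
    assume "q permutes {Suc k..2 * k}"
    from permutes_not_in[OF this] show ?thesis by (intro prod.cong) auto
  qed
  show "(\<Prod>j\<in>{1..k}. \<phi> (z (q (k + j)))) = (\<Prod>j\<in>{1..k}. \<phi> (z (k + j)))"
    using assms
  proof
    assume "q permutes {1..k}"
    from permutes_not_in[OF this] show ?thesis by (intro prod.cong) auto
  next
    assume "q permutes {Suc k..2 * k}"
    from prod.permute[OF this, of "\<lambda>j. \<phi> (z j)"] show ?thesis
      unfolding shift[of "\<lambda>j. \<phi> (z (q j))"] shift[of "\<lambda>j. \<phi> (z j)"] by (simp add: o_def)
  qed
qed

lemma prod_prod_block_permute:
  fixes \<psi> :: "complex \<Rightarrow> complex \<Rightarrow> 'b::comm_monoid_mult"
  assumes "q permutes {1..k} \<or> q permutes {Suc k..2 * k}"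
  shows "(\<Prod>i\<in>{1..k}. \<Prod>j\<in>{1..k}. \<psi> (z (q i)) (z (q (k + j)))) = (\<Prod>i\<in>{1..k}. \<Prod>j\<in>{1..k}. \<psi> (z i) (z (k + j)))"
  unfolding prod_block_permute(2)[OF assms]
  by (rule prod_block_permute(1)[OF assms, of "\<lambda>w. \<Prod>j\<in>{1..k}. \<psi> w (z (k + j))"])

lemma A_local_permute:
  assumes "q permutes {1..k} \<or> q permutes {Suc k..2 * k}"
  shows "A_local k (\<lambda>i. z (q i)) p = A_local k z p"
  unfolding A_local_def prod.distrib
    prod_prod_block_permute[OF assms, of "\<lambda>v w. 1 - of_nat p powr (- 1 - v + w)"]
    prod_block_permute(1)[OF assms, of "\<lambda>v. inverse (1 - e \<theta> / of_nat p powr (1/2 + v))" for \<theta>]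
    prod_block_permute(2)[OF assms, of "\<lambda>v. inverse (1 - e (- \<theta>) / of_nat p powr (1/2 - v))" for \<theta>] ..

lemma A_permute:
  assumes "q permutes {1..k} \<or> q permutes {Suc k..2 * k}"
  shows "A k (\<lambda>i. z (q i)) = A k z"
  unfolding A_def A_local_permute[OF assms] ..

section \<open>Exchange of the two halves with a change of sign\<close>

definition half_swap :: "nat \<Rightarrow> nat \<Rightarrow> nat" where
  "half_swap k i = (if 1 \<le> i \<and> i \<le> k then i + k else if k < i \<and> i \<le> 2 * k then i - k else i)"

lemma half_swap_permutes: "half_swap k permutes {1..2 * k}"
  by (rule inj_imp_permutes) (auto simp: half_swap_def inj_on_def split: if_splits)

lemma half_swap_simps: 
  "j \<in> {1..k} \<Longrightarrow> half_swap k j = k + j" "j \<in> {1..k} \<Longrightarrow> half_swap k (k + j) = j"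
  by (auto simp: half_swap_def)

text \<open>Reflection preserves integrability in both directions, and the integral of a
  non-integrable function is 0 by convention, so the symmetry derived from this holds at every
  \<open>z\<close>.\<close>

lemma integral_reflect_unit:
  fixes f :: "real \<Rightarrow> complex"
  shows "integral {0..1} (\<lambda>t. f (1 - t)) = integral {0..1} f"
proof -
  have *: "((\<lambda>t. f (1 - t)) has_integral i) {0..1}" if "(f has_integral i) {0..1}" for f :: "real \<Rightarrow> complex" and i
  proof -
    have "(\<lambda>x. (1 / (-1)) *\<^sub>R x + - ((1 / (-1)) *\<^sub>R 1)) ` cbox 0 1 = {0..1::real}"
    proof (intro equalityI subsetI)
      fix x :: real assume "x \<in> {0..1}"
      then show "x \<in> (\<lambda>x. (1 / (-1)) *\<^sub>R x + - ((1 / (-1)) *\<^sub>R 1)) ` cbox 0 1"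
        by (intro image_eqI[of _ _ "1 - x"]) auto
    qed auto
    then show ?thesis using has_integral_affinity[of f i 0 1 "-1" 1] that by (simp add: algebra_simps)
  qed
  have "f integrable_on {0..1} \<longleftrightarrow> (\<lambda>t. f (1 - t)) integrable_on {0..1}"
    using *[of f] *[of "\<lambda>t. f (1 - t)"] by (auto simp: integrable_on_def)
  then show ?thesis
    by (cases "f integrable_on {0..1}") (auto simp: not_integrable_integral intro!: integral_unique *)
qed

text \<open>The exchange interchanges the roles of \<open>e \<theta>\<close> and
  \<open>e (- \<theta>)\<close> in the integrand; replacing \<theta> by 1 - \<theta> and using the
  period 1 restores it.\<close>

lemma A_local_swap: "A_local k (\<lambda>i. - z (half_swap k i)) p = A_local k z p"
proof -
  define f where "f = (\<lambda>\<theta>. \<Prod>j\<in>{1..k}. inverse (1 - e \<theta> / of_nat p powr (1/2 + z j)) *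
        inverse (1 - e (- \<theta>) / of_nat p powr (1/2 - z (k + j))))"
  have per: "e (1 - \<theta>) = e (- \<theta>)" "e (- (1 - \<theta>)) = e \<theta>" for \<theta>
  proof -
    have "e (t + 1) = e t" for t
      unfolding e_def by (simp add: distrib_left exp_add)
    from this[of "- \<theta>"] this[of "\<theta> - 1"] show "e (1 - \<theta>) = e (- \<theta>)" "e (- (1 - \<theta>)) = e \<theta>" by simp_all
  qed
  have "(\<Prod>i\<in>{1..k}. \<Prod>j\<in>{1..k}. 1 - of_nat p powr (- 1 - (- z (half_swap k i)) + (- z (half_swap k (k + j))))) =
    (\<Prod>i\<in>{1..k}. \<Prod>j\<in>{1..k}. 1 - of_nat p powr (- 1 - z j + z (k + i)))"
  proof (intro prod.cong refl)
    fix i j assume ij: "i \<in> {1..k}" "j \<in> {1..k}"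
    have "- 1 - (- z (half_swap k i)) + (- z (half_swap k (k + j))) = - 1 - z j + z (k + i)"
      unfolding half_swap_simps(1)[OF ij(1)] half_swap_simps(2)[OF ij(2)] by simp
    then show "1 - of_nat p powr (- 1 - (- z (half_swap k i)) + (- z (half_swap k (k + j)))) = 1 - of_nat p powr (- 1 - z j + z (k + i))"
      by (simp only:)
  qed
  also have "\<dots> = (\<Prod>i\<in>{1..k}. \<Prod>j\<in>{1..k}. 1 - of_nat p powr (- 1 - z i + z (k + j)))"
    by (rule prod.swap)
  finally have 1: "(\<Prod>i\<in>{1..k}. \<Prod>j\<in>{1..k}. 1 - of_nat p powr (- 1 - (- z (half_swap k i)) + (- z (half_swap k (k + j))))) = \<dots>" .
  have "(\<lambda>\<theta>. \<Prod>j\<in>{1..k}. inverse (1 - e \<theta> / of_nat p powr (1/2 + (- z (half_swap k j)))) *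
        inverse (1 - e (- \<theta>) / of_nat p powr (1/2 - (- z (half_swap k (k + j)))))) = (\<lambda>\<theta>. f (1 - \<theta>))"
    unfolding f_def per by (intro ext prod.cong refl) (simp add: half_swap_simps mult.commute)
  then show ?thesis unfolding A_local_def 1 by (simp only: integral_reflect_unit) (simp only: f_def)
qed

lemma A_swap: "A k (\<lambda>i. - z (half_swap k i)) = A k z"
  unfolding A_def A_local_swap ..

text \<open>\<open>F\<close> is written with the holomorphic \<open>h\<close> in place of the zeta
  factors. It is thus regular on the diagonals, and its symmetries can be read off from the formula
  at every point, not only where the coordinates are distinct.\<close>

lemma regular_part:
  obtains F \<rho> where "\<rho> > 0" "F \<in> polydisc_alg \<rho> (2 * k)"
    "\<And>z. z \<in> polydisc \<rho> (2 * k) \<Longrightarrow> inj_on z {1..2 * k} \<Longrightarrow>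
       A k z * (\<Prod>i\<in>{1..k}. \<Prod>j\<in>{1..k}. (z i - z (j + k)) * zeta (1 + z i - z (j + k))) = F z"
    "\<And>q z. q permutes {1..k} \<or> q permutes {Suc k..2 * k} \<Longrightarrow> F (\<lambda>i. z (q i)) = F z"
    "\<And>z. F (\<lambda>i. - z (half_swap k i)) = F z"
proof -
  obtain R h where R: "R > 0" and h: "h holomorphic_on ball 0 R"
    and zh: "\<And>w. w \<noteq> 0 \<Longrightarrow> norm w < R \<Longrightarrow> w * zeta (1 + w) = h w"
    using zeta_regularized by metis
  \<comment> \<open>1/12 serves the Euler product; \<open>R / 3\<close> keeps the differences
    \<open>z i - z (k + j)\<close>, of modulus at most \<open>2 * \<rho>\<close>, inside the disc of
    \<open>h\<close>.\<close>
  define \<rho> where "\<rho> = min (1/12) (R / 3)"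
  have \<rho>: "\<rho> > 0" "\<rho> \<le> 1/12" "2 * \<rho> < R" using R by (auto simp: \<rho>_def)
  define F where "F = (\<lambda>z. A k z * (\<Prod>i\<in>{1..k}. \<Prod>j\<in>{1..k}. h (z i - z (k + j))))"
  have le: "norm (z i - z (k + j)) \<le> 2 * \<rho>" if "z \<in> polydisc \<rho> (2 * k)" "i \<in> {1..k}" "j \<in> {1..k}" for z i j
  proof -
    have "norm (z i) \<le> \<rho>" "norm (z (k + j)) \<le> \<rho>" using that by (auto simp: polydisc_def)
    then show ?thesis using norm_triangle_ineq4[of "z i" "z (k + j)"] by linarith
  qed
  show ?thesis
  proof (rule that[of \<rho> F])
    show "\<rho> > 0" by fact
    have coord: "(\<lambda>z. z i - z (k + j)) \<in> polydisc_alg \<rho> (2 * k)" if "i \<in> {1..k}" "j \<in> {1..k}" for i j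
      using that by (intro pd.unif_closure_diff polydisc_alg_coord) auto
    show "F \<in> polydisc_alg \<rho> (2 * k)" unfolding F_def
    proof (intro pd.unif_closure_mult polydisc_alg_A pd.unif_closure_prod \<rho>(2))
      fix i j assume ij: "i \<in> {1..k}" "j \<in> {1..k}"
      show "(\<lambda>z. h (z i - z (k + j))) \<in> polydisc_alg \<rho> (2 * k)"
        by (rule pd.unif_closure_holomorphic_comp[OF coord[OF ij] le[OF _ ij] \<rho>(3) h])
    qed
  next
    fix z assume z: "z \<in> polydisc \<rho> (2 * k)" and inj: "inj_on z {1..2 * k}"
    have "(z i - z (j + k)) * zeta (1 + z i - z (j + k)) = h (z i - z (k + j))" if "i \<in> {1..k}" "j \<in> {1..k}" for i j
    proof -
      have "z i \<noteq> z (k + j)" using inj_onD[OF inj, of i "k + j"] that by auto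
      then show ?thesis using zh[of "z i - z (k + j)"] le[OF z that] \<rho>(3) by (simp add: add.commute add_diff_eq)
    qed
    then show "A k z * (\<Prod>i\<in>{1..k}. \<Prod>j\<in>{1..k}. (z i - z (j + k)) * zeta (1 + z i - z (j + k))) = F z"
      by (simp add: F_def)
  next
    fix q z assume q: "q permutes {1..k} \<or> q permutes {Suc k..2 * k}"
    show "F (\<lambda>i. z (q i)) = F z"
      unfolding F_def A_permute[OF q] prod_prod_block_permute[OF q, of "\<lambda>v w. h (v - w)"] ..
  next
    fix z
    have "(\<Prod>i\<in>{1..k}. \<Prod>j\<in>{1..k}. h (- z (half_swap k i) - - z (half_swap k (k + j)))) =
       (\<Prod>i\<in>{1..k}. \<Prod>j\<in>{1..k}. h (z j - z (k + i)))"
      by (intro prod.cong refl) (simp add: half_swap_simps)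
    also have "\<dots> = (\<Prod>i\<in>{1..k}. \<Prod>j\<in>{1..k}. h (z i - z (k + j)))" by (rule prod.swap)
    finally show "F (\<lambda>i. - z (half_swap k i)) = F z" by (simp add: F_def A_swap)
  qed
qed

text \<open>A rearrangement of a tuple becomes a permutation of the variables of one half, with
  \<open>c = 0\<close> for the first half and \<open>c = k\<close> for the second.\<close>

lemma list_permutation_block:
  assumes "mset xs = mset ys" "length ys = k"
  obtains q where "q permutes {Suc c..c + k}" "\<And>i. i \<in> {Suc c..c + k} \<Longrightarrow> xs ! (i - Suc c) = ys ! (q i - Suc c)"
proof -
  obtain p where p: "p permutes {..<length ys}" "permute_list p ys = xs"
    using mset_eq_permutation[OF assms(1)] by blast
  have inp: "p j < k" if "j < k" for j using permutes_in_image[OF p(1), of j] that assms(2) by simp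
  define q where "q = (\<lambda>i. if i \<in> {Suc c..c + k} then Suc c + p (i - Suc c) else i)"
  have "q permutes {Suc c..c + k}"
  proof (rule inj_imp_permutes)
    show "inj_on q {Suc c..c + k}"
    proof (rule inj_onI)
      fix i j assume ij: "i \<in> {Suc c..c + k}" "j \<in> {Suc c..c + k}" "q i = q j"
      then have "p (i - Suc c) = p (j - Suc c)" by (simp add: q_def)
      then have "i - Suc c = j - Suc c" using permutes_inj[OF p(1)] by (simp add: inj_eq)
      then show "i = j" using ij by auto
    qed
    show "q i \<in> {Suc c..c + k}" if "i \<in> {Suc c..c + k}" for i
    proof -
      have "i - Suc c < k" using that by auto
      from inp[OF this] show ?thesis using that by (simp add: q_def)
    qed
  qed (auto simp: q_def)
  moreover have "xs ! (i - Suc c) = ys ! (q i - Suc c)" if "i \<in> {Suc c..c + k}" for i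
  proof -
    have "i - Suc c < length ys" using that assms(2) by auto
    from permute_list_nth[OF p(1) this] show ?thesis using that p(2) by (simp add: q_def)
  qed
  ultimately show ?thesis by (rule that)
qed

section \<open>The coefficients of the polynomial\<close>

lemma bounded_functional_lincomb:
  assumes \<Psi>: "bounded_functional \<rho> n \<Psi>" and "finite X" and f: "\<And>p. p \<in> X \<Longrightarrow> f p \<in> polydisc_alg \<rho> n"
  shows "\<Psi> (\<lambda>z. \<Sum>p\<in>X. c p * f p z) = (\<Sum>p\<in>X. c p * \<Psi> (f p))"
  using assms(2,3)
proof (induction X rule: finite_induct)
  case empty
  show ?case using bounded_functionalD(1)[OF \<Psi> unif_closure_const, of 0 0] by simp
next
  case (insert p X)
  have "(\<lambda>z. \<Sum>p\<in>X. c p * f p z) \<in> polydisc_alg \<rho> n"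
    by (intro pd.unif_closure_sum pd.unif_closure_cmult insert.prems) auto
  moreover have "f p \<in> polydisc_alg \<rho> n" by (intro insert.prems) auto
  ultimately show ?case
    using insert bounded_functionalD(2)[OF \<Psi> pd.unif_closure_cmult, of "f p" "\<lambda>z. \<Sum>p\<in>X. c p * f p z" "c p"]
      bounded_functionalD(1)[OF \<Psi>, of "f p" "c p"] by simp
qed

lemma tuple_index_covers:
  assumes "(\<Sum>i\<in>{1..2 * k}. \<alpha> i) \<le> K"
  shows "\<exists>r\<le>K. \<exists>t\<in>tuple_pairs k r. \<forall>i\<in>{1..2 * k}. tuple_index k t i = \<alpha> i"
proof -
  define t where "t = (map (\<lambda>i. \<alpha> (Suc i)) [0..<k], map (\<lambda>i. \<alpha> (Suc (i + k))) [0..<k])"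
  have idx: "tuple_index k t i = \<alpha> i" if "i \<in> {1..2 * k}" for i
    using that by (auto simp: tuple_index_def t_def)
  have len: "length (fst t) = k" "length (snd t) = k" by (auto simp: t_def)
  have "sum_list (fst t) + sum_list (snd t) = (\<Sum>i\<in>{1..2 * k}. \<alpha> i)"
    unfolding sum_tuple_index[OF len, symmetric] by (intro sum.cong refl idx)
  then show ?thesis using assms idx len
    by (intro exI[of _ "\<Sum>i\<in>{1..2 * k}. \<alpha> i"] conjI bexI[of _ t]) (auto simp: tuple_pairs_def case_prod_beta)
qed

lemma tuple_index_inj:
  assumes t: "length (fst t) = k" "length (snd t) = k" and t': "length (fst t') = k" "length (snd t') = k"
    and eq: "\<forall>i\<in>{1..2 * k}. tuple_index k t i = tuple_index k t' i"
  shows "t = t'"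
proof (rule prod_eqI; rule nth_equalityI)
  fix i assume "i < length (fst t)"
  then show "fst t ! i = fst t' ! i" using eq[rule_format, of "Suc i"] t by (simp add: tuple_index_def)
next
  fix i assume "i < length (snd t)"
  then show "snd t ! i = snd t' ! i" using eq[rule_format, of "Suc (i + k)"] t by (simp add: tuple_index_def)
qed (use t t' in auto)

text \<open>The gaps then have a negative sum, so one of them is negative and its factor is 0. This
  is why Taylor terms of degree above \<open>k ^ 2\<close> leave no trace.\<close>

lemma exp_coeff_prod_eq_0:
  assumes "k \<ge> 1" "p permutes {1..2 * k}" "(\<Sum>i\<in>{1..2 * k}. a i) > k ^ 2"
  shows "(\<Prod>i\<in>{1..2 * k}. exp_coeff (s i) (exponent_gap k p a i)) = 0"
proof -
  have neg: "(\<Sum>i\<in>{1..2 * k}. exponent_gap k p a i) < 0"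
    using assms(3) unfolding sum_exponent_gap[OF assms(1,2)] by linarith
  obtain i where "i \<in> {1..2 * k}" "exponent_gap k p a i < 0"
    using sum_nonneg[of "{1..2 * k}" "exponent_gap k p a"] neg by (meson not_less)
  then show ?thesis by (intro prod_zero) (auto simp: exp_coeff_def)
qed

lemma alternant_cong:
  assumes "\<And>i. i \<in> I \<Longrightarrow> z i = z' i"
  shows "alternant I w z = alternant I w z'"
  unfolding alternant_def by (intro sum.cong arg_cong2[of _ _ _ _ "(*)"] prod.cong refl) (simp add: assms)

lemma exp_weight_eq:
  fixes z :: "nat \<Rightarrow> complex"
  shows "exp (x / 2 * (\<Sum>i\<in>{1..k}. z i - z (i + k))) =
     (\<Prod>i\<in>{1..2 * k}. exp ((if i \<le> k then x / 2 else - (x / 2)) * z i))"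
proof -
  have "(\<Sum>i\<in>{1..k}. z i - z (i + k)) = (\<Sum>i<k. z (Suc i) - z (Suc (i + k)))"
    by (rule sum.reindex_bij_witness[of _ Suc "\<lambda>i. i - 1"]) auto
  then have "x / 2 * (\<Sum>i\<in>{1..k}. z i - z (i + k)) =
    (\<Sum>i\<in>{1..2 * k}. (if i \<le> k then x / 2 else - (x / 2)) * z i)"
    unfolding sum_double_split by (simp add: sum_subtractf sum_negf sum_distrib_left right_diff_distrib sum_divide_distrib)
  then show ?thesis by (simp add: exp_sum)
qed

section \<open>Expansion of the contour integral over pairs of tuples\<close>

context
  fixes k :: nat and x :: complex and \<rho> :: real and F :: "(nat \<Rightarrow> complex) \<Rightarrow> complex"
  assumes k: "k \<ge> 1" and \<rho>: "\<rho> > 0" and F: "F \<in> polydisc_alg \<rho> (2 * k)"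
    and F_eq: "\<And>z. z \<in> polydisc \<rho> (2 * k) \<Longrightarrow> inj_on z {1..2 * k} \<Longrightarrow>
       A k z * (\<Prod>i\<in>{1..k}. \<Prod>j\<in>{1..k}. (z i - z (j + k)) * zeta (1 + z i - z (j + k))) = F z"
    and F_permute: "\<And>q z. q permutes {1..k} \<or> q permutes {Suc k..2 * k} \<Longrightarrow> F (\<lambda>i. z (q i)) = F z"
    and F_swap: "\<And>z. F (\<lambda>i. - z (half_swap k i)) = F z"
begin

definition "weight i = (if i \<le> k then x / 2 else - (x / 2))" for i
definition "expw z = (\<Prod>i\<in>{1..2 * k}. exp (weight i * z i))" for z
definition "vand = alternant {1..2 * k} (\<lambda>i. i - 1)"

lemma expw_alg: "expw \<in> polydisc_alg \<rho> (2 * k)"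
  unfolding expw_def[abs_def]
  by (intro pd.unif_closure_prod pd.unif_closure_exp pd.unif_closure_cmult polydisc_alg_coord)

lemma vand_alg: "vand \<in> polydisc_alg \<rho> (2 * k)"
  unfolding vand_def by (rule polydisc_alg_alternant) simp

lemma block_permutes:
  assumes "q permutes {1..k} \<or> q permutes {Suc k..2 * k}"
  shows "q permutes {1..2 * k}"
  using assms by (auto intro: permutes_subset)

lemma expw_permute:
  assumes q: "q permutes {1..k} \<or> q permutes {Suc k..2 * k}"
  shows "expw (\<lambda>i. z (q i)) = expw z"
proof -
  have "weight (q i) = weight i" if "i \<in> {1..2 * k}" for i
    using q
  proof
    assume q: "q permutes {1..k}"
    show ?thesis using permutes_in_image[OF q, of i] permutes_not_in[OF q, of i] that by (auto simp: weight_def)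
  next
    assume q: "q permutes {Suc k..2 * k}"
    show ?thesis using permutes_in_image[OF q, of i] permutes_not_in[OF q, of i] that by (auto simp: weight_def)
  qed
  then have "expw (\<lambda>i. z (q i)) = (\<Prod>i\<in>{1..2 * k}. exp (weight (q i) * z (q i)))"
    unfolding expw_def by (intro prod.cong) auto
  also have "\<dots> = expw z"
    using prod.permute[OF block_permutes[OF q], of "\<lambda>i. exp (weight i * z i)"] by (simp add: expw_def o_def)
  finally show ?thesis .
qed

lemma vand_permute:
  assumes q: "q permutes {1..k} \<or> q permutes {Suc k..2 * k}"
  shows "vand (\<lambda>i. z (q i)) = of_int (sign q) * vand z"
  unfolding vand_def by (rule alternant_permute[OF _ block_permutes[OF q]]) simp

text \<open>One Vandermonde factor is split, and its cross differences turn \<open>G\<close> into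
  \<open>F\<close>; the other stays whole for the determinant. Reversing the \<open>k ^ 2\<close>
  cross differences costs \<open>(-1) ^ k\<close>, since \<open>k ^ 2\<close> and \<open>k\<close>
  have the same parity, and this cancels the sign in \<open>P\<close>.\<close>

lemma P_eq_tcoeff:
  "P k x = 1 / (fact k) ^ 2 * tcoeff \<rho> (2 * k)
     (\<lambda>z. F z * vand z * expw z * alternant {Suc k..2 * k} (\<lambda>i. i - Suc k) z * alternant {1..k} (\<lambda>i. i - 1) z) (\<lambda>_. 2 * k - 1)"
proof -
  let ?f = "\<lambda>z. F z * vand z * expw z * alternant {Suc k..2 * k} (\<lambda>i. i - Suc k) z * alternant {1..k} (\<lambda>i. i - 1) z"
  have f: "?f \<in> polydisc_alg \<rho> (2 * k)"
    by (intro pd.unif_closure_mult F vand_alg expw_alg polydisc_alg_alternant) auto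
  have "small_circ_int (2 * k) (\<lambda>z. G k z * Vandermonde (2 * k) z ^ 2 / (\<Prod>i\<in>{1..2*k}. z i ^ (2 * k))
        * exp (x / 2 * (\<Sum>i\<in>{1..k}. z i - z (i + k)))) =
     (2 * of_real pi * \<i>) ^ (2 * k) * tcoeff \<rho> (2 * k) (\<lambda>z. (-1) ^ k * ?f z) (\<lambda>_. 2 * k - 1)"
  proof (rule small_circ_int_eq[OF pd.unif_closure_cmult[OF f] \<rho>])
    fix z assume z: "z \<in> polydisc \<rho> (2 * k)" and inj: "inj_on z {1..2 * k}"
    define V1 where "V1 = alternant {1..k} (\<lambda>i. i - 1) z"
    define V2 where "V2 = alternant {Suc k..2 * k} (\<lambda>i. i - Suc k) z"
    define C where "C = (\<Prod>i\<in>{1..k}. \<Prod>j\<in>{1..k}. z i - z (j + k))"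
    have "(\<Prod>i\<in>{1..k}. \<Prod>j\<in>{1..k}. z (j + k) - z i) = (\<Prod>i\<in>{1..k}. \<Prod>j\<in>{1..k}. (-1) * (z i - z (j + k)))"
      by simp
    also have "\<dots> = ((-1) ^ k) ^ k * C"
      unfolding prod.distrib C_def by simp
    also have "((-1 :: complex) ^ k) ^ k = (-1) ^ k" by (cases "even k") auto
    finally have C: "(\<Prod>i\<in>{1..k}. \<Prod>j\<in>{1..k}. z (j + k) - z i) = (-1) ^ k * C" .
    have V: "Vandermonde (2 * k) z = vand z" unfolding vand_def by (rule Vandermonde_alternant)
    have V': "vand z = V1 * V2 * ((-1) ^ k * C)"
      unfolding V[symmetric] V1_def V2_def C[symmetric] by (rule Vandermonde_split)
    have "G k z * C = F z"
      unfolding F_eq[OF z inj, symmetric] G_def C_def by (simp add: prod.distrib mult_ac)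
    then have "G k z * vand z ^ 2 = (-1) ^ k * (F z * vand z * V2 * V1)"
      unfolding power2_eq_square by (subst (2) V') (simp add: mult_ac)
    moreover have "2 * k - 1 + 1 = 2 * k" using k by simp
    ultimately show "G k z * Vandermonde (2 * k) z ^ 2 / (\<Prod>i\<in>{1..2*k}. z i ^ (2 * k))
        * exp (x / 2 * (\<Sum>i\<in>{1..k}. z i - z (i + k))) = (-1) ^ k * ?f z / (\<Prod>i\<in>{1..2 * k}. z i ^ (2 * k - 1 + 1))"
      unfolding V exp_weight_eq by (simp add: expw_def weight_def V1_def V2_def)
  qed
  also have "tcoeff \<rho> (2 * k) (\<lambda>z. (-1) ^ k * ?f z) (\<lambda>_. 2 * k - 1) = (-1) ^ k * tcoeff \<rho> (2 * k) ?f (\<lambda>_. 2 * k - 1)"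
    by (rule bounded_functionalD(1)[OF bounded_functional_tcoeff[OF \<rho> order_refl] f])
  finally have S: "small_circ_int (2 * k) (\<lambda>z. G k z * Vandermonde (2 * k) z ^ 2 / (\<Prod>i\<in>{1..2*k}. z i ^ (2 * k))
        * exp (x / 2 * (\<Sum>i\<in>{1..k}. z i - z (i + k)))) =
     (2 * of_real pi * \<i>) ^ (2 * k) * ((-1) ^ k * tcoeff \<rho> (2 * k) ?f (\<lambda>_. 2 * k - 1))" .
  have cancel: "s / u * (1 / W) * (W * (s * t)) = s * s * (1 / u * t)" if "W \<noteq> 0" for s u t W :: complex
    using that by simp
  have W0: "(2 * of_real pi * \<i>) ^ (2 * k) \<noteq> (0 :: complex)" by simp
  have sq: "(-1) ^ k * (-1) ^ k = (1 :: complex)" by (simp flip: power_mult_distrib)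
  show ?thesis unfolding P_def S of_nat_fact cancel[OF W0] sq mult_1 ..
qed

text \<open>In each half the rest of the integrand is antisymmetric: \<open>vand\<close> changes
  sign, \<open>F\<close> and \<open>expw\<close> are symmetric, and the remaining factor does not
  involve that half. The two factors \<open>fact k\<close> cancel the normalisation of
  \<open>P\<close>.\<close>

lemma tcoeff_antisymmetrized:
  "tcoeff \<rho> (2 * k)
     (\<lambda>z. F z * vand z * expw z * alternant {Suc k..2 * k} (\<lambda>i. i - Suc k) z * alternant {1..k} (\<lambda>i. i - 1) z) (\<lambda>_. M) =
   (fact k) ^ 2 * tcoeff \<rho> (2 * k) (\<lambda>z. F z * vand z * expw z * monomial (2 * k) (row_degree k) z) (\<lambda>_. M)"
proof -
  let ?m1 = "\<lambda>z. \<Prod>i\<in>{1..k}. z i ^ (i - 1)" and ?m2 = "\<lambda>z. \<Prod>i\<in>{Suc k..2 * k}. z i ^ (i - Suc k)"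
  let ?V2 = "alternant {Suc k..2 * k} (\<lambda>i. i - Suc k)"
  have alg1: "(\<lambda>z. F z * vand z * expw z * ?V2 z) \<in> polydisc_alg \<rho> (2 * k)"
    by (intro pd.unif_closure_mult F vand_alg expw_alg polydisc_alg_alternant) auto
  have alg2: "(\<lambda>z. F z * vand z * expw z * ?m1 z) \<in> polydisc_alg \<rho> (2 * k)"
    by (intro pd.unif_closure_mult F vand_alg expw_alg polydisc_alg_monomial) auto
  have "tcoeff \<rho> (2 * k) (\<lambda>z. F z * vand z * expw z * ?V2 z * alternant {1..k} (\<lambda>i. i - 1) z) (\<lambda>_. M) =
     fact (card {1..k}) * tcoeff \<rho> (2 * k) (\<lambda>z. F z * vand z * expw z * ?V2 z * ?m1 z) (\<lambda>_. M)"
  proof (rule tcoeff_antisymmetric[OF alg1 \<rho> order_refl])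
    fix q z assume q: "q permutes {1..k}"
    have "?V2 (\<lambda>i. z (q i)) = ?V2 z"
      by (rule alternant_cong) (use permutes_not_in[OF q] in auto)
    then show "F (\<lambda>i. z (q i)) * vand (\<lambda>i. z (q i)) * expw (\<lambda>i. z (q i)) * ?V2 (\<lambda>i. z (q i)) =
        of_int (sign q) * (F z * vand z * expw z * ?V2 z)"
      using q by (simp add: F_permute vand_permute expw_permute)
  qed auto
  also have "(\<lambda>z. F z * vand z * expw z * ?V2 z * ?m1 z) = (\<lambda>z. F z * vand z * expw z * ?m1 z * ?V2 z)"
    by (simp add: mult_ac)
  also have "tcoeff \<rho> (2 * k) (\<lambda>z. F z * vand z * expw z * ?m1 z * ?V2 z) (\<lambda>_. M) =
     fact (card {Suc k..2 * k}) * tcoeff \<rho> (2 * k) (\<lambda>z. F z * vand z * expw z * ?m1 z * ?m2 z) (\<lambda>_. M)"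
  proof (rule tcoeff_antisymmetric[OF alg2 \<rho> order_refl])
    fix q and z :: "nat \<Rightarrow> complex" assume q: "q permutes {Suc k..2 * k}"
    have "?m1 (\<lambda>i. z (q i)) = ?m1 z"
      by (rule prod.cong) (use permutes_not_in[OF q] in auto)
    then show "F (\<lambda>i. z (q i)) * vand (\<lambda>i. z (q i)) * expw (\<lambda>i. z (q i)) * ?m1 (\<lambda>i. z (q i)) =
        of_int (sign q) * (F z * vand z * expw z * ?m1 z)"
      using q by (simp add: F_permute vand_permute expw_permute)
  qed auto
  also have "(\<lambda>z. F z * vand z * expw z * ?m1 z * ?m2 z) = (\<lambda>z. F z * vand z * expw z * monomial (2 * k) (row_degree k) z)"
  proof
    fix z
    have split: "{1..2 * k} = {1..k} \<union> {Suc k..2 * k}" by auto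
    have "monomial (2 * k) (row_degree k) z = (\<Prod>i\<in>{1..k}. z i ^ row_degree k i) * (\<Prod>i\<in>{Suc k..2 * k}. z i ^ row_degree k i)"
      unfolding monomial_def split by (rule prod.union_disjoint) auto
    also have "\<dots> = ?m1 z * ?m2 z"
      by (intro arg_cong2[of _ _ _ _ "(*)"] prod.cong) (auto simp: row_degree_def)
    finally show "F z * vand z * expw z * ?m1 z * ?m2 z = F z * vand z * expw z * monomial (2 * k) (row_degree k) z"
      by (simp add: mult_ac)
  qed
  finally show ?thesis by (simp add: power2_eq_square mult.assoc)
qed

lemma P_eq_sum:
  "P k x = (\<Sum>r\<in>{0..k ^ 2}. \<Sum>(\<alpha>, \<beta>)\<in>tuple_pairs k r.
      tcoeff \<rho> (2 * k) F (tuple_index k (\<alpha>, \<beta>)) * ((x / 2) ^ (k ^ 2 - r) * of_real (Mt k \<alpha> \<beta>)))"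
proof -
  \<comment> \<open>All Taylor exponents of total degree at most \<open>k ^ 2\<close>; the others
    are the ones whose residues vanish.\<close>
  define T where "T = (\<Union>r\<in>{0..k ^ 2}. tuple_pairs k r)"
  have finT: "finite T" unfolding T_def by (intro finite_UN_I finite_tuple_pairs) auto
  have lenT: "length (fst t) = k" "length (snd t) = k" if "t \<in> T" for t
    using that by (auto simp: T_def tuple_pairs_def)
  let ?c = "\<lambda>p a. \<Prod>i\<in>{1..2 * k}. exp_coeff (weight i) (exponent_gap k p a i)"
  let ?g = "\<lambda>p z. F z * (monomial (2 * k) (\<lambda>i. row_degree k i + (p i - 1)) z * expw z)"
  let ?S = "{p. p permutes {1..2 * k}}"
  have g: "?g p \<in> polydisc_alg \<rho> (2 * k)" for p
    by (intro pd.unif_closure_mult F expw_alg polydisc_alg_mono)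
  have coeff_g: "tcoeff \<rho> (2 * k) (?g p) (\<lambda>_. 2 * k - 1) = (\<Sum>t\<in>T. tcoeff \<rho> (2 * k) F (tuple_index k t) * ?c p (tuple_index k t))"
    if "p \<in> ?S" for p
  proof -
    from that have p: "p permutes {1..2 * k}" by simp
    show ?thesis unfolding expw_def exponent_gap_def
    proof (rule tcoeff_mult_exp[OF F \<rho> order_refl finT])
      fix t t' assume "t \<in> T" "t' \<in> T" "\<forall>i\<in>{1..2 * k}. tuple_index k t i = tuple_index k t' i"
      then show "t = t'" by (intro tuple_index_inj) (simp_all only: lenT)
    next
      fix \<alpha> assume no: "\<forall>t\<in>T. \<exists>i\<in>{1..2 * k}. tuple_index k t i \<noteq> \<alpha> i"
      have "(\<Sum>i\<in>{1..2 * k}. \<alpha> i) > k ^ 2"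
      proof (rule ccontr)
        assume "\<not> ?thesis"
        then obtain r t where "r \<le> k ^ 2" "t \<in> tuple_pairs k r" "\<forall>i\<in>{1..2 * k}. tuple_index k t i = \<alpha> i"
          using tuple_index_covers[where k = k and \<alpha> = \<alpha> and K = "k ^ 2"] unfolding not_less by blast
        moreover from this have "t \<in> T" by (auto simp: T_def)
        ultimately show False using no by blast
      qed
      from exp_coeff_prod_eq_0[OF k p this, of weight]
      show "(\<Prod>i\<in>{1..2 * k}. exp_coeff (weight i) (int (2 * k - 1) - int (row_degree k i + (p i - 1)) - int (\<alpha> i))) = 0"
        by (simp only: exponent_gap_def)
    qed
  qed
  \<comment> \<open>Leibniz expansion of \<open>vand\<close>: its exponents \<open>p i - 1\<close>
    are added to the staircase, leaving one monomial for each permutation.\<close>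
  have "(\<lambda>z. F z * vand z * expw z * monomial (2 * k) (row_degree k) z) = (\<lambda>z. \<Sum>p\<in>?S. of_int (sign p) * ?g p z)"
  proof
    fix z
    have "monomial (2 * k) (\<lambda>i. row_degree k i + (p i - 1)) z = monomial (2 * k) (row_degree k) z * (\<Prod>i\<in>{1..2 * k}. z i ^ (p i - 1))" for p
      by (simp add: monomial_add) (simp add: monomial_def)
    then show "F z * vand z * expw z * monomial (2 * k) (row_degree k) z = (\<Sum>p\<in>?S. of_int (sign p) * ?g p z)"
      by (simp add: vand_def alternant_def sum_distrib_left sum_distrib_right mult_ac)
  qed
  then have "P k x = tcoeff \<rho> (2 * k) (\<lambda>z. \<Sum>p\<in>?S. of_int (sign p) * ?g p z) (\<lambda>_. 2 * k - 1)"
    unfolding P_eq_tcoeff tcoeff_antisymmetrized by simp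
  also have "\<dots> = (\<Sum>p\<in>?S. of_int (sign p) * tcoeff \<rho> (2 * k) (?g p) (\<lambda>_. 2 * k - 1))"
    by (rule bounded_functional_lincomb[OF bounded_functional_tcoeff[OF \<rho> order_refl]])
      (use finite_permutations g in auto)
  also have "\<dots> = (\<Sum>p\<in>?S. \<Sum>t\<in>T. tcoeff \<rho> (2 * k) F (tuple_index k t) * (of_int (sign p) * ?c p (tuple_index k t)))"
  proof (rule sum.cong[OF refl])
    fix p assume p: "p \<in> ?S"
    show "of_int (sign p) * tcoeff \<rho> (2 * k) (?g p) (\<lambda>_. 2 * k - 1) =
      (\<Sum>t\<in>T. tcoeff \<rho> (2 * k) F (tuple_index k t) * (of_int (sign p) * ?c p (tuple_index k t)))"
      unfolding coeff_g[OF p] sum_distrib_left by (simp only: mult.left_commute)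
  qed
  also have "\<dots> = (\<Sum>t\<in>T. tcoeff \<rho> (2 * k) F (tuple_index k t) * (\<Sum>p\<in>?S. of_int (sign p) * ?c p (tuple_index k t)))"
    by (subst sum.swap) (simp only: sum_distrib_left)
  also have "\<dots> = (\<Sum>r\<in>{0..k ^ 2}. \<Sum>t\<in>tuple_pairs k r. tcoeff \<rho> (2 * k) F (tuple_index k t) * (\<Sum>p\<in>?S. of_int (sign p) * ?c p (tuple_index k t)))"
    unfolding T_def using finite_tuple_pairs by (intro sum.UNION_disjoint) (auto simp: tuple_pairs_def[THEN eqset_imp_iff])
  also have "\<dots> = (\<Sum>r\<in>{0..k ^ 2}. \<Sum>(\<alpha>, \<beta>)\<in>tuple_pairs k r.
      tcoeff \<rho> (2 * k) F (tuple_index k (\<alpha>, \<beta>)) * ((x / 2) ^ (k ^ 2 - r) * of_real (Mt k \<alpha> \<beta>)))"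
  proof (rule sum.cong[OF refl], rule sum.cong[OF refl])
    fix r t assume r: "r \<in> {0..k ^ 2}" and t: "t \<in> tuple_pairs k r"
    obtain \<alpha> \<beta> where tt: "t = (\<alpha>, \<beta>)" by (cases t)
    have len: "length \<alpha> = k" "length \<beta> = k" "sum_list \<alpha> + sum_list \<beta> = r" using t by (auto simp: tt tuple_pairs_def)
    have "(\<Sum>p\<in>?S. of_int (sign p) * ?c p (tuple_index k t)) = (x / 2) ^ (k ^ 2 - r) * of_real (Mt k \<alpha> \<beta>)"
      using Mt_exp_coeff[OF k len(1,2), of x] r unfolding len(3) tt weight_def by (simp only: atLeastAtMost_iff)
    then show "tcoeff \<rho> (2 * k) F (tuple_index k t) * (\<Sum>p\<in>?S. of_int (sign p) * ?c p (tuple_index k t)) =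
      (case t of (\<alpha>, \<beta>) \<Rightarrow> tcoeff \<rho> (2 * k) F (tuple_index k (\<alpha>, \<beta>)) * ((x / 2) ^ (k ^ 2 - r) * of_real (Mt k \<alpha> \<beta>)))"
      by (simp only: tt prod.case)
  qed
  finally show ?thesis .
qed

lemma b_eq: "b k \<alpha> \<beta> = tcoeff \<rho> (2 * k) F (tuple_index k (\<alpha>, \<beta>)) / of_real (a_const k)"
proof -
  have "b k \<alpha> \<beta> = tcoeff \<rho> (2 * k) (\<lambda>z. 1 / of_real (a_const k) * F z) (tuple_index k (\<alpha>, \<beta>))"
    unfolding b_def tuple_index_def fst_conv snd_conv
    by (rule taylor_coeff_eq[OF pd.unif_closure_cmult[OF F] \<rho>]) (simp add: F_eq[symmetric])
  also have "\<dots> = 1 / of_real (a_const k) * tcoeff \<rho> (2 * k) F (tuple_index k (\<alpha>, \<beta>))"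
    by (rule bounded_functionalD(1)[OF bounded_functional_tcoeff[OF \<rho> order_refl] F])
  finally show ?thesis by simp
qed

lemma tcoeff_permute:
  assumes q: "q permutes {1..k} \<or> q permutes {Suc k..2 * k}"
  shows "tcoeff \<rho> (2 * k) F (\<lambda>i. a (q i)) = tcoeff \<rho> (2 * k) F a"
  using tcoeff_twist[OF F \<rho> order_refl block_permutes[OF q], of 1 a] by (simp add: F_permute[OF q])

text \<open>\<open>F\<close> is symmetric in each half, and the halves are rearranged one after the
  other.\<close>

lemma b_permute:
  assumes len: "length \<alpha> = k" "length \<beta> = k" and ms: "mset \<sigma> = mset \<alpha>" "mset \<tau> = mset \<beta>"
  shows "b k \<sigma> \<tau> = b k \<alpha> \<beta>"
proof -
  obtain q where q: "q permutes {Suc 0..0 + k}" "\<And>i. i \<in> {Suc 0..0 + k} \<Longrightarrow> \<sigma> ! (i - Suc 0) = \<alpha> ! (q i - Suc 0)"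
    using list_permutation_block[OF ms(1) len(1)] by metis
  have q': "q permutes {1..k}" using q(1) by simp
  have "tuple_index k (\<sigma>, \<tau>) = (\<lambda>i. tuple_index k (\<alpha>, \<tau>) (q i))"
  proof
    fix i
    show "tuple_index k (\<sigma>, \<tau>) i = tuple_index k (\<alpha>, \<tau>) (q i)"
      using q(2)[of i] permutes_in_image[OF q', of i] permutes_not_in[OF q', of i]
      by (auto simp: tuple_index_def)
  qed
  then have 1: "tcoeff \<rho> (2 * k) F (tuple_index k (\<sigma>, \<tau>)) = tcoeff \<rho> (2 * k) F (tuple_index k (\<alpha>, \<tau>))"
    using tcoeff_permute[OF disjI1[OF q']] by simp
  obtain q where q: "q permutes {Suc k..k + k}" "\<And>i. i \<in> {Suc k..k + k} \<Longrightarrow> \<tau> ! (i - Suc k) = \<beta> ! (q i - Suc k)"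
    using list_permutation_block[OF ms(2) len(2)] by metis
  have q': "q permutes {Suc k..2 * k}" using q(1) by (simp add: mult_2)
  have "tuple_index k (\<alpha>, \<tau>) = (\<lambda>i. tuple_index k (\<alpha>, \<beta>) (q i))"
  proof
    fix i
    show "tuple_index k (\<alpha>, \<tau>) i = tuple_index k (\<alpha>, \<beta>) (q i)"
      using q(2)[of i] permutes_in_image[OF q', of i] permutes_not_in[OF q', of i]
      by (cases "i \<in> {Suc k..2 * k}") (auto simp: tuple_index_def)
  qed
  then have "tcoeff \<rho> (2 * k) F (tuple_index k (\<alpha>, \<tau>)) = tcoeff \<rho> (2 * k) F (tuple_index k (\<alpha>, \<beta>))"
    using tcoeff_permute[OF disjI2[OF q']] by simp
  with 1 show ?thesis by (simp only: b_eq)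
qed

lemma b_swap:
  assumes len: "length \<alpha> = k" "length \<beta> = k"
  shows "b k \<beta> \<alpha> = (-1) ^ (sum_list \<alpha> + sum_list \<beta>) * b k \<alpha> \<beta>"
proof -
  have "(\<lambda>i. tuple_index k (\<beta>, \<alpha>) (half_swap k i)) = tuple_index k (\<alpha>, \<beta>)"
    by (auto simp: fun_eq_iff tuple_index_def half_swap_def)
  then have "tcoeff \<rho> (2 * k) F (tuple_index k (\<beta>, \<alpha>)) =
     (-1) ^ (sum_list \<beta> + sum_list \<alpha>) * tcoeff \<rho> (2 * k) F (tuple_index k (\<alpha>, \<beta>))"
    using tcoeff_twist[OF F \<rho> order_refl half_swap_permutes, of "-1" "tuple_index k (\<beta>, \<alpha>)"]
      sum_tuple_index[of "(\<beta>, \<alpha>)" k] len by (simp add: F_swap)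
  then show ?thesis by (simp add: b_eq add.commute)
qed

text \<open>\<open>b\<close> and \<open>N\<close> acquire the same sign when the partitions are
  exchanged, so their product is symmetric and the lexicographic restriction can be lifted. Since
  \<open>b\<close> is constant on rearrangements, it moves inside the sum in \<open>N\<close>; the
  factorials and \<open>a_const k\<close> then cancel.\<close>

lemma coeff_c_eq:
  assumes r: "r \<le> k ^ 2"
  shows "coeff_c k r * x ^ (k ^ 2 - r) = (\<Sum>(\<alpha>, \<beta>)\<in>tuple_pairs k r.
      tcoeff \<rho> (2 * k) F (tuple_index k (\<alpha>, \<beta>)) * ((x / 2) ^ (k ^ 2 - r) * of_real (Mt k \<alpha> \<beta>)))"
proof -
  define c where "c = (\<Prod>l<k. fact l / fact (k + l) :: real)"
  \<comment> \<open>The power of 2 contained in \<open>N\<close>; it turns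
    \<open>x ^ (k ^ 2 - r)\<close> into a power of \<open>x / 2\<close>.\<close>
  define h :: complex where "h = 1 / 2 ^ (k ^ 2 - r)"
  have c0: "c \<noteq> 0" by (simp add: c_def)
  have a0: "a_const k \<noteq> 0" by (rule a_const_nonzero[OF k])
  have sym: "b k \<beta> \<alpha> * of_real (N k \<beta> \<alpha>) = b k \<alpha> \<beta> * of_real (N k \<alpha> \<beta>)"
    if "(\<alpha>, \<beta>) \<in> partition_pairs k r" for \<alpha> \<beta>
  proof -
    have len: "length \<alpha> = k" "length \<beta> = k" using that by (auto simp: partition_pairs_def is_partition_k_def)
    have "((-1 :: complex) ^ m) * (-1) ^ m = 1" for m by (simp flip: power_mult_distrib)
    then show ?thesis unfolding b_swap[OF len] N_swap[of k \<beta> \<alpha>]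
      by (simp add: mult_ac)
  qed
  have NM: "b k \<alpha> \<beta> * of_real (N k \<alpha> \<beta>) = h / of_real c *
      (\<Sum>\<sigma>\<in>rearrangements \<alpha>. \<Sum>\<tau>\<in>rearrangements \<beta>. b k \<sigma> \<tau> * of_real (Mt k \<sigma> \<tau>))"
    if "(\<alpha>, \<beta>) \<in> partition_pairs k r" for \<alpha> \<beta>
  proof -
    have len: "length \<alpha> = k" "length \<beta> = k" and sum: "sum_list \<alpha> + sum_list \<beta> = r"
      using that by (auto simp: partition_pairs_def is_partition_k_def)
    have "(\<Sum>\<sigma>\<in>rearrangements \<alpha>. \<Sum>\<tau>\<in>rearrangements \<beta>. b k \<sigma> \<tau> * of_real (Mt k \<sigma> \<tau>)) =
      (\<Sum>\<sigma>\<in>rearrangements \<alpha>. \<Sum>\<tau>\<in>rearrangements \<beta>. b k \<alpha> \<beta> * of_real (Mt k \<sigma> \<tau>))"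
    proof (intro sum.cong refl)
      fix \<sigma> \<tau> assume "\<sigma> \<in> rearrangements \<alpha>" "\<tau> \<in> rearrangements \<beta>"
      then have "b k \<sigma> \<tau> = b k \<alpha> \<beta>"
        by (intro b_permute[OF len]) (simp_all add: permutations_of_multiset_def)
      then show "b k \<sigma> \<tau> * of_real (Mt k \<sigma> \<tau>) = b k \<alpha> \<beta> * of_real (Mt k \<sigma> \<tau>)" by (simp only:)
    qed
    then show ?thesis
      unfolding N_def sum c_def[symmetric] by (simp add: h_def sum_distrib_left sum_distrib_right divide_inverse mult_ac)
  qed
  have "coeff_c k r = of_real (a_const k * c) * (\<Sum>(\<alpha>, \<beta>)\<in>{(\<alpha>, \<beta>). is_partition_k k \<alpha> \<and> is_partition_k k \<beta> \<and>
       sum_list \<alpha> + sum_list \<beta> = r \<and> lex_ge \<alpha> \<beta>}. 2 ^ (if \<alpha> = \<beta> then 0 else 1) * (b k \<alpha> \<beta> * of_real (N k \<alpha> \<beta>)))"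
    unfolding coeff_c_def c_def[symmetric] 
    by (intro arg_cong2[of _ _ _ _ "(*)"] sum.cong refl) (auto simp: mult_ac)
  also have "\<dots> = of_real (a_const k * c) * (\<Sum>(\<alpha>, \<beta>)\<in>partition_pairs k r. b k \<alpha> \<beta> * of_real (N k \<alpha> \<beta>))"
    by (subst sum_partition_pairs_lex[OF sym]) auto
  also have "(\<Sum>(\<alpha>, \<beta>)\<in>partition_pairs k r. b k \<alpha> \<beta> * of_real (N k \<alpha> \<beta>)) =
     (\<Sum>(\<alpha>, \<beta>)\<in>partition_pairs k r. h / of_real c * (\<Sum>\<sigma>\<in>rearrangements \<alpha>.
        \<Sum>\<tau>\<in>rearrangements \<beta>. b k \<sigma> \<tau> * of_real (Mt k \<sigma> \<tau>)))"
    by (rule sum.cong) (auto simp: NM)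
  also have "\<dots> = h / of_real c * (\<Sum>(\<alpha>, \<beta>)\<in>partition_pairs k r. \<Sum>\<sigma>\<in>rearrangements \<alpha>.
        \<Sum>\<tau>\<in>rearrangements \<beta>. b k \<sigma> \<tau> * of_real (Mt k \<sigma> \<tau>))"
    by (simp add: sum_distrib_left case_prod_beta)
  also have "\<dots> = h / of_real c * (\<Sum>(\<alpha>, \<beta>)\<in>tuple_pairs k r. b k \<alpha> \<beta> * of_real (Mt k \<alpha> \<beta>))"
    by (simp only: sum_tuple_pairs[symmetric])
  finally have "coeff_c k r = of_real (a_const k) * h * (\<Sum>(\<alpha>, \<beta>)\<in>tuple_pairs k r. b k \<alpha> \<beta> * of_real (Mt k \<alpha> \<beta>))"
    using c0 by simp
  also have "\<dots> = h * (\<Sum>(\<alpha>, \<beta>)\<in>tuple_pairs k r. tcoeff \<rho> (2 * k) F (tuple_index k (\<alpha>, \<beta>)) * of_real (Mt k \<alpha> \<beta>))"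
    using a0 by (simp add: b_eq sum_distrib_left case_prod_beta)
  finally show ?thesis
    by (simp add: h_def sum_distrib_left sum_distrib_right case_prod_beta power_divide mult_ac)
qed

lemma P_eq_sum_coeff_c: "P k x = (\<Sum>r\<in>{0..k^2}. coeff_c k r * x ^ (k^2 - r))"
  unfolding P_eq_sum by (rule sum.cong) (simp_all add: coeff_c_eq)

end

theorem theorem1:
  fixes k :: nat and x :: complex
  assumes "k \<ge> 1"
  shows "P k x = (\<Sum>r\<in>{0..k^2}. coeff_c k r * x ^ (k^2 - r))"
proof -
  obtain F \<rho> where "\<rho> > 0" "F \<in> polydisc_alg \<rho> (2 * k)"
    "\<And>z. z \<in> polydisc \<rho> (2 * k) \<Longrightarrow> inj_on z {1..2 * k} \<Longrightarrow>
       A k z * (\<Prod>i\<in>{1..k}. \<Prod>j\<in>{1..k}. (z i - z (j + k)) * zeta (1 + z i - z (j + k))) = F z"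
    "\<And>q z. q permutes {1..k} \<or> q permutes {Suc k..2 * k} \<Longrightarrow> F (\<lambda>i. z (q i)) = F z"
    "\<And>z. F (\<lambda>i. - z (half_swap k i)) = F z"
    by (rule regular_part[where k = k]) (rule that)
  from P_eq_sum_coeff_c[OF assms this] show ?thesis .
qed

end
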